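(* Suppose $(K,\mathcal{L})$ is a $C$-minimal valued field such that $(\Gamma_K,\mathcal{L}_{ind})$ is $\mathbb{Q}$-linearly bounded. Then $(K,\mathcal{L})$ is uniformly polynomially bounded.
   Context: Valued fields $(K,v)$ are non-trivially valued; $\Gamma_K$ is the value group. Closed balls are $B(a,\gamma)=\{x\in K: v(x-a)\geq\gamma\}$ for $a \in K$, $\gamma\in\Gamma_K\cup\{+\infty\}$; open balls are $B^\circ(a,\gamma)=\{x\in K: v(x-a)>\gamma\}$ for $a\in K$, $\gamma\in\Gamma_K\cup\{-\infty\}$ (so points are closed balls and $K$ is an open ball). A ball is a closed or an open ball. $\mathcal{L}_{div}=(+,-,\cdot,0,1,\mathrm{div})$ is the language of valued fields, with $\mathrm{div}(x,y)$ interpreted as $v(x)\leq v(y)$. Let $K$ be an algebraically closed valued field and $(K,\mathcal{L})$ an expansion of $(K,\mathcal{L}_{div})$ ($\mathcal{L}\supseteq\mathcal{L}_{div}$). $(K,\mathcal{L})$ is $C$-minimal (a "$C$-minimal valued field") if for every structure $(K',\mathcal{L})$ elementarily equivalent to it, every $\mathcal{L}$-definable subset of $K'$ is a boolean combination of balls. "Definable" means $\mathcal{L}$-definable with parameters; for subsets of (products involving) $\Gamma_K$ it means interpretable. $(\Gamma_K,\mathcal{L}_{ind})$ is $\Gamma_K$ with the induced structure, consisting of all $\emptyset$-$\mathcal{L}$-interpretable subsets of cartesian powers of $\Gamma_K$. It is $\mathbb{Q}$-linearly bounded if for every $\mathcal{L}_{ind}$-definable (with parameters) function $g\colon\Gamma_K\to\Gamma_K$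 there are an integer $n$ and $a\in\Gamma_K$ such that $|g(x)|<|nx|$ for all $x \in \Gamma_K$ with $|x|>|a|$. A definable family $X\subseteq W\times K$ is a definable set whose projection to the definable set $W$ is all of $W$; $X_w=\{x: (w,x)\in X\}$. A definable family of functions is a definable function $f\colon X\subseteq W\times K\to K$, with fibers $f_w\colon X_w\to K$, $f_w(x)=f(w,x)$. $(K,\mathcal{L})$ is uniformly polynomially bounded if for every definable set $W$ and every definable family of functions $f\colon X\subseteq W\times K\to K$ there are an integer $n$ and a definable function $a\colon W\to\Gamma_K$ such that for each $w\in W$, $v(f_w(x))>nv(x)$ for all $x\in X_w$ with $v(x)<a(w)$. (Here $v(0)=+\infty$.) *)

theory Defs
  imports
    "HOL-Computational_Algebra.Polynomial"
    "HOL-Library.Extended"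
    "HOL-Library.Equipollence"
begin

section \<open>First-order languages and structures\<close>

text \<open>
  A symbol of a language is a name together with an arity, so that arbitrary (in particular
  arbitrarily large) one-sorted languages are covered. Variables are natural numbers and
  structures have an explicit carrier; the interpretations are only meaningful on argument lists
  of the right length with entries in the carrier.
\<close>

datatype 'f trm = Var nat | Fun 'f "'f trm list"

datatype ('f, 'r) fm =
    Equal "'f trm" "'f trm"
  | Rel 'r "'f trm list"
  | Neg "('f, 'r) fm"
  | Conj "('f, 'r) fm" "('f, 'r) fm"
  | Exi nat "('f, 'r) fm"

record ('f, 'r) lang =
  funs :: "('f \<times> nat) set"
  rels :: "('r \<times> nat) set"

record ('a, 'f, 'r) struct =
  carr :: "'a set"
  fn_int :: "'f \<Rightarrow> 'a list \<Rightarrow> 'a"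
  rel_int :: "'r \<Rightarrow> 'a list \<Rightarrow> bool"

primrec wf_trm :: "('f, 'r) lang \<Rightarrow> 'f trm \<Rightarrow> bool" where
  "wf_trm L (Var i) \<longleftrightarrow> True"
| "wf_trm L (Fun f ts) \<longleftrightarrow> (f, length ts) \<in> funs L \<and> list_all (wf_trm L) ts"

primrec wf_fm :: "('f, 'r) lang \<Rightarrow> ('f, 'r) fm \<Rightarrow> bool" where
  "wf_fm L (Equal s t) \<longleftrightarrow> wf_trm L s \<and> wf_trm L t"
| "wf_fm L (Rel r ts) \<longleftrightarrow> (r, length ts) \<in> rels L \<and> list_all (wf_trm L) ts"
| "wf_fm L (Neg p) \<longleftrightarrow> wf_fm L p"
| "wf_fm L (Conj p q) \<longleftrightarrow> wf_fm L p \<and> wf_fm L q"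
| "wf_fm L (Exi i p) \<longleftrightarrow> wf_fm L p"

primrec fv_trm :: "'f trm \<Rightarrow> nat set" where
  "fv_trm (Var i) = {i}"
| "fv_trm (Fun f ts) = \<Union>(set (map fv_trm ts))"

primrec fv :: "('f, 'r) fm \<Rightarrow> nat set" where
  "fv (Equal s t) = fv_trm s \<union> fv_trm t"
| "fv (Rel r ts) = (\<Union>t\<in>set ts. fv_trm t)"
| "fv (Neg p) = fv p"
| "fv (Conj p q) = fv p \<union> fv q"
| "fv (Exi i p) = fv p - {i}"

primrec tval :: "('a, 'f, 'r) struct \<Rightarrow> (nat \<Rightarrow> 'a) \<Rightarrow> 'f trm \<Rightarrow> 'a" where
  "tval M e (Var i) = e i"
| "tval M e (Fun f ts) = fn_int M f (map (tval M e) ts)"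

primrec sat :: "('a, 'f, 'r) struct \<Rightarrow> (nat \<Rightarrow> 'a) \<Rightarrow> ('f, 'r) fm \<Rightarrow> bool" where
  "sat M e (Equal s t) \<longleftrightarrow> tval M e s = tval M e t"
| "sat M e (Rel r ts) \<longleftrightarrow> rel_int M r (map (tval M e) ts)"
| "sat M e (Neg p) \<longleftrightarrow> \<not> sat M e p"
| "sat M e (Conj p q) \<longleftrightarrow> sat M e p \<and> sat M e q"
| "sat M e (Exi i p) \<longleftrightarrow> (\<exists>x\<in>carr M. sat M (e(i := x)) p)"

definition is_struct :: "('f, 'r) lang \<Rightarrow> ('a, 'f, 'r) struct \<Rightarrow> bool" where
  "is_struct L M \<longleftrightarrow> carr M \<noteq> {} \<and>
     (\<forall>(f, n)\<in>funs L. \<forall>xs. length xs = n \<and> set xs \<subseteq> carr M \<longrightarrow> fn_int M f xs \<in> carr M)"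

definition elem_equiv ::
  "('f, 'r) lang \<Rightarrow> ('a, 'f, 'r) struct \<Rightarrow> ('b, 'f, 'r) struct \<Rightarrow> bool" where
  "elem_equiv L M N \<longleftrightarrow> (\<forall>p. wf_fm L p \<and> fv p = {} \<longrightarrow>
     (\<forall>d e. range d \<subseteq> carr M \<and> range e \<subseteq> carr N \<longrightarrow> sat M d p = sat N e p))"

text \<open>
  Subsets of the \<open>n\<close>-th cartesian power are sets of lists of length \<open>n\<close>. The variables
  \<open>0, \<dots>, n - 1\<close> stand for the entries of the list and all other variables are assigned
  parameters by \<open>e\<close>; a formula uses only finitely many of them.
\<close>

definition assign :: "'a list \<Rightarrow> (nat \<Rightarrow> 'a) \<Rightarrow> nat \<Rightarrow> 'a" where
  "assign xs e i = (if i < length xs then xs ! i else e i)"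

definition solutions ::
  "('a, 'f, 'r) struct \<Rightarrow> nat \<Rightarrow> (nat \<Rightarrow> 'a) \<Rightarrow> ('f, 'r) fm \<Rightarrow> 'a list set" where
  "solutions M n e p = {xs. length xs = n \<and> set xs \<subseteq> carr M \<and> sat M (assign xs e) p}"

definition definable ::
  "('f, 'r) lang \<Rightarrow> ('a, 'f, 'r) struct \<Rightarrow> nat \<Rightarrow> 'a list set \<Rightarrow> bool" where
  "definable L M n X \<longleftrightarrow>
     (\<exists>p e. wf_fm L p \<and> range e \<subseteq> carr M \<and> X = solutions M n e p)"

definition zero_definable ::
  "('f, 'r) lang \<Rightarrow> ('a, 'f, 'r) struct \<Rightarrow> nat \<Rightarrow> 'a list set \<Rightarrow> bool" where
  "zero_definable L M n X \<longleftrightarrow>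
     (\<exists>p e. wf_fm L p \<and> fv p \<subseteq> {..<n} \<and> range e \<subseteq> carr M \<and> X = solutions M n e p)"


section \<open>Valued fields and their expansions\<close>

text \<open>
  The value group is the whole type \<open>'g\<close>; \<open>Fin\<close> embeds it into \<open>'g extended\<close>, which also
  contains \<open>+\<infinity>\<close> and \<open>-\<infinity>\<close>.
\<close>

definition valuation ::
  "('k::field \<Rightarrow> 'g::linordered_ab_group_add extended) \<Rightarrow> bool" where
  "valuation v \<longleftrightarrow>
     (\<forall>x. v x \<noteq> -\<infinity>) \<and> (\<forall>x. v x = \<infinity> \<longleftrightarrow> x = 0) \<and>
     (\<forall>x y. v (x * y) = v x + v y) \<and> (\<forall>x y. min (v x) (v y) \<le> v (x + y)) \<and>
     (\<forall>\<gamma>. \<exists>x. v x = Fin \<gamma>)"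

datatype 'f vf_fun = Zero | One | Add | Sub | Mul | OtherFun 'f

datatype 'r vf_rel = Div | OtherRel 'r

definition L_div :: "('f vf_fun, 'r vf_rel) lang" where
  "L_div = \<lparr>funs = {(Zero, 0), (One, 0), (Add, 2), (Sub, 2), (Mul, 2)}, rels = {(Div, 2)}\<rparr>"

definition extends_L_div :: "('f vf_fun, 'r vf_rel) lang \<Rightarrow> bool" where
  "extends_L_div L \<longleftrightarrow>
     funs (L_div :: ('f vf_fun, 'r vf_rel) lang) \<subseteq> funs L \<and>
     rels (L_div :: ('f vf_fun, 'r vf_rel) lang) \<subseteq> rels L"

text \<open>
  \<open>M\<close> is an \<open>L\<close>-expansion of the non-trivially valued field with underlying field the type \<open>'k\<close>
  and valuation \<open>v\<close>.
\<close>

definition expands_valued_field ::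
  "('f vf_fun, 'r vf_rel) lang \<Rightarrow> ('k::field, 'f vf_fun, 'r vf_rel) struct
    \<Rightarrow> ('k \<Rightarrow> 'g::linordered_ab_group_add extended) \<Rightarrow> bool" where
  "expands_valued_field L M v \<longleftrightarrow>
     valuation v \<and> (\<exists>\<gamma>::'g. \<gamma> \<noteq> 0) \<and> extends_L_div L \<and> carr M = UNIV \<and>
     fn_int M Zero [] = 0 \<and> fn_int M One [] = 1 \<and>
     (\<forall>x y. fn_int M Add [x, y] = x + y) \<and>
     (\<forall>x y. fn_int M Sub [x, y] = x - y) \<and>
     (\<forall>x y. fn_int M Mul [x, y] = x * y) \<and>
     (\<forall>x y. rel_int M Div [x, y] \<longleftrightarrow> v x \<le> v y)"


section \<open>C-minimality\<close>

text \<open>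
  Structures elementarily equivalent to a valued field come without a chosen valuation map. In
  them, balls are expressed by \<open>div\<close>: a value is \<open>v b\<close> for some \<open>b\<close>, where \<open>b = 0\<close> gives
  \<open>+\<infinity>\<close>. Lemma \<open>balls_valued\<close> below recovers the description by \<open>v\<close>.
\<close>

definition closed_ball ::
  "('a, 'f vf_fun, 'r vf_rel) struct \<Rightarrow> 'a \<Rightarrow> 'a \<Rightarrow> 'a set" where
  "closed_ball N a b = {x \<in> carr N. rel_int N Div [b, fn_int N Sub [x, a]]}"

definition open_ball ::
  "('a, 'f vf_fun, 'r vf_rel) struct \<Rightarrow> 'a \<Rightarrow> 'a \<Rightarrow> 'a set" where
  "open_ball N a b = {x \<in> carr N. \<not> rel_int N Div [fn_int N Sub [x, a], b]}"

definition balls :: "('a, 'f vf_fun, 'r vf_rel) struct \<Rightarrow> 'a set set" where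
  "balls N = {closed_ball N a b |a b. a \<in> carr N \<and> b \<in> carr N}
     \<union> {open_ball N a b |a b. a \<in> carr N \<and> b \<in> carr N \<and> b \<noteq> fn_int N Zero []}
     \<union> {carr N}"

inductive_set boolean_combinations :: "'a set \<Rightarrow> 'a set set \<Rightarrow> 'a set set"
  for C :: "'a set" and B :: "'a set set" where
  basic: "S \<in> B \<Longrightarrow> S \<in> boolean_combinations C B"
| compl: "S \<in> boolean_combinations C B \<Longrightarrow> C - S \<in> boolean_combinations C B"
| union: "S \<in> boolean_combinations C B \<Longrightarrow> T \<in> boolean_combinations C B
    \<Longrightarrow> S \<union> T \<in> boolean_combinations C B"

definition definable_subsets_from_balls ::
  "('f vf_fun, 'r vf_rel) lang \<Rightarrow> ('a, 'f vf_fun, 'r vf_rel) struct \<Rightarrow> bool" where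
  "definable_subsets_from_balls L N \<longleftrightarrow>
     (\<forall>S. definable L N 1 ((\<lambda>x. [x]) ` S) \<longrightarrow> S \<in> boolean_combinations (carr N) (balls N))"

text \<open>
  A formula cannot quantify over types, so the structures elementarily equivalent to \<open>M\<close> range
  over those whose carrier is a set of elements of one type of cardinality at least
  \<open>\<bar>L\<bar> + \<aleph>\<^sub>0\<close>. This is no restriction: theorem \<open>C_minimal_all_types\<close> below (downward
  Loewenheim-Skolem) extends the conclusion to structures over every type.
\<close>

type_synonym ('k, 'f, 'r) big = "'k + 'f + 'r + nat"

definition C_minimal ::
  "('f vf_fun, 'r vf_rel) lang \<Rightarrow> ('k, 'f vf_fun, 'r vf_rel) struct \<Rightarrow> bool" where
  "C_minimal L M \<longleftrightarrow>
     (\<forall>N :: (('k, 'f, 'r) big, 'f vf_fun, 'r vf_rel) struct.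
        is_struct L N \<and> elem_equiv L M N \<longrightarrow> definable_subsets_from_balls L N)"


section \<open>Interpretable sets and the induced structure on the value group\<close>

text \<open>
  Tuples from products of powers of \<open>K\<close> and of the value group are pairs of lists. A subset of such a
  product is interpretable iff its preimage under the valuation, which is a subset of a power of
  \<open>K\<close>, is definable. Note that \<open>map v ys = map Fin gs\<close> forces the entries of \<open>ys\<close> to be non-zero.
\<close>

definition pullback ::
  "('k \<Rightarrow> 'g extended) \<Rightarrow> ('k list \<times> 'g list) set \<Rightarrow> 'k list set" where
  "pullback v D = {xs @ ys |xs ys gs. (xs, gs) \<in> D \<and> map v ys = map Fin gs}"

definition interpretable ::
  "('f, 'r) lang \<Rightarrow> ('k, 'f, 'r) struct \<Rightarrow> ('k \<Rightarrow> 'g extended) \<Rightarrow> nat \<Rightarrow> nat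
    \<Rightarrow> ('k list \<times> 'g list) set \<Rightarrow> bool" where
  "interpretable L M v m k D \<longleftrightarrow>
     (\<forall>(xs, gs)\<in>D. length xs = m \<and> length gs = k) \<and> definable L M (m + k) (pullback v D)"

definition zero_interpretable ::
  "('f, 'r) lang \<Rightarrow> ('k, 'f, 'r) struct \<Rightarrow> ('k \<Rightarrow> 'g extended) \<Rightarrow> nat \<Rightarrow> nat
    \<Rightarrow> ('k list \<times> 'g list) set \<Rightarrow> bool" where
  "zero_interpretable L M v m k D \<longleftrightarrow>
     (\<forall>(xs, gs)\<in>D. length xs = m \<and> length gs = k) \<and> zero_definable L M (m + k) (pullback v D)"

text \<open>The induced language has one relation symbol, the set itself, for each
  parameter-free interpretable set, and no function symbols.\<close>

definition L_ind ::
  "('f, 'r) lang \<Rightarrow> ('k, 'f, 'r) struct \<Rightarrow> ('k \<Rightarrow> 'g extended)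
    \<Rightarrow> (unit, 'g list set) lang" where
  "L_ind L M v = \<lparr>funs = {}, rels = {(D, k). zero_interpretable L M v 0 k ({[]} \<times> D)}\<rparr>"

definition Gamma_ind :: "('g::zero, unit, 'g list set) struct" where
  "Gamma_ind = \<lparr>carr = UNIV, fn_int = (\<lambda>_ _. 0), rel_int = (\<lambda>D xs. xs \<in> D)\<rparr>"

definition int_mult :: "int \<Rightarrow> 'g::ab_group_add \<Rightarrow> 'g" where
  "int_mult n x = (if 0 \<le> n then (\<Sum>i<nat n. x) else - (\<Sum>i<nat (- n). x))"

definition Q_linearly_bounded ::
  "('f, 'r) lang \<Rightarrow> ('g::{linordered_ab_group_add, ordered_ab_group_add_abs}, 'f, 'r) struct
    \<Rightarrow> bool" where
  "Q_linearly_bounded L G \<longleftrightarrow>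
     (\<forall>g :: 'g \<Rightarrow> 'g. definable L G 2 (range (\<lambda>x. [x, g x])) \<longrightarrow>
        (\<exists>(n::int) a. \<forall>x. \<bar>x\<bar> > \<bar>a\<bar> \<longrightarrow> \<bar>g x\<bar> < \<bar>int_mult n x\<bar>))"


section \<open>Uniform polynomial boundedness\<close>

text \<open>
  The parameter set \<open>W\<close> may involve the value group: \<open>W \<subseteq> K\<^sup>m \<times> \<Gamma>\<^sup>k\<close>, so that
  \<open>W \<subseteq> K\<^sup>m\<close> is the case \<open>k = 0\<close>. The functions \<open>f\<close> and \<open>a\<close> are total in HOL, only their
  restrictions to \<open>X\<close> and \<open>W\<close> matter.
\<close>

definition definable_family ::
  "('f, 'r) lang \<Rightarrow> ('k, 'f, 'r) struct \<Rightarrow> ('k \<Rightarrow> 'g extended) \<Rightarrow> nat \<Rightarrow> nat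
    \<Rightarrow> ('k list \<times> 'g list) set \<Rightarrow> (('k list \<times> 'g list) \<times> 'k) set \<Rightarrow> bool" where
  "definable_family L M v m k W X \<longleftrightarrow>
     interpretable L M v m k W \<and> fst ` X = W \<and>
     interpretable L M v (m + 1) k {(xs @ [x], gs) |xs gs x. ((xs, gs), x) \<in> X}"

definition definable_function_family ::
  "('f, 'r) lang \<Rightarrow> ('k, 'f, 'r) struct \<Rightarrow> ('k \<Rightarrow> 'g extended) \<Rightarrow> nat \<Rightarrow> nat
    \<Rightarrow> ('k list \<times> 'g list) set \<Rightarrow> (('k list \<times> 'g list) \<times> 'k) set
    \<Rightarrow> ('k list \<times> 'g list \<Rightarrow> 'k \<Rightarrow> 'k) \<Rightarrow> bool" where
  "definable_function_family L M v m k W X f \<longleftrightarrow>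
     definable_family L M v m k W X \<and>
     interpretable L M v (m + 2) k
       {(xs @ [x, f (xs, gs) x], gs) |xs gs x. ((xs, gs), x) \<in> X}"

definition definable_value_function ::
  "('f, 'r) lang \<Rightarrow> ('k, 'f, 'r) struct \<Rightarrow> ('k \<Rightarrow> 'g extended) \<Rightarrow> nat \<Rightarrow> nat
    \<Rightarrow> ('k list \<times> 'g list) set \<Rightarrow> ('k list \<times> 'g list \<Rightarrow> 'g) \<Rightarrow> bool" where
  "definable_value_function L M v m k W a \<longleftrightarrow>
     interpretable L M v m (k + 1) {(xs, gs @ [a (xs, gs)]) |xs gs. (xs, gs) \<in> W}"

text \<open>In the last line, \<open>v x < a w\<close> makes \<open>v x\<close> finite, equal to \<open>Fin \<gamma>\<close>.\<close>

definition uniformly_polynomially_bounded ::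
  "('f, 'r) lang \<Rightarrow> ('k, 'f, 'r) struct
    \<Rightarrow> ('k \<Rightarrow> 'g::linordered_ab_group_add extended) \<Rightarrow> bool" where
  "uniformly_polynomially_bounded L M v \<longleftrightarrow>
     (\<forall>m k W X f. definable_function_family L M v m k W X f \<longrightarrow>
        (\<exists>(n::int) a. definable_value_function L M v m k W a \<and>
           (\<forall>w\<in>W. \<forall>x. (w, x) \<in> X \<longrightarrow>
              (\<forall>\<gamma>. v x = Fin \<gamma> \<and> \<gamma> < a w \<longrightarrow> v (f w x) > Fin (int_mult n \<gamma>)))))"


section \<open>Adequacy of the definition of balls\<close>

lemma balls_valued:
  assumes "expands_valued_field L M v"
  shows "balls M = {{x. v (x - a) \<ge> \<gamma>} |a \<gamma>. \<gamma> \<noteq> -\<infinity>} \<union> {{x. v (x - a) > \<gamma>} |a \<gamma>. \<gamma> \<noteq> \<infinity>}"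
    (is "_ = ?C \<union> ?O")
proof -
  from assms have [simp]: "carr M = UNIV" "\<And>x y. rel_int M Div [x, y] \<longleftrightarrow> v x \<le> v y"
    "\<And>x y. fn_int M Sub [x, y] = x - y" "fn_int M Zero [] = 0"
    and v: "valuation v"
    by (auto simp: expands_valued_field_def)
  have surj: "\<exists>b. v b = \<gamma> \<and> (\<gamma> \<noteq> \<infinity> \<longrightarrow> b \<noteq> 0)" if "\<gamma> \<noteq> -\<infinity>" for \<gamma>
    using v that unfolding valuation_def by (cases \<gamma>) (metis extended.distinct(1))+
  have ne: "v b \<noteq> -\<infinity>" "v b = \<infinity> \<longleftrightarrow> b = 0" for b
    using v unfolding valuation_def by auto
  have gt: "-\<infinity> < v b" for b
    using ne(1)[of b] by (cases "v b") auto
  have "{closed_ball M a b |a b. True} = ?C"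
    unfolding closed_ball_def using surj ne by auto metis
  moreover have "{open_ball M a b |a b. b \<noteq> 0} \<union> {UNIV} = ?O"
  proof (intro set_eqI iffI)
    fix S assume "S \<in> {open_ball M a b |a b. b \<noteq> 0} \<union> {UNIV}"
    then consider a b where "S = open_ball M a b" "b \<noteq> 0" | "S = UNIV" by auto
    then show "S \<in> ?O"
    proof cases
      case 1
      then show ?thesis using ne by (auto simp: open_ball_def not_le)
    next
      case 2
      then have "S = {x. v (x - 0) > -\<infinity>}" using gt by simp
      then show ?thesis by blast
    qed
  next
    fix S assume "S \<in> ?O"
    then obtain a \<gamma> where S: "S = {x. v (x - a) > \<gamma>}" "\<gamma> \<noteq> \<infinity>" by auto
    show "S \<in> {open_ball M a b |a b. b \<noteq> 0} \<union> {UNIV}"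
    proof (cases "\<gamma> = -\<infinity>")
      case True
      then show ?thesis using S gt by simp
    next
      case False
      with surj S obtain b where "v b = \<gamma>" "b \<noteq> 0" by blast
      then show ?thesis using S by (auto simp: open_ball_def not_le)
    qed
  qed
  moreover have "balls M = {closed_ball M a b |a b. True} \<union> ({open_ball M a b |a b. b \<noteq> 0} \<union> {UNIV})"
    by (simp add: balls_def Un_assoc)
  ultimately show ?thesis by simp
qed


section \<open>Adequacy of the definition of C-minimality\<close>

lemma lepoll_card_of: "A \<lesssim> B \<longleftrightarrow> (card_of A, card_of B) \<in> ordLeq"
  unfolding lepoll_def card_of_ordLeq by simp

lemma UN_nat_lepoll:
  fixes A :: "nat \<Rightarrow> 'a set" and U :: "'u set"
  assumes "infinite U" "\<And>n. A n \<lesssim> U"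
  shows "(\<Union>n. A n) \<lesssim> U"
  unfolding lepoll_card_of
  by (rule card_of_UNION_ordLeq_infinite)
    (use assms infinite_iff_card_of_nat in \<open>auto simp: lepoll_card_of\<close>)

lemma Times_lepoll:
  assumes "infinite U" "A \<lesssim> U" "B \<lesssim> U"
  shows "A \<times> B \<lesssim> U"
proof -
  have "U \<times> U \<lesssim> U"
    unfolding lepoll_card_of
    by (rule ordIso_imp_ordLeq[OF card_of_Times_same_infinite[OF assms(1)]])
  with times_lepoll_mono[OF assms(2,3)] show ?thesis by (rule lepoll_trans)
qed

lemma Un_lepoll:
  assumes "infinite U" "A \<lesssim> U" "B \<lesssim> U"
  shows "A \<union> B \<lesssim> U"
proof -
  have "A \<union> B = (\<Union>n::nat. if n = 0 then A else B)"
    by (auto split: if_splits intro: exI[of _ 1])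
  then show ?thesis using UN_nat_lepoll[OF assms(1), of "\<lambda>n. if n = 0 then A else B"] assms
    by auto
qed

lemma image_lepoll': "A \<lesssim> U \<Longrightarrow> f ` A \<lesssim> U"
  using image_lepoll lepoll_trans by blast

lemma lists_lepoll:
  fixes U :: "'u set"
  assumes "infinite U" "A \<lesssim> U"
  shows "lists A \<lesssim> U"
proof -
  have "{xs. length xs = n \<and> set xs \<subseteq> A} \<lesssim> U" for n
  proof (induction n)
    case 0
    have "{xs. length xs = 0 \<and> set xs \<subseteq> A} = {[]}" by auto
    then show ?case using assms(1) by (simp add: finite_lepoll_infinite)
  next
    case (Suc n)
    have eq: "{xs. length xs = Suc n \<and> set xs \<subseteq> A}
        = (\<lambda>(x, xs). x # xs) ` (A \<times> {xs. length xs = n \<and> set xs \<subseteq> A})"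
      by (force simp: length_Suc_conv)
    show ?case
      unfolding eq by (rule image_lepoll'[OF Times_lepoll[OF assms Suc.IH]])
  qed
  then have "(\<Union>n. {xs. length xs = n \<and> set xs \<subseteq> A}) \<lesssim> U"
    by (rule UN_nat_lepoll[OF assms(1)])
  moreover have "(\<Union>n. {xs. length xs = n \<and> set xs \<subseteq> A}) = lists A" by auto
  ultimately show ?thesis by simp
qed

lemma nat_lepoll: "infinite U \<Longrightarrow> (N :: nat set) \<lesssim> U"
  by (rule lepoll_trans[OF subset_imp_lepoll[OF subset_UNIV]]) (simp flip: infinite_le_lepoll)

lemma trm_lepoll:
  fixes U :: "'u set"
  assumes U: "infinite U" and F: "(UNIV :: 'f set) \<lesssim> U"
  shows "(UNIV :: 'f trm set) \<lesssim> U"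
proof -
  define G :: "'f trm set \<Rightarrow> 'f trm set" where
    "G T = T \<union> (range Var \<union> (\<lambda>(f, ts). Fun f ts) ` (UNIV \<times> lists T))" for T
  have lep: "(G ^^ n) {} \<lesssim> U" for n
    by (induction n)
      (simp_all add: G_def Un_lepoll U image_lepoll' nat_lepoll Times_lepoll F lists_lepoll)
  have mono: "(G ^^ n) {} \<subseteq> (G ^^ m) {}" if "n \<le> m" for n m
    using that by (induction m) (auto simp: le_Suc_eq G_def)
  have "\<exists>n. t \<in> (G ^^ n) {}" for t
  proof (induction t)
    case (Var i)
    have "Var i \<in> (G ^^ Suc 0) {}" by (simp add: G_def)
    then show ?case by blast
  next
    case (Fun f ts)
    then obtain n where n: "\<And>t. t \<in> set ts \<Longrightarrow> t \<in> (G ^^ n t) {}" by metis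
    have "t \<in> (G ^^ Max (n ` set ts)) {}" if "t \<in> set ts" for t
      using n[OF that] mono[of "n t" "Max (n ` set ts)"] that by auto
    then have "Fun f ts \<in> (G ^^ Suc (Max (n ` set ts))) {}" by (auto simp: G_def)
    then show ?case by blast
  qed
  then have "(\<Union>n. (G ^^ n) {}) = UNIV" by auto
  then show ?thesis using UN_nat_lepoll[OF U, of "\<lambda>n. (G ^^ n) {}", OF lep] by simp
qed

lemma fm_lepoll:
  fixes U :: "'u set"
  assumes U: "infinite U" and F: "(UNIV :: 'f set) \<lesssim> U" and R: "(UNIV :: 'r set) \<lesssim> U"
  shows "(UNIV :: ('f, 'r) fm set) \<lesssim> U"
proof -
  define G :: "('f, 'r) fm set \<Rightarrow> ('f, 'r) fm set" where
    "G P = P \<union> (range (\<lambda>(s, t). Equal s t) \<union> (range (\<lambda>(r, ts). Rel r ts) \<union>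
       (Neg ` P \<union> ((\<lambda>(p, q). Conj p q) ` (P \<times> P) \<union> (\<lambda>(i, p). Exi i p) ` (UNIV \<times> P)))))"
    for P
  note T = trm_lepoll[OF U F]
  have TT: "(UNIV :: ('f trm \<times> 'f trm) set) \<lesssim> U"
    using Times_lepoll[OF U T T] by simp
  have RT: "(UNIV :: ('r \<times> 'f trm list) set) \<lesssim> U"
    using Times_lepoll[OF U R lists_lepoll[OF U T]] by simp
  have lep: "(G ^^ n) {} \<lesssim> U" for n
    by (induction n)
      (simp_all add: G_def Un_lepoll U image_lepoll' nat_lepoll Times_lepoll TT RT)
  have mono: "(G ^^ n) {} \<subseteq> (G ^^ m) {}" if "n \<le> m" for n m
    using that by (induction m) (auto simp: le_Suc_eq G_def)
  have step: "\<exists>n. p \<in> (G ^^ n) {}" if "p \<in> G ((G ^^ n) {})" for p n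
    using that by (intro exI[of _ "Suc n"]) simp
  have "\<exists>n. p \<in> (G ^^ n) {}" for p
  proof (induction p)
    case (Equal s t)
    show ?case by (rule step[of _ 0]) (force simp: G_def)
  next
    case (Rel r ts)
    show ?case by (rule step[of _ 0]) (force simp: G_def)
  next
    case (Neg p)
    then obtain n where "p \<in> (G ^^ n) {}" by blast
    then show ?case by (intro step[of _ n]) (auto simp: G_def)
  next
    case (Conj p q)
    then obtain n m where "p \<in> (G ^^ n) {}" "q \<in> (G ^^ m) {}" by blast
    then have "p \<in> (G ^^ max n m) {}" "q \<in> (G ^^ max n m) {}"
      using mono[of n "max n m"] mono[of m "max n m"] by auto
    then show ?case by (intro step[of _ "max n m"]) (auto simp: G_def)
  next
    case (Exi i p)
    then obtain n where "p \<in> (G ^^ n) {}" by blast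
    then show ?case by (intro step[of _ n]) (auto simp: G_def)
  qed
  then have "(\<Union>n. (G ^^ n) {}) = UNIV" by auto
  then show ?thesis using UN_nat_lepoll[OF U, of "\<lambda>n. (G ^^ n) {}", OF lep] by simp
qed

lemma finite_fv_trm: "finite (fv_trm t)"
  by (induction t) auto

lemma finite_fv: "finite (fv p)"
  by (induction p) (auto simp: finite_fv_trm)

lemma tval_cong: "(\<And>i. i \<in> fv_trm t \<Longrightarrow> d i = e i) \<Longrightarrow> tval M d t = tval M e t"
proof (induction t)
  case (Fun f ts)
  then have "map (tval M d) ts = map (tval M e) ts" by auto
  then show ?case by (simp del: map_eq_conv)
qed simp

lemma sat_cong: "(\<And>i. i \<in> fv p \<Longrightarrow> d i = e i) \<Longrightarrow> sat M d p = sat M e p"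
proof (induction p arbitrary: d e)
  case (Equal s t)
  have "tval M d s = tval M e s" "tval M d t = tval M e t"
    by (rule tval_cong, use Equal in auto)+
  then show ?case by simp
next
  case (Rel r ts)
  have "map (tval M d) ts = map (tval M e) ts"
    by (rule map_cong[OF refl], rule tval_cong) (use Rel in auto)
  then show ?case by (simp del: map_eq_conv)
next
  case (Neg p)
  have "sat M d p = sat M e p"
    by (rule Neg.IH) (use Neg.prems in auto)
  then show ?case by simp
next
  case (Conj p q)
  have "sat M d p = sat M e p"
    by (rule Conj.IH(1)) (use Conj.prems in auto)
  moreover have "sat M d q = sat M e q"
    by (rule Conj.IH(2)) (use Conj.prems in auto)
  ultimately show ?case by simp
next
  case (Exi i p)
  have "sat M (d(i := x)) p = sat M (e(i := x)) p" for x
    by (rule Exi.IH) (use Exi.prems in auto)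
  then show ?case by simp
qed

lemma tval_carr_upd: "tval (N\<lparr>carr := H\<rparr>) e t = tval N e t"
proof (induction t)
  case (Fun f ts)
  then have "map (tval (N\<lparr>carr := H\<rparr>) e) ts = map (tval N e) ts" by auto
  then show ?case by (simp del: map_eq_conv)
qed simp

text \<open>Downward Loewenheim-Skolem.\<close>

lemma loewenheim_skolem:
  fixes N :: "('u, 'f, 'r) struct" and U :: "'w set"
  assumes N: "is_struct L N" and A: "A \<subseteq> carr N" "A \<lesssim> U"
    and U: "infinite U" "(UNIV :: 'f set) \<lesssim> U" "(UNIV :: 'r set) \<lesssim> U"
  obtains H where "A \<subseteq> H" "H \<subseteq> carr N" "H \<lesssim> U" "is_struct L (N\<lparr>carr := H\<rparr>)"
    "\<And>p e. range e \<subseteq> H \<Longrightarrow> sat (N\<lparr>carr := H\<rparr>) e p = sat N e p"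
proof -
  obtain d where d: "d \<in> carr N" using N by (auto simp: is_struct_def)
  define wit where "wit = (\<lambda>(p, i, xs).
    if \<exists>x\<in>carr N. sat N ((assign xs (\<lambda>_. d))(i := x)) p
    then SOME x. x \<in> carr N \<and> sat N ((assign xs (\<lambda>_. d))(i := x)) p else d)"
  have wit: "wit (p, i, xs) \<in> carr N \<and> sat N ((assign xs (\<lambda>_. d))(i := wit (p, i, xs))) p"
    if "\<exists>x\<in>carr N. sat N ((assign xs (\<lambda>_. d))(i := x)) p" for p i xs
  proof -
    from that obtain x where "x \<in> carr N \<and> sat N ((assign xs (\<lambda>_. d))(i := x)) p" by blast
    from someI[of "\<lambda>x. x \<in> carr N \<and> sat N ((assign xs (\<lambda>_. d))(i := x)) p", OF this]
    show ?thesis using that unfolding wit_def by simp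
  qed
  have wit_carr: "wit y \<in> carr N" for y
  proof (cases y)
    case (fields p i xs)
    then show ?thesis using wit[of xs i p] d by (auto simp: wit_def)
  qed
  define G where "G B = B \<union> wit ` (UNIV \<times> (UNIV \<times> lists B))" for B
  define S where "S n = (G ^^ n) (insert d A)" for n
  define H where "H = (\<Union>n. S n)"
  have G_carr: "G B \<subseteq> carr N" if "B \<subseteq> carr N" for B
    using that wit_carr by (auto simp: G_def)
  have S_carr: "S n \<subseteq> carr N" for n
    using A d G_carr by (induction n) (auto simp: S_def)
  have "insert d A \<lesssim> U"
    using Un_lepoll[OF U(1) finite_lepoll_infinite[OF U(1), of "{d}"] A(2)] by simp
  then have "S n \<lesssim> U" for n
  proof (induction n)
    case (Suc n)
    then show ?case
      unfolding S_def
      by (simp add: G_def Un_lepoll image_lepoll' Times_lepoll U nat_lepoll lists_lepoll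
          fm_lepoll)
  qed (simp add: S_def)
  then have H_lep: "H \<lesssim> U" unfolding H_def by (rule UN_nat_lepoll[OF U(1)])
  have S_mono: "S n \<subseteq> S m" if "n \<le> m" for n m
    using that by (induction m) (auto simp: le_Suc_eq S_def G_def)
  have S_fin: "\<exists>n. B \<subseteq> S n" if "finite B" "B \<subseteq> H" for B
    using that
  proof (induction B)
    case (insert b B)
    then obtain n m where "B \<subseteq> S n" "b \<in> S m" by (auto simp: H_def)
    then have "insert b B \<subseteq> S (max n m)"
      using S_mono[of n "max n m"] S_mono[of m "max n m"] by auto
    then show ?case by blast
  qed simp
  have S0: "insert d A \<subseteq> S 0" by (simp add: S_def)
  have dH: "d \<in> H" and AH: "A \<subseteq> H" using S0 by (auto simp: H_def)
  have HN: "H \<subseteq> carr N" using S_carr by (auto simp: H_def)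
  have tv: "\<exists>x\<in>H. sat N (e(i := x)) p"
    if e: "range e \<subseteq> H" and ex: "\<exists>x\<in>carr N. sat N (e(i := x)) p" for e i p
  proof -
    obtain m where m: "\<And>j. j \<in> fv p \<Longrightarrow> j < m"
      using finite_fv[of p] by (metis finite_nat_set_iff_bounded)
    define xs where "xs = map e [0..<m]"
    have agree: "sat N ((assign xs (\<lambda>_. d))(i := x)) p = sat N (e(i := x)) p" for x
      by (rule sat_cong) (auto simp: assign_def xs_def dest: m)
    have "set xs \<subseteq> H" using e by (auto simp: xs_def)
    then obtain n where "set xs \<subseteq> S n" using S_fin[of "set xs"] by auto
    then have "wit (p, i, xs) \<in> G (S n)" by (auto simp: G_def)
    then have "wit (p, i, xs) \<in> S (Suc n)" by (simp add: S_def)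
    then have "wit (p, i, xs) \<in> H" by (auto simp: H_def)
    moreover have "sat N (e(i := wit (p, i, xs))) p"
      using wit[of xs i p] ex agree by auto
    ultimately show ?thesis by blast
  qed
  have el: "sat (N\<lparr>carr := H\<rparr>) e p = sat N e p" if "range e \<subseteq> H" for p e
    using that
  proof (induction p arbitrary: e)
    case (Rel r ts)
    have "map (tval (N\<lparr>carr := H\<rparr>) e) ts = map (tval N e) ts" by (simp add: tval_carr_upd)
    then show ?case by (simp del: map_eq_conv)
  next
    case (Exi i p)
    have "sat (N\<lparr>carr := H\<rparr>) (e(i := x)) p = sat N (e(i := x)) p" if "x \<in> H" for x
      by (rule Exi.IH) (use that Exi.prems in \<open>auto simp: image_subset_iff\<close>)
    then show ?case using tv[OF Exi.prems, of i p] HN by auto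
  qed (auto simp: tval_carr_upd)
  have "fn_int N f xs \<in> H" if f: "(f, length xs) \<in> funs L" and xs: "set xs \<subseteq> H" for f xs
  proof -
    define n where "n = length xs"
    define e where "e = assign xs (\<lambda>_. d)"
    have e: "range e \<subseteq> H" using xs dH by (auto simp: e_def assign_def)
    have val: "map (tval N (e(n := x))) (map Var [0..<n]) = xs" for x
      by (rule nth_equalityI) (auto simp: n_def e_def assign_def)
    have "fn_int N f xs \<in> carr N" using N f xs HN by (fastforce simp: is_struct_def)
    then have "\<exists>x\<in>carr N. sat N (e(n := x)) (Equal (Var n) (Fun f (map Var [0..<n])))"
      by (intro bexI[of _ "fn_int N f xs"]) (use val in \<open>auto simp del: map_map\<close>)
    from tv[OF e this] obtain x where "x \<in> H"
      "sat N (e(n := x)) (Equal (Var n) (Fun f (map Var [0..<n])))" by blast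
    then show ?thesis using val[of x] by (simp del: map_map)
  qed
  then have "is_struct L (N\<lparr>carr := H\<rparr>)" using dH by (auto simp: is_struct_def)
  with that AH HN H_lep el show ?thesis by blast
qed

text \<open>Transport of a structure along an injection.\<close>

definition transport :: "('a \<Rightarrow> 'b) \<Rightarrow> ('a, 'f, 'r) struct \<Rightarrow> ('b, 'f, 'r) struct" where
  "transport h N = \<lparr>carr = h ` carr N,
     fn_int = (\<lambda>f ys. h (fn_int N f (map (inv_into (carr N) h) ys))),
     rel_int = (\<lambda>r ys. rel_int N r (map (inv_into (carr N) h) ys))\<rparr>"

lemma upd_h: "(\<lambda>j. h (e j))(i := h x) = (\<lambda>j. h ((e(i := x)) j))"
  by auto

context
  fixes L :: "('f, 'r) lang" and N :: "('a, 'f, 'r) struct" and h :: "'a \<Rightarrow> 'b"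
  assumes N: "is_struct L N" and h: "inj_on h (carr N)"
begin

lemma inv_map: "set xs \<subseteq> carr N \<Longrightarrow> map (inv_into (carr N) h) (map h xs) = xs"
  using h by (induction xs) auto

lemma transport_fn:
  "set xs \<subseteq> carr N \<Longrightarrow> fn_int (transport h N) f (map h xs) = h (fn_int N f xs)"
  unfolding transport_def by (simp add: inv_map del: map_map)

lemma transport_rel:
  "set xs \<subseteq> carr N \<Longrightarrow> rel_int (transport h N) r (map h xs) = rel_int N r xs"
  unfolding transport_def by (simp add: inv_map del: map_map)

lemma transport_carr: "carr (transport h N) = h ` carr N"
  by (simp add: transport_def)

lemma transport_is_struct: "is_struct L (transport h N)"
proof -
  have "fn_int (transport h N) f ys \<in> h ` carr N"
    if "(f, length ys) \<in> funs L" "set ys \<subseteq> h ` carr N" for f ys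
  proof -
    define xs where "xs = map (inv_into (carr N) h) ys"
    have ys: "ys = map h xs" and xs: "set xs \<subseteq> carr N"
      using that(2)
      by (auto simp: xs_def f_inv_into_f inv_into_into subset_iff intro!: map_idI[symmetric])
    show ?thesis
      using N that(1) xs unfolding ys transport_fn[OF xs] by (fastforce simp: is_struct_def)
  qed
  then show ?thesis using N by (auto simp: is_struct_def transport_carr)
qed

lemma tval_transport:
  assumes "wf_trm L t" "range e \<subseteq> carr N"
  shows "tval (transport h N) (\<lambda>i. h (e i)) t = h (tval N e t) \<and> tval N e t \<in> carr N"
  using assms(1)
proof (induction t)
  case (Var i)
  then show ?case using assms(2) by auto
next
  case (Fun f ts)
  have ts: "tval (transport h N) (\<lambda>i. h (e i)) t = h (tval N e t) \<and> tval N e t \<in> carr N"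
    if "t \<in> set ts" for t
    using Fun.IH[OF that] Fun.prems that by (auto simp only: wf_trm.simps list_all_iff)
  then have eq: "map (tval (transport h N) (\<lambda>i. h (e i))) ts = map h (map (tval N e) ts)"
    by simp
  have sub: "set (map (tval N e) ts) \<subseteq> carr N" using ts by auto
  have "fn_int N f (map (tval N e) ts) \<in> carr N"
    using N Fun.prems sub unfolding is_struct_def by fastforce
  then show ?case unfolding tval.simps eq transport_fn[OF sub] by blast
qed

lemma sat_transport:
  assumes "wf_fm L p" "range e \<subseteq> carr N"
  shows "sat (transport h N) (\<lambda>i. h (e i)) p = sat N e p"
  using assms
proof (induction p arbitrary: e)
  case (Equal s t)
  then show ?case
    using tval_transport[of s e] tval_transport[of t e] h by (auto dest: inj_onD)
next
  case (Rel r ts)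
  have ts: "tval (transport h N) (\<lambda>i. h (e i)) t = h (tval N e t) \<and> tval N e t \<in> carr N"
    if "t \<in> set ts" for t
    by (rule tval_transport) (use Rel.prems that in \<open>auto simp: list_all_iff\<close>)
  then have eq: "map (tval (transport h N) (\<lambda>i. h (e i))) ts = map h (map (tval N e) ts)"
    by simp
  have sub: "set (map (tval N e) ts) \<subseteq> carr N" using ts by auto
  show ?case unfolding sat.simps eq transport_rel[OF sub] by blast
next
  case (Exi i p)
  have "sat (transport h N) ((\<lambda>j. h (e j))(i := h x)) p = sat N (e(i := x)) p" if "x \<in> carr N" for x
    unfolding upd_h
    by (rule Exi.IH) (use Exi.prems that in \<open>auto simp: image_subset_iff\<close>)
  then show ?case by (simp add: transport_carr)
qed simp_all

end

lemma transport_boolean_combinations: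
  fixes N :: "('a, 'f vf_fun, 'r vf_rel) struct"
  assumes L: "extends_L_div L" and N: "is_struct L N" and h: "inj_on h (carr N)"
    and B: "B \<in> boolean_combinations (carr (transport h N)) (balls (transport h N))"
  shows "\<exists>B0\<in>boolean_combinations (carr N) (balls N). B0 \<subseteq> carr N \<and> B = h ` B0"
  using B
proof induction
  case (basic S)
  have zero: "fn_int (transport h N) Zero [] = h (fn_int N Zero [])"
    using transport_fn[OF N h, of "[]"] by simp
  have sub: "fn_int (transport h N) Sub [h x, h a] = h (fn_int N Sub [x, a])"
    and sub_carr: "fn_int N Sub [x, a] \<in> carr N" if "x \<in> carr N" "a \<in> carr N" for x a
  proof -
    show "fn_int (transport h N) Sub [h x, h a] = h (fn_int N Sub [x, a])"
      using transport_fn[OF N h, of "[x, a]"] that by simp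
    have "(Sub, 2) \<in> funs L" using L by (auto simp: extends_L_div_def L_div_def)
    then show "fn_int N Sub [x, a] \<in> carr N" using N that by (fastforce simp: is_struct_def)
  qed
  have div: "rel_int (transport h N) Div [h x, h y] = rel_int N Div [x, y]"
    if "x \<in> carr N" "y \<in> carr N" for x y
    using transport_rel[OF N h, of "[x, y]"] that by simp
  note carr = transport_carr[OF N h]
  have cl: "closed_ball (transport h N) (h a) (h b) = h ` closed_ball N a b"
    if "a \<in> carr N" "b \<in> carr N" for a b
    using that by (auto simp: closed_ball_def carr sub sub_carr div)
  have op: "open_ball (transport h N) (h a) (h b) = h ` open_ball N a b"
    if "a \<in> carr N" "b \<in> carr N" for a b
    using that by (auto simp: open_ball_def carr sub sub_carr div)
  from basic consider a b where "a \<in> carr N" "b \<in> carr N" "S = closed_ball (transport h N) (h a) (h b)"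
    | a b where "a \<in> carr N" "b \<in> carr N" "h b \<noteq> h (fn_int N Zero [])"
        "S = open_ball (transport h N) (h a) (h b)"
    | "S = h ` carr N"
    unfolding balls_def carr zero by blast
  then have "\<exists>B0\<in>balls N. B0 \<subseteq> carr N \<and> S = h ` B0"
  proof cases
    case 1
    then have "closed_ball N a b \<in> balls N" unfolding balls_def by blast
    then show ?thesis using cl 1 by (intro bexI[of _ "closed_ball N a b"])
        (auto simp: closed_ball_def)
  next
    case 2
    then have "open_ball N a b \<in> balls N" unfolding balls_def by blast
    then show ?thesis using op 2 by (intro bexI[of _ "open_ball N a b"])
        (auto simp: open_ball_def)
  next
    case 3
    then show ?thesis by (intro bexI[of _ "carr N"]) (auto simp: balls_def)
  qed
  then show ?case using boolean_combinations.basic by blast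
next
  case (compl S)
  then obtain B0 where "B0 \<in> boolean_combinations (carr N) (balls N)" "B0 \<subseteq> carr N" "S = h ` B0"
    by blast
  then show ?case
    using h by (intro bexI[of _ "carr N - B0"])
      (auto simp: transport_carr[OF N h] inj_on_def intro: boolean_combinations.compl)
next
  case (union S T)
  then obtain B0 B1 where "B0 \<in> boolean_combinations (carr N) (balls N)" "B0 \<subseteq> carr N"
    "S = h ` B0" "B1 \<in> boolean_combinations (carr N) (balls N)" "B1 \<subseteq> carr N" "T = h ` B1"
    by blast
  then show ?case
    by (intro bexI[of _ "B0 \<union> B1"]) (auto intro: boolean_combinations.union)
qed

lemma boolean_combination_formula:
  fixes N :: "('a, 'f vf_fun, 'r vf_rel) struct"
  assumes L: "extends_L_div L" and H: "H \<subseteq> carr N"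
    and B: "B \<in> boolean_combinations H (balls (N\<lparr>carr := H\<rparr>))"
  shows "\<exists>P. finite P \<and> P \<subseteq> H \<and> (\<forall>e. P \<subseteq> e ` {0<..} \<longrightarrow>
    (\<exists>q. wf_fm L q \<and> B = {x \<in> H. sat N (e(0 := x)) q} \<and>
      {x \<in> carr N. sat N (e(0 := x)) q} \<in> boolean_combinations (carr N) (balls N)))"
  using B
proof induction
  case (basic S)
  have sym: "(Sub, 2) \<in> funs L" "(Div, 2) \<in> rels L"
    using L by (auto simp: extends_L_div_def L_div_def)
  from basic consider a b where "a \<in> H" "b \<in> H" "S = closed_ball (N\<lparr>carr := H\<rparr>) a b"
    | a b where "a \<in> H" "b \<in> H" "b \<noteq> fn_int N Zero []" "S = open_ball (N\<lparr>carr := H\<rparr>) a b"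
    | "S = H"
    by (auto simp: balls_def)
  then show ?case
  proof cases
    case 1
    have "\<exists>q. wf_fm L q \<and> S = {x \<in> H. sat N (e(0 := x)) q} \<and>
      {x \<in> carr N. sat N (e(0 := x)) q} \<in> boolean_combinations (carr N) (balls N)"
      if e: "{a, b} \<subseteq> e ` {0<..}" for e
    proof -
      from e have "a \<in> e ` {0<..}" "b \<in> e ` {0<..}" by simp_all
      then obtain i j where ij: "0 < i" "0 < j" "e i = a" "e j = b"
        by (metis imageE greaterThan_iff)
      define q :: "('f vf_fun, 'r vf_rel) fm" where
        "q = Rel Div [Var j, Fun Sub [Var 0, Var i]]"
      have sat_q: "sat N (e(0 := x)) q \<longleftrightarrow> rel_int N Div [b, fn_int N Sub [x, a]]" for x
        using ij by (simp add: q_def)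
      have "{x \<in> carr N. sat N (e(0 := x)) q} = closed_ball N a b"
        "S = {x \<in> H. sat N (e(0 := x)) q}"
        using 1 by (simp_all add: sat_q closed_ball_def)
      moreover have "closed_ball N a b \<in> balls N"
        using 1 H unfolding balls_def by blast
      moreover have "wf_fm L q" using sym by (simp add: q_def numeral_2_eq_2)
      ultimately show ?thesis
        by (intro exI[of _ q] conjI) (simp_all only: boolean_combinations.basic)
    qed
    moreover have "finite {a, b}" "{a, b} \<subseteq> H" using 1 by auto
    ultimately show ?thesis by meson
  next
    case 2
    have "\<exists>q. wf_fm L q \<and> S = {x \<in> H. sat N (e(0 := x)) q} \<and>
      {x \<in> carr N. sat N (e(0 := x)) q} \<in> boolean_combinations (carr N) (balls N)"
      if e: "{a, b} \<subseteq> e ` {0<..}" for e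
    proof -
      from e have "a \<in> e ` {0<..}" "b \<in> e ` {0<..}" by simp_all
      then obtain i j where ij: "0 < i" "0 < j" "e i = a" "e j = b"
        by (metis imageE greaterThan_iff)
      define q :: "('f vf_fun, 'r vf_rel) fm" where
        "q = Neg (Rel Div [Fun Sub [Var 0, Var i], Var j])"
      have sat_q: "sat N (e(0 := x)) q \<longleftrightarrow> \<not> rel_int N Div [fn_int N Sub [x, a], b]" for x
        using ij by (simp add: q_def)
      have "{x \<in> carr N. sat N (e(0 := x)) q} = open_ball N a b"
        "S = {x \<in> H. sat N (e(0 := x)) q}"
        using 2 by (simp_all add: sat_q open_ball_def)
      moreover have "open_ball N a b \<in> balls N"
        using 2 H unfolding balls_def by blast
      moreover have "wf_fm L q" using sym by (simp add: q_def numeral_2_eq_2)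
      ultimately show ?thesis
        by (intro exI[of _ q] conjI) (simp_all only: boolean_combinations.basic)
    qed
    moreover have "finite {a, b}" "{a, b} \<subseteq> H" using 2 by auto
    ultimately show ?thesis by meson
  next
    case 3
    have "carr N \<in> boolean_combinations (carr N) (balls N)"
      by (auto simp: balls_def intro: boolean_combinations.basic)
    then show ?thesis
      using 3 by (intro exI[of _ "{}"]) (auto intro!: exI[of _ "Equal (Var 0) (Var 0)"])
  qed
next
  case (compl S)
  then obtain P where P: "finite P" "P \<subseteq> H" "\<And>e. P \<subseteq> e ` {0<..} \<Longrightarrow>
    (\<exists>q. wf_fm L q \<and> S = {x \<in> H. sat N (e(0 := x)) q} \<and>
      {x \<in> carr N. sat N (e(0 := x)) q} \<in> boolean_combinations (carr N) (balls N))"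
    by blast
  have "\<exists>q. wf_fm L q \<and> H - S = {x \<in> H. sat N (e(0 := x)) q} \<and>
      {x \<in> carr N. sat N (e(0 := x)) q} \<in> boolean_combinations (carr N) (balls N)"
    if e: "P \<subseteq> e ` {0<..}" for e
  proof -
    from P(3)[OF e] obtain q where q: "wf_fm L q" "S = {x \<in> H. sat N (e(0 := x)) q}"
      "{x \<in> carr N. sat N (e(0 := x)) q} \<in> boolean_combinations (carr N) (balls N)" by blast
    have "{x \<in> carr N. sat N (e(0 := x)) (Neg q)} = carr N - {x \<in> carr N. sat N (e(0 := x)) q}"
      by auto
    then have "{x \<in> carr N. sat N (e(0 := x)) (Neg q)} \<in> boolean_combinations (carr N) (balls N)"
      using boolean_combinations.compl[OF q(3)] by simp
    then show ?thesis using q by (intro exI[of _ "Neg q"]) auto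
  qed
  then show ?case using P by blast
next
  case (union S T)
  then obtain P Q where P: "finite P" "P \<subseteq> H" "\<And>e. P \<subseteq> e ` {0<..} \<Longrightarrow>
    (\<exists>q. wf_fm L q \<and> S = {x \<in> H. sat N (e(0 := x)) q} \<and>
      {x \<in> carr N. sat N (e(0 := x)) q} \<in> boolean_combinations (carr N) (balls N))"
    and Q: "finite Q" "Q \<subseteq> H" "\<And>e. Q \<subseteq> e ` {0<..} \<Longrightarrow>
    (\<exists>q. wf_fm L q \<and> T = {x \<in> H. sat N (e(0 := x)) q} \<and>
      {x \<in> carr N. sat N (e(0 := x)) q} \<in> boolean_combinations (carr N) (balls N))"
    by meson
  have "\<exists>q. wf_fm L q \<and> S \<union> T = {x \<in> H. sat N (e(0 := x)) q} \<and>
      {x \<in> carr N. sat N (e(0 := x)) q} \<in> boolean_combinations (carr N) (balls N)"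
    if e: "P \<union> Q \<subseteq> e ` {0<..}" for e
  proof -
    from e have "P \<subseteq> e ` {0<..}" "Q \<subseteq> e ` {0<..}" by auto
    with P(3) Q(3) obtain p q where
      p: "wf_fm L p" "S = {x \<in> H. sat N (e(0 := x)) p}"
      "{x \<in> carr N. sat N (e(0 := x)) p} \<in> boolean_combinations (carr N) (balls N)" and
      q: "wf_fm L q" "T = {x \<in> H. sat N (e(0 := x)) q}"
      "{x \<in> carr N. sat N (e(0 := x)) q} \<in> boolean_combinations (carr N) (balls N)" by meson
    have "{x \<in> carr N. sat N (e(0 := x)) (Neg (Conj (Neg p) (Neg q)))}
        = {x \<in> carr N. sat N (e(0 := x)) p} \<union> {x \<in> carr N. sat N (e(0 := x)) q}"
      by auto
    then have "{x \<in> carr N. sat N (e(0 := x)) (Neg (Conj (Neg p) (Neg q)))}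
        \<in> boolean_combinations (carr N) (balls N)"
      using boolean_combinations.union[OF p(3) q(3)] by simp
    then show ?thesis using p q by (intro exI[of _ "Neg (Conj (Neg p) (Neg q))"]) auto
  qed
  moreover have "finite (P \<union> Q)" "P \<union> Q \<subseteq> H" using P(1,2) Q(1,2) by auto
  ultimately show ?case by meson
qed

lemma assign_singleton: "assign [x] e = e(0 := x)"
  by (auto simp: assign_def fun_eq_iff)

lemma singletons_eq_solutions:
  "(\<lambda>x. [x]) ` S = solutions N 1 e p \<longleftrightarrow> S = {x \<in> carr N. sat N (e(0 := x)) p}"
proof -
  have "solutions N 1 e p = (\<lambda>x. [x]) ` {x \<in> carr N. sat N (e(0 := x)) p}"
    by (auto simp: solutions_def length_Suc_conv assign_singleton)
  then show ?thesis by (simp add: inj_image_eq_iff inj_def)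
qed

text \<open>The type of \<open>N\<close> is arbitrary here.\<close>

theorem C_minimal_all_types:
  fixes L :: "('f vf_fun, 'r vf_rel) lang"
    and M :: "('k, 'f vf_fun, 'r vf_rel) struct" and N :: "('u, 'f vf_fun, 'r vf_rel) struct"
  assumes L: "extends_L_div L" and M: "C_minimal L M"
    and N: "is_struct L N" and MN: "elem_equiv L M N"
  shows "definable_subsets_from_balls L N"
  unfolding definable_subsets_from_balls_def
proof (intro allI impI)
  fix S assume "definable L N 1 ((\<lambda>x. [x]) ` S)"
  then obtain p e where p: "wf_fm L p" and e: "range e \<subseteq> carr N"
    and S: "S = {x \<in> carr N. sat N (e(0 := x)) p}"
    unfolding definable_def singletons_eq_solutions by blast
  let ?U = "UNIV :: ('k, 'f, 'r) big set"
  have U: "infinite ?U"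
    by (simp add: finite_Plus_UNIV_iff)
  have "(UNIV :: 'f vf_fun set) \<lesssim> ?U"
  proof -
    have "inj (\<lambda>s :: 'f vf_fun. case s of Zero \<Rightarrow> Inr (Inr (Inr 0)) | One \<Rightarrow> Inr (Inr (Inr 1))
        | Add \<Rightarrow> Inr (Inr (Inr 2)) | Sub \<Rightarrow> Inr (Inr (Inr 3)) | Mul \<Rightarrow> Inr (Inr (Inr 4))
        | OtherFun f \<Rightarrow> (Inr (Inl f) :: ('k, 'f, 'r) big))"
      by (rule injI) (auto split: vf_fun.splits)
    then show ?thesis unfolding lepoll_def by blast
  qed
  moreover have "(UNIV :: 'r vf_rel set) \<lesssim> ?U"
  proof -
    have "inj (\<lambda>s :: 'r vf_rel. case s of Div \<Rightarrow> Inr (Inr (Inr 0))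
        | OtherRel r \<Rightarrow> (Inr (Inr (Inl r)) :: ('k, 'f, 'r) big))"
      by (rule injI) (auto split: vf_rel.splits)
    then show ?thesis unfolding lepoll_def by blast
  qed
  moreover have "range e \<lesssim> ?U" by (rule image_lepoll'[OF nat_lepoll[OF U]])
  ultimately obtain H where H: "range e \<subseteq> H" "H \<subseteq> carr N" "H \<lesssim> ?U"
    "is_struct L (N\<lparr>carr := H\<rparr>)"
    "\<And>p e. range e \<subseteq> H \<Longrightarrow> sat (N\<lparr>carr := H\<rparr>) e p = sat N e p"
    using loewenheim_skolem[OF N e _ U] by metis
  define NH where "NH = N\<lparr>carr := H\<rparr>"
  have NH: "is_struct L NH" "carr NH = H" using H by (auto simp: NH_def)
  have el: "range e \<subseteq> H \<Longrightarrow> sat NH e q = sat N e q" for e q using H(5) by (simp add: NH_def)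
  obtain h :: "'u \<Rightarrow> ('k, 'f, 'r) big" where "inj_on h H" using H(3) unfolding lepoll_def by blast
  then have h: "inj_on h (carr NH)" using NH by simp
  note sat_h = sat_transport[OF NH(1) h]
  define S0 where "S0 = {x \<in> H. sat N (e(0 := x)) p}"
  have upd: "range (e(0 := x)) \<subseteq> H" if "x \<in> H" "range e \<subseteq> H" for x and e :: "nat \<Rightarrow> 'u"
    using that by (auto simp: image_subset_iff)
  have "elem_equiv L M (transport h NH)"
    unfolding elem_equiv_def
  proof (intro allI impI, elim conjE)
    fix q and d :: "nat \<Rightarrow> 'k" and e' :: "nat \<Rightarrow> ('k, 'f, 'r) big"
    assume q: "wf_fm L q" "fv q = {}"
      and d: "range d \<subseteq> carr M" and e': "range e' \<subseteq> carr (transport h NH)"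
    define e'' where "e'' i = inv_into H h (e' i)" for i
    have "e' i \<in> h ` H" for i using e' by (auto simp: transport_carr[OF NH(1) h] NH(2))
    then have "e' = (\<lambda>i. h (e'' i))" "range e'' \<subseteq> H"
      by (auto simp: e''_def f_inv_into_f inv_into_into)
    then have "sat (transport h NH) e' q = sat N e'' q"
      using sat_h[OF q(1)] el NH by simp
    also have "\<dots> = sat M d q"
      using MN q d \<open>range e'' \<subseteq> H\<close> H(2) unfolding elem_equiv_def by (meson order_trans)
    finally show "sat M d q = sat (transport h NH) e' q" by simp
  qed
  moreover note transport_is_struct[OF NH(1) h]
  ultimately have "definable_subsets_from_balls L (transport h NH)"
    using M unfolding C_minimal_def by blast
  moreover have "definable L (transport h NH) 1 ((\<lambda>x. [x]) ` h ` S0)"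
  proof -
    have "sat (transport h NH) ((\<lambda>i. h (e i))(0 := h x)) p = sat N (e(0 := x)) p" if "x \<in> H" for x
      unfolding upd_h el[OF upd[OF that H(1)], symmetric]
      by (rule sat_h[OF p]) (use upd[OF that H(1)] NH(2) in blast)
    then have "h ` S0 = {y \<in> carr (transport h NH). sat (transport h NH) ((\<lambda>i. h (e i))(0 := y)) p}"
      by (auto simp: S0_def transport_carr[OF NH(1) h] NH(2))
    moreover have "range (\<lambda>i. h (e i)) \<subseteq> carr (transport h NH)"
      using H(1) by (auto simp: transport_carr[OF NH(1) h] NH(2))
    ultimately show ?thesis
      unfolding definable_def singletons_eq_solutions using p by blast
  qed
  ultimately have "h ` S0 \<in> boolean_combinations (carr (transport h NH)) (balls (transport h NH))"
    unfolding definable_subsets_from_balls_def by blast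
  from transport_boolean_combinations[OF L NH(1) h this]
  obtain B0 where B0: "B0 \<in> boolean_combinations H (balls NH)" "B0 \<subseteq> H" "h ` S0 = h ` B0"
    using NH(2) by auto
  moreover have "S0 \<subseteq> H" by (auto simp: S0_def)
  ultimately have "S0 \<in> boolean_combinations H (balls NH)"
    using inj_on_image_eq_iff[OF h] NH(2) by metis
  from boolean_combination_formula[OF L H(2) this[unfolded NH_def]]
  obtain P where P: "finite P" "P \<subseteq> H" "\<And>e. P \<subseteq> e ` {0<..} \<Longrightarrow>
    (\<exists>q. wf_fm L q \<and> S0 = {x \<in> H. sat N (e(0 := x)) q} \<and>
      {x \<in> carr N. sat N (e(0 := x)) q} \<in> boolean_combinations (carr N) (balls N))"
    by blast
  obtain ps where ps: "set ps = P" using finite_list[OF P(1)] by blast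
  obtain m0 where m0: "\<And>j. j \<in> fv p \<Longrightarrow> j < m0"
    using finite_fv[of p] by (metis finite_nat_set_iff_bounded)
  define m where "m = Suc m0"
  define e' where "e' i = (if i < m then e i else assign ps e (i - m))" for i
  have e': "range e' \<subseteq> H" using H(1) P(2) ps by (auto simp: e'_def assign_def)
  have "P \<subseteq> e' ` {0<..}"
  proof
    fix y assume "y \<in> P"
    then obtain i where "i < length ps" "ps ! i = y" using ps by (metis in_set_conv_nth)
    then have "y = e' (m + i)" by (simp add: e'_def assign_def)
    then show "y \<in> e' ` {0<..}" by (auto simp: m_def)
  qed
  from P(3)[OF this] obtain q where q: "wf_fm L q" "S0 = {x \<in> H. sat N (e'(0 := x)) q}"
    "{x \<in> carr N. sat N (e'(0 := x)) q} \<in> boolean_combinations (carr N) (balls N)" by blast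
  have p': "sat N (e'(0 := x)) p = sat N (e(0 := x)) p" for x
    by (rule sat_cong) (auto simp: e'_def m_def dest: m0)
  have pq: "sat N (e'(0 := x)) p = sat N (e'(0 := x)) q" if "x \<in> H" for x
    using q(2) that unfolding S0_def p' by blast
  have no: "\<not> sat N e' (Exi 0 r)" if "\<And>x. x \<in> H \<Longrightarrow> \<not> sat N (e'(0 := x)) r" for r
    using that el[OF upd[OF _ e']] NH(2) unfolding el[OF e', symmetric] by simp
  have "\<not> sat N e' (Exi 0 (Conj p (Neg q)))" "\<not> sat N e' (Exi 0 (Conj q (Neg p)))"
    by (rule no, use pq in simp)+
  then have "S = {x \<in> carr N. sat N (e'(0 := x)) q}"
    unfolding S p'[symmetric] by auto
  with q(3) show "S \<in> boolean_combinations (carr N) (balls N)" by simp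
qed

end

theory Submission
  imports Defs
begin

text \<open>
  By C-minimality, membership in a definable subset of \<open>K\<close> depends only on membership in finitely
  many balls. Hence the value group is o-minimal and, the residue field being infinite, a definable
  function to the value group that is constant on the residue classes of a ball has finitely many
  values there. It follows that \<open>f\<^sub>w\<close> is bounded on the annuli \<open>v x = -\<gamma>\<close> for all large \<open>\<gamma>\<close>; let
  \<open>h\<^sub>w(\<gamma>)\<close> be the supremum of \<open>-v(f\<^sub>w(x))\<close> there.

  The hypothesis of linear boundedness concerns functions with parameters from the value group, while
  \<open>w\<close> is a tuple from \<open>K\<close>, so each \<open>h\<^sub>w\<close> is dominated by such a function, eliminating one parameter
  \<open>x \<in> K\<close> at a time: call a ball mixed if the functions \<open>h\<^sub>x\<close> with \<open>x\<close> in it are not all equal. For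
  each radius only finitely many balls are mixed. The radii of the mixed balls around \<open>x\<close> form an
  initial segment of the value group, hence are described by one value; and the points with a given
  initial segment yield only finitely many \<open>h\<^sub>x(\<gamma>)\<close> for each \<open>\<gamma>\<close>, so their maximum is the function
  wanted.

  For uniformity consider the slopes \<open>\<lambda>\<^sub>w(t) = lim (h\<^sub>w(\<gamma> + t) - h\<^sub>w(\<gamma>))\<close>, which are additive and
  of constant sign relative to multiples of \<open>t\<close>. If no multiple of \<open>t\<^sub>0\<close> bounded all \<open>\<lambda>\<^sub>w(t\<^sub>0)\<close>,
  then \<open>s \<mapsto> inf {\<lambda>\<^sub>w(s) | \<lambda>\<^sub>w(t\<^sub>0) \<ge> s}\<close> would be definable and grow superlinearly.
\<close>

section \<open>A calculus of definable relations\<close>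

text \<open>Linear boundedness is assumed of the given structure only, and its integer may depend on
  the parameters. Since only upper bounds on \<open>h\<^sub>w\<close> are at stake, a dominating
  function serves as well as \<open>h\<^sub>w\<close> itself.

  Slopes enter because an inequality between \<open>h\<^sub>w(\<gamma>)\<close> and a multiple of
  \<gamma> holds only beyond a value that depends on \<open>w\<close>. The limit of the increments
  does not see this value, and if it exceeds \<open>n t\<close> at the single \<open>t0\<close>, it
  is at least \<open>n t\<close> at every positive \<open>t\<close>.

  The value group need not be archimedean, so arguments that would iterate a step or a doubling are
  replaced by suprema and infima of definable sets, whose existence comes from C-minimality.\<close>

primrec ren_trm :: "(nat \<Rightarrow> nat) \<Rightarrow> 'f trm \<Rightarrow> 'f trm" where
  "ren_trm \<rho> (Var i) = Var (\<rho> i)"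
| "ren_trm \<rho> (Fun f ts) = Fun f (map (ren_trm \<rho>) ts)"

text \<open>A bound variable is moved above the images of all free variables of the body, so nothing
  is captured; the inserted 0 covers the case that there are none.\<close>

primrec ren_fm :: "(nat \<Rightarrow> nat) \<Rightarrow> ('f, 'r) fm \<Rightarrow> ('f, 'r) fm" where
  "ren_fm \<rho> (Equal s t) = Equal (ren_trm \<rho> s) (ren_trm \<rho> t)"
| "ren_fm \<rho> (Rel r ts) = Rel r (map (ren_trm \<rho>) ts)"
| "ren_fm \<rho> (Neg p) = Neg (ren_fm \<rho> p)"
| "ren_fm \<rho> (Conj p q) = Conj (ren_fm \<rho> p) (ren_fm \<rho> q)"
| "ren_fm \<rho> (Exi i p) = (let j = Suc (Max (insert 0 (\<rho> ` fv p))) in Exi j (ren_fm (\<rho>(i := j)) p))"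

lemma wf_ren_trm: "wf_trm L (ren_trm \<rho> t) \<longleftrightarrow> wf_trm L t"
  by (induction t) (simp_all add: list_all_iff)

lemma wf_ren_fm: "wf_fm L (ren_fm \<rho> p) \<longleftrightarrow> wf_fm L p"
  by (induction p arbitrary: \<rho>) (simp_all add: wf_ren_trm list_all_iff Let_def)

lemma tval_ren_trm: "tval M e (ren_trm \<rho> t) = tval M (\<lambda>i. e (\<rho> i)) t"
proof (induction t)
  case (Fun f ts)
  then have "map (tval M e) (map (ren_trm \<rho>) ts) = map (tval M (\<lambda>i. e (\<rho> i))) ts" by simp
  then show ?case unfolding ren_trm.simps tval.simps by (rule arg_cong)
qed simp

lemma sat_ren_fm: "sat M e (ren_fm \<rho> p) = sat M (\<lambda>i. e (\<rho> i)) p"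
proof (induction p arbitrary: \<rho> e)
  case (Rel r ts)
  have "map (tval M e) (map (ren_trm \<rho>) ts) = map (tval M (\<lambda>i. e (\<rho> i))) ts"
    by (simp add: tval_ren_trm)
  then show ?case unfolding ren_fm.simps sat.simps by (rule arg_cong)
next
  case (Exi i p)
  define j where "j = Suc (Max (insert 0 (\<rho> ` fv p)))"
  have "\<rho> k \<le> Max (insert 0 (\<rho> ` fv p))" if "k \<in> fv p" for k
    using that finite_fv[of p] by (intro Max_ge) auto
  then have "\<rho> k \<noteq> j" if "k \<in> fv p" for k
    using that unfolding j_def by (metis Suc_n_not_le_n)
  then have "sat M (e(j := x)) (ren_fm (\<rho>(i := j)) p) = sat M ((\<lambda>i. e (\<rho> i))(i := x)) p" for x
    unfolding Exi.IH by (intro sat_cong) auto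
  then show ?case by (simp add: Let_def flip: j_def)
qed (simp_all add: tval_ren_trm)

section \<open>Suprema with a default value, and integer multiples\<close>

definition is_lub :: "'g::linorder set \<Rightarrow> 'g \<Rightarrow> bool" where
  "is_lub S \<delta> \<longleftrightarrow> (\<forall>\<beta>. (\<forall>\<alpha>. \<alpha> \<in> S \<longrightarrow> \<alpha> \<le> \<beta>) \<longleftrightarrow> \<delta> \<le> \<beta>)"

text \<open>The junk value is \<open>0\<close>.\<close>

definition lub :: "'g::{linorder, zero} set \<Rightarrow> 'g" where
  "lub S = (if \<exists>\<delta>. is_lub S \<delta> then THE \<delta>. is_lub S \<delta> else 0)"

lemma is_lub_unique: "is_lub S a \<Longrightarrow> is_lub S b \<Longrightarrow> a = b"
  unfolding is_lub_def by (meson order.refl order.antisym)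

lemma lub_eqI: "is_lub S \<delta> \<Longrightarrow> lub S = \<delta>"
  unfolding lub_def using is_lub_unique by (smt (verit) the_equality)

lemma lub_eq_iff: "lub S = \<delta> \<longleftrightarrow> is_lub S \<delta> \<or> (\<not> (\<exists>\<delta>. is_lub S \<delta>) \<and> \<delta> = 0)"
  using lub_eqI unfolding lub_def by metis

lemma lub_singleton: "lub {\<delta>} = \<delta>"
  by (rule lub_eqI) (auto simp: is_lub_def)

lemma lub_le_finite: "finite S \<Longrightarrow> x \<in> S \<Longrightarrow> x \<le> lub S"
proof -
  assume S: "finite S" "x \<in> S"
  then have "is_lub S (Max S)" unfolding is_lub_def
    by (metis Max_ge Max_in empty_iff order_trans)
  with S show "x \<le> lub S" using lub_eqI by (metis Max_ge)
qed

definition mul :: "nat \<Rightarrow> 'g::ab_group_add \<Rightarrow> 'g" where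
  "mul n x = (\<Sum>i<n. x)"

lemma mul_0 [simp]: "mul 0 x = 0" and mul_Suc [simp]: "mul (Suc n) x = mul n x + x"
  by (simp_all add: mul_def)

lemma mul_add: "mul n (x + y) = mul n x + mul n y"
  by (induction n) (simp_all add: algebra_simps)

lemma mul_minus: "mul n (- x) = - mul n x"
  by (induction n) simp_all

lemma int_mult_mul: "int_mult n x = (if 0 \<le> n then mul (nat n) x else - mul (nat (- n)) x)"
  by (simp add: int_mult_def mul_def)

lemma mul_nonneg: "0 \<le> (x::'g::linordered_ab_group_add) \<Longrightarrow> 0 \<le> mul n x"
  by (induction n) auto

lemma abs_int_mult:
  fixes x :: "'g::{linordered_ab_group_add, ordered_ab_group_add_abs}"
  shows "0 \<le> x \<Longrightarrow> \<bar>int_mult n x\<bar> = mul (nat \<bar>n\<bar>) x"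
  by (simp add: int_mult_mul mul_nonneg)

section \<open>The valued field and its value map\<close>

locale C_minimal_valued_field =
  fixes L :: "('f vf_fun, 'r vf_rel) lang"
    and M :: "('k::alg_closed_field, 'f vf_fun, 'r vf_rel) struct"
    and v :: "'k \<Rightarrow> 'g::{linordered_ab_group_add, ordered_ab_group_add_abs} extended"
  assumes expands: "expands_valued_field L M v"
    and C_minimal: "C_minimal L M"
begin

lemma carr_M [simp]: "carr M = UNIV"
  and valuation_v: "valuation v"
  and extends_L: "extends_L_div L"
  and fn_Zero: "fn_int M Zero [] = 0"
  and fn_Sub: "fn_int M Sub [x, y] = x - y"
  and fn_Mul: "fn_int M Mul [x, y] = x * y"
  and rel_Div: "rel_int M Div [x, y] \<longleftrightarrow> v x \<le> v y"
  and nontrivial: "\<exists>\<gamma>::'g. \<gamma> \<noteq> 0"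
  using expands by (auto simp: expands_valued_field_def)

text \<open>Values live in \<open>'g\<close> rather than in \<open>'g extended\<close>; \<open>val 0 = 0\<close> is junk.\<close>

definition val :: "'k \<Rightarrow> 'g" where
  "val x = (if x = 0 then 0 else THE \<gamma>. v x = Fin \<gamma>)"

lemma v_eq: "v x = (if x = 0 then \<infinity> else Fin (val x))"
proof (cases "x = 0")
  case False
  then obtain \<gamma> where "v x = Fin \<gamma>"
    using valuation_v unfolding valuation_def by (cases "v x") auto
  with False show ?thesis by (simp add: val_def)
qed (use valuation_v in \<open>auto simp: valuation_def\<close>)

lemma val_0 [simp]: "val 0 = 0"
  by (simp add: val_def)

lemma ex_val: "\<exists>x. x \<noteq> 0 \<and> val x = \<gamma>"
proof -
  obtain x where "v x = Fin \<gamma>" using valuation_v unfolding valuation_def by blast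
  then have "x \<noteq> 0 \<and> val x = \<gamma>" by (auto simp: v_eq split: if_splits)
  then show ?thesis by blast
qed

lemma val_mult: "x \<noteq> 0 \<Longrightarrow> y \<noteq> 0 \<Longrightarrow> val (x * y) = val x + val y"
proof -
  assume "x \<noteq> 0" "y \<noteq> 0"
  moreover have "v (x * y) = v x + v y" using valuation_v by (auto simp: valuation_def)
  ultimately show ?thesis by (simp add: v_eq)
qed

lemma val_add: "x \<noteq> 0 \<Longrightarrow> y \<noteq> 0 \<Longrightarrow> x + y \<noteq> 0 \<Longrightarrow> min (val x) (val y) \<le> val (x + y)"
proof -
  assume "x \<noteq> 0" "y \<noteq> 0" "x + y \<noteq> 0"
  moreover have "min (v x) (v y) \<le> v (x + y)" using valuation_v by (auto simp: valuation_def)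
  ultimately show ?thesis by (simp add: v_eq)
qed

lemma val_1 [simp]: "val 1 = 0"
  using val_mult[of 1 1] by simp

lemma val_minus [simp]: "val (- x) = val x"
proof (cases "x = 0")
  case False
  have "val (-1) + val (-1) = 0" using val_mult[of "-1" "-1"] by simp
  then have "val (-1) = 0" by (metis double_zero)
  then show ?thesis using val_mult[of "-1" x] False by simp
qed simp

lemma val_diff_commute: "val (x - y) = val (y - x)"
  using val_minus[of "x - y"] by simp

text \<open>
  \<open>dfn A P\<close> is definability with constants from \<open>A\<close> of a relation between the entries of an
  environment. The rules below use de Bruijn indices: entry \<open>0\<close> is the innermost bound variable.
\<close>

definition var_or_const :: "'k set \<Rightarrow> ((nat \<Rightarrow> 'k) \<Rightarrow> 'k) \<Rightarrow> bool" where
  "var_or_const A t \<longleftrightarrow> (\<exists>i. t = (\<lambda>e. e i)) \<or> (\<exists>a\<in>A. t = (\<lambda>_. a))"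

definition dfn :: "'k set \<Rightarrow> ((nat \<Rightarrow> 'k) \<Rightarrow> bool) \<Rightarrow> bool" where
  "dfn A P \<longleftrightarrow>
     (\<exists>p \<tau>. wf_fm L p \<and> (\<forall>i. var_or_const A (\<tau> i)) \<and> P = (\<lambda>e. sat M (\<lambda>i. \<tau> i e) p))"

lemma var_or_const_var: "var_or_const A (\<lambda>e. e i)"
  and var_or_const_const: "a \<in> A \<Longrightarrow> var_or_const A (\<lambda>_. a)"
  by (auto simp: var_or_const_def)

lemma dfn_sat: "wf_fm L p \<Longrightarrow> (\<And>i. var_or_const A (\<tau> i)) \<Longrightarrow> dfn A (\<lambda>e. sat M (\<lambda>i. \<tau> i e) p)"
  by (auto simp: dfn_def)

lemma dfn_subst:
  assumes "dfn A P" "\<And>i. var_or_const A (\<tau> i)"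
  shows "dfn A (\<lambda>e. P (\<lambda>i. \<tau> i e))"
proof -
  obtain p \<sigma> where p: "wf_fm L p" "\<And>i. var_or_const A (\<sigma> i)" "P = (\<lambda>e. sat M (\<lambda>i. \<sigma> i e) p)"
    using assms(1) by (auto simp: dfn_def)
  have "var_or_const A (\<lambda>e. \<sigma> i (\<lambda>j. \<tau> j e))" for i
  proof -
    consider j where "\<sigma> i = (\<lambda>e. e j)" | a where "a \<in> A" "\<sigma> i = (\<lambda>_. a)"
      using p(2)[of i] by (auto simp: var_or_const_def)
    then show ?thesis using assms(2) by cases (auto simp: var_or_const_const)
  qed
  then show ?thesis unfolding p(3) by (rule dfn_sat[OF p(1)])
qed

text \<open>Two sets of constants matter: with none, a relation can become a symbol of the induced
  language; with all of \<open>K\<close>, C-minimality applies.\<close>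

lemma dfn_mono: "dfn A P \<Longrightarrow> A \<subseteq> B \<Longrightarrow> dfn B P"
proof -
  assume "dfn A P" and AB: "A \<subseteq> B"
  then obtain p \<tau> where "wf_fm L p" "\<And>i. var_or_const A (\<tau> i)" "P = (\<lambda>e. sat M (\<lambda>i. \<tau> i e) p)"
    by (auto simp: dfn_def)
  moreover have "var_or_const B (\<tau> i)" if "var_or_const A (\<tau> i)" for i
    using that AB by (auto simp: var_or_const_def)
  ultimately show ?thesis by (auto simp: dfn_def)
qed

lemma dfn_rename: "dfn A P \<Longrightarrow> dfn A (\<lambda>e. P (\<lambda>i. e (\<rho> i)))"
  by (erule dfn_subst) (rule var_or_const_var)

lemma dfn_neg: "dfn A P \<Longrightarrow> dfn A (\<lambda>e. \<not> P e)"
proof -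
  assume "dfn A P"
  then obtain p \<tau> where p: "wf_fm L p" "\<And>i. var_or_const A (\<tau> i)" "P = (\<lambda>e. sat M (\<lambda>i. \<tau> i e) p)"
    by (auto simp: dfn_def)
  then show ?thesis using dfn_sat[of "Neg p" A \<tau>] by simp
qed

lemma dfn_conj: "dfn A P \<Longrightarrow> dfn A Q \<Longrightarrow> dfn A (\<lambda>e. P e \<and> Q e)"
proof -
  assume "dfn A P" "dfn A Q"
  then obtain p \<tau> q \<sigma>
    where p: "wf_fm L p" "\<And>i. var_or_const A (\<tau> i)" "P = (\<lambda>e. sat M (\<lambda>i. \<tau> i e) p)"
      and q: "wf_fm L q" "\<And>i. var_or_const A (\<sigma> i)" "Q = (\<lambda>e. sat M (\<lambda>i. \<sigma> i e) q)"
    by (auto simp: dfn_def)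
  \<comment> \<open>The two substitutions are interleaved: \<open>p\<close> reads the even variables
    and \<open>q\<close> the odd ones.\<close>
  define \<rho> where "\<rho> i = (if even i then \<tau> (i div 2) else \<sigma> (i div 2))" for i
  have \<rho>: "var_or_const A (\<rho> i)" for i using p(2) q(2) by (simp add: \<rho>_def)
  have [simp]: "\<rho> (2 * i) = \<tau> i" "\<rho> (Suc (2 * i)) = \<sigma> i" for i by (simp_all add: \<rho>_def)
  have "wf_fm L (Conj (ren_fm (\<lambda>i. 2 * i) p) (ren_fm (\<lambda>i. 2 * i + 1) q))"
    using p q by (simp add: wf_ren_fm)
  from dfn_sat[OF this, where \<tau> = \<rho> and A = A, OF \<rho>] show ?thesis
    by (simp add: sat_ren_fm p(3) q(3))
qed

lemma dfn_disj: "dfn A P \<Longrightarrow> dfn A Q \<Longrightarrow> dfn A (\<lambda>e. P e \<or> Q e)"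
  using dfn_neg[OF dfn_conj[OF dfn_neg dfn_neg, of A P Q]] by simp

lemma dfn_imp: "dfn A P \<Longrightarrow> dfn A Q \<Longrightarrow> dfn A (\<lambda>e. P e \<longrightarrow> Q e)"
  using dfn_disj[OF dfn_neg, of A P Q] by simp

lemma dfn_iff: "dfn A P \<Longrightarrow> dfn A Q \<Longrightarrow> dfn A (\<lambda>e. P e \<longleftrightarrow> Q e)"
  using dfn_conj[OF dfn_imp dfn_imp, of A P Q Q P] by (simp add: iff_conv_conj_imp)

lemma dfn_ex:
  assumes "dfn A (\<lambda>e. P (\<lambda>i. e (Suc i)) (e 0))"
  shows "dfn A (\<lambda>e. \<exists>x. P e x)"
proof -
  obtain p \<tau> where p: "wf_fm L p" and \<tau>: "\<And>i. var_or_const A (\<tau> i)"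
    and P: "(\<lambda>e. P (\<lambda>i. e (Suc i)) (e 0)) = (\<lambda>e. sat M (\<lambda>i. \<tau> i e) p)"
    using assms by (auto simp: dfn_def)
  have "\<exists>s. var_or_const A s \<and> (\<tau> i \<noteq> (\<lambda>e. e 0) \<longrightarrow> (\<forall>e x. \<tau> i (case_nat x e) = s e))" for i
  proof -
    consider j where "\<tau> i = (\<lambda>e. e j)" | a where "a \<in> A" "\<tau> i = (\<lambda>_. a)"
      using \<tau>[of i] by (auto simp: var_or_const_def)
    then show ?thesis
    proof cases
      case 1
      show ?thesis
      proof (cases j)
        case 0
        then show ?thesis using 1 var_or_const_var by blast
      next
        case (Suc k)
        then show ?thesis using 1 by (intro exI[of _ "\<lambda>e. e k"]) (simp add: var_or_const_var)
      qed
    next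
      case 2
      then show ?thesis by (intro exI[of _ "\<lambda>_. a"]) (simp add: var_or_const_const)
    qed
  qed
  then obtain \<sigma> where \<sigma>: "\<And>i. var_or_const A (\<sigma> i)"
    "\<And>i e x. \<tau> i \<noteq> (\<lambda>e. e 0) \<Longrightarrow> \<tau> i (case_nat x e) = \<sigma> i e" by metis
  \<comment> \<open>Every variable of \<open>p\<close> that reads the quantified entry becomes
    variable 0; the others move up by one and are assigned by \<open>\<sigma>\<close> from the outer
    environment.\<close>
  define \<rho> where "\<rho> i = (if \<tau> i = (\<lambda>e. e 0) then 0 else Suc i)" for i
  define \<sigma>' where "\<sigma>' = case_nat (\<lambda>e. e 0) \<sigma>"
  have \<sigma>': "var_or_const A (\<sigma>' i)" for i
    using \<sigma>(1) var_or_const_var by (cases i) (auto simp: \<sigma>'_def)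
  have eq: "P e x = sat M ((\<lambda>i. \<sigma>' i e)(0 := x)) (ren_fm \<rho> p)" for e x
  proof -
    have "P e x = sat M (\<lambda>i. \<tau> i (case_nat x e)) p" using fun_cong[OF P, of "case_nat x e"] by simp
    also have "(\<lambda>i. \<tau> i (case_nat x e)) = (\<lambda>i. ((\<lambda>i. \<sigma>' i e)(0 := x)) (\<rho> i))"
      using \<sigma>(2) by (auto simp: \<rho>_def \<sigma>'_def fun_eq_iff)
    finally show ?thesis by (simp add: sat_ren_fm)
  qed
  have "wf_fm L (Exi 0 (ren_fm \<rho> p))" using p by (simp add: wf_ren_fm)
  from dfn_sat[OF this, where \<tau> = \<sigma>' and A = A, OF \<sigma>'] show ?thesis by (simp add: eq)
qed

lemma dfn_all:
  assumes "dfn A (\<lambda>e. P (\<lambda>i. e (Suc i)) (e 0))"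
  shows "dfn A (\<lambda>e. \<forall>x. P e x)"
  using dfn_neg[OF dfn_ex[OF dfn_neg[OF assms]]] by simp

lemma dfn_sat_var: "wf_fm L p \<Longrightarrow> dfn A (\<lambda>e. sat M (\<lambda>i. e (\<rho> i)) p)"
  by (erule dfn_sat) (rule var_or_const_var)

lemma dfn_const: "dfn A (\<lambda>e. b)"
proof -
  have "dfn A (\<lambda>e. True)"
    using dfn_sat_var[of "Equal (Var 0) (Var 0)" A id] by simp
  then show ?thesis using dfn_neg[of A "\<lambda>e. True"] by (cases b) auto
qed

subsection \<open>Definable functions to the field\<close>

definition dfnK :: "'k set \<Rightarrow> ((nat \<Rightarrow> 'k) \<Rightarrow> 'k) \<Rightarrow> bool" where
  "dfnK A t \<longleftrightarrow> dfn A (\<lambda>e. e 0 = t (\<lambda>i. e (Suc i)))"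

lemma dfn_eq_var: "dfn A (\<lambda>e. e i = e j)"
  using dfn_sat_var[of "Equal (Var i) (Var j)" A id] by simp

lemma dfnK_var: "dfnK A (\<lambda>e. e i)"
  unfolding dfnK_def by (rule dfn_eq_var)

lemma dfnK_const: "a \<in> A \<Longrightarrow> dfnK A (\<lambda>e. a)"
  unfolding dfnK_def
  using dfn_subst[OF dfn_eq_var[of A 0 1], of "\<lambda>i. if i = 1 then (\<lambda>e. a) else (\<lambda>e. e i)"]
  by (simp add: var_or_const_var var_or_const_const)

lemma dfn_substK:
  assumes "dfn A (\<lambda>e. P (\<lambda>i. e (Suc i)) (e 0))" "dfnK A t"
  shows "dfn A (\<lambda>e. P e (t e))"
proof -
  have "dfn A (\<lambda>e. \<exists>x. x = t e \<and> P e x)"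
    by (intro dfn_ex dfn_conj assms(1) assms(2)[unfolded dfnK_def])
  then show ?thesis by simp
qed

lemma dfnK_rename: "dfnK A t \<Longrightarrow> dfnK A (\<lambda>e. t (\<lambda>i. e (\<rho> i)))"
  unfolding dfnK_def
  by (drule dfn_rename[of _ _ "case_nat 0 (\<lambda>i. Suc (\<rho> i))"]) simp

lemma dfn_eqK: "dfnK A s \<Longrightarrow> dfnK A t \<Longrightarrow> dfn A (\<lambda>e. s e = t e)"
  by (rule dfn_substK[where t = s]) (simp_all add: dfnK_def)

lemma funs_L: "(Zero, 0) \<in> funs L" "(Sub, 2) \<in> funs L" "(Mul, 2) \<in> funs L"
    "(Div, 2) \<in> rels L"
  using extends_L by (auto simp: extends_L_div_def L_div_def)

lemma dfnK_binop:
  assumes "\<And>i j k. dfn A (\<lambda>e. e i = op (e j) (e k))" "dfnK A s" "dfnK A t"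
  shows "dfnK A (\<lambda>e. op (s e) (t e))"
proof -
  have "dfn A (\<lambda>e. e (Suc 0) = op (s (\<lambda>i. e (Suc (Suc i)))) (e 0))"
    by (rule dfn_substK[where P = "\<lambda>e y. e (Suc 0) = op y (e 0)" and
          t = "\<lambda>e. s (\<lambda>i. e (Suc (Suc i)))"])
      (rule assms(1) dfnK_rename[OF assms(2)])+
  then show ?thesis unfolding dfnK_def
    by (rule dfn_substK[where P = "\<lambda>e y. e 0 = op (s (\<lambda>i. e (Suc i))) y" and
          t = "\<lambda>e. t (\<lambda>i. e (Suc i))"])
      (rule dfnK_rename[OF assms(3)])
qed

lemma dfnK_diff: "dfnK A s \<Longrightarrow> dfnK A t \<Longrightarrow> dfnK A (\<lambda>e. s e - t e)"
proof (rule dfnK_binop[where op = minus])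
  show "dfn A (\<lambda>e. e i = e j - e k)" for i j k
    using dfn_sat_var[of "Equal (Var i) (Fun Sub [Var j, Var k])" A id] funs_L
    by (simp add: fn_Sub numeral_2_eq_2)
qed

lemma dfnK_mult: "dfnK A s \<Longrightarrow> dfnK A t \<Longrightarrow> dfnK A (\<lambda>e. s e * t e)"
proof (rule dfnK_binop[where op = times])
  show "dfn A (\<lambda>e. e i = e j * e k)" for i j k
    using dfn_sat_var[of "Equal (Var i) (Fun Mul [Var j, Var k])" A id] funs_L
    by (simp add: fn_Mul numeral_2_eq_2)
qed

lemma dfnK_0: "dfnK A (\<lambda>e. 0)"
  unfolding dfnK_def
  using dfn_sat_var[of "Equal (Var 0) (Fun Zero [])" A id] funs_L by (simp add: fn_Zero)

subsection \<open>Definable functions to the value group\<close>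

definition dfnG :: "'k set \<Rightarrow> ((nat \<Rightarrow> 'k) \<Rightarrow> 'g) \<Rightarrow> bool" where
  "dfnG A t \<longleftrightarrow> dfn A (\<lambda>e. val (e 0) = t (\<lambda>i. e (Suc i)))"

lemma dfn_exG:
  assumes "dfn A (\<lambda>e. P (\<lambda>i. e (Suc i)) (val (e 0)))"
  shows "dfn A (\<lambda>e. \<exists>\<gamma>. P e \<gamma>)"
proof -
  have "(\<exists>\<gamma>. P e \<gamma>) \<longleftrightarrow> (\<exists>x. P e (val x))" for e using ex_val by metis
  then show ?thesis by (simp add: dfn_ex[of A "\<lambda>e x. P e (val x)", OF assms])
qed

lemma dfn_allG:
  assumes "dfn A (\<lambda>e. P (\<lambda>i. e (Suc i)) (val (e 0)))"
  shows "dfn A (\<lambda>e. \<forall>\<gamma>. P e \<gamma>)"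
  using dfn_neg[OF dfn_exG[OF dfn_neg[OF assms]]] by simp

lemma dfn_substG:
  assumes "dfn A (\<lambda>e. P (\<lambda>i. e (Suc i)) (val (e 0)))" "dfnG A t"
  shows "dfn A (\<lambda>e. P e (t e))"
proof -
  have "dfn A (\<lambda>e. \<exists>\<gamma>. \<gamma> = t e \<and> P e \<gamma>)"
    by (intro dfn_exG dfn_conj assms(1) assms(2)[unfolded dfnG_def])
  then show ?thesis by simp
qed

lemma dfnG_rename: "dfnG A t \<Longrightarrow> dfnG A (\<lambda>e. t (\<lambda>i. e (\<rho> i)))"
  unfolding dfnG_def
  by (drule dfn_rename[of _ _ "case_nat 0 (\<lambda>i. Suc (\<rho> i))"]) simp

lemma dfn_binrelG:
  assumes "\<And>i j. dfn A (\<lambda>e. R (val (e i)) (val (e j)))" "dfnG A s" "dfnG A t"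
  shows "dfn A (\<lambda>e. R (s e) (t e))"
proof -
  have "dfn A (\<lambda>e. R (s (\<lambda>i. e (Suc i))) (val (e 0)))"
    by (rule dfn_substG[where P = "\<lambda>e y. R y (val (e 0))" and t = "\<lambda>e. s (\<lambda>i. e (Suc i))"])
      (rule assms(1) dfnG_rename[OF assms(2)])+
  then show ?thesis by (rule dfn_substG[where P = "\<lambda>e. R (s e)"]) (rule assms)
qed

lemma dfnK_1: "dfnK A (\<lambda>e. 1)"
proof -
  have "(One, 0) \<in> funs L" using extends_L by (auto simp: extends_L_div_def L_div_def)
  moreover have "fn_int M One [] = 1" using expands by (auto simp: expands_valued_field_def)
  ultimately show ?thesis unfolding dfnK_def
    using dfn_sat_var[of "Equal (Var 0) (Fun One [])" A id] by simp
qed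

lemma dfn_val_le_var: "dfn A (\<lambda>e. val (e i) \<le> val (e j))"
proof -
  have div: "dfn A (\<lambda>e. v (e i) \<le> v (e j))" for i j
    using dfn_sat_var[of "Rel Div [Var i, Var j]" A id] funs_L
    by (simp add: rel_Div numeral_2_eq_2)
  \<comment> \<open>For \<open>div\<close> the value of 0 is infinite, while \<open>val 0\<close> is
    0; so an entry 0 is replaced by 1, whose value is 0.\<close>
  have "dfn A (\<lambda>e. \<exists>x. \<exists>y. (e i = 0 \<and> x = 1 \<or> e i \<noteq> 0 \<and> x = e i) \<and>
     (e j = 0 \<and> y = 1 \<or> e j \<noteq> 0 \<and> y = e j) \<and> v x \<le> v y)"
    by (intro dfn_ex dfn_conj div dfn_disj dfn_neg dfn_eqK dfnK_var dfnK_0 dfnK_1)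
  moreover have "(\<exists>x. \<exists>y. (e i = 0 \<and> x = 1 \<or> e i \<noteq> 0 \<and> x = e i) \<and>
     (e j = 0 \<and> y = 1 \<or> e j \<noteq> 0 \<and> y = e j) \<and> v x \<le> v y) \<longleftrightarrow> val (e i) \<le> val (e j)" for e
    by (cases "e i = 0"; cases "e j = 0") (simp_all add: v_eq)
  ultimately show ?thesis by simp
qed

lemma dfn_le: "dfnG A s \<Longrightarrow> dfnG A t \<Longrightarrow> dfn A (\<lambda>e. s e \<le> t e)"
  by (rule dfn_binrelG[where R = less_eq, OF dfn_val_le_var])

lemma dfn_less: "dfnG A s \<Longrightarrow> dfnG A t \<Longrightarrow> dfn A (\<lambda>e. s e < t e)"
  unfolding not_le[symmetric] by (rule dfn_neg[OF dfn_le])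

lemma dfn_eqG: "dfnG A s \<Longrightarrow> dfnG A t \<Longrightarrow> dfn A (\<lambda>e. s e = t e)"
  unfolding order.eq_iff by (intro dfn_conj dfn_le)

lemma dfnG_val_var: "dfnG A (\<lambda>e. val (e i))"
  unfolding dfnG_def order.eq_iff by (intro dfn_conj dfn_val_le_var)

lemma dfnG_const: "dfnG UNIV (\<lambda>e. \<gamma>)"
proof -
  obtain x where "val x = \<gamma>" using ex_val by blast
  then show ?thesis unfolding dfnG_def
    using dfn_substK[of UNIV "\<lambda>e x. val (e 0) = val x", OF _ dfnK_const[of x]]
      dfnG_val_var[of UNIV 0, unfolded dfnG_def, THEN dfn_rename[where \<rho> = "case_nat 1 (\<lambda>i. i)"]]
    by simp
qed

lemma dfnG_0: "dfnG A (\<lambda>e. 0)"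
proof -
  have "dfn A (\<lambda>e. \<exists>x. x = 0 \<and> val (e 0) = val x)"
    by (intro dfn_ex dfn_conj dfn_eqK dfnK_var dfnK_0 dfn_eqG dfnG_val_var)
  then show ?thesis by (simp add: dfnG_def)
qed

lemma dfnG_val: "dfnK A t \<Longrightarrow> dfnG A (\<lambda>e. val (t e))"
  unfolding dfnG_def
  by (rule dfn_substK[where P = "\<lambda>e y. val (e 0) = val y" and t = "\<lambda>e. t (\<lambda>i. e (Suc i))"])
     (intro dfn_eqG dfnG_val_var, erule dfnK_rename)

lemma dfnG_binop:
  assumes "\<And>i j k. dfn A (\<lambda>e. val (e i) = op (val (e j)) (val (e k)))" "dfnG A s" "dfnG A t"
  shows "dfnG A (\<lambda>e. op (s e) (t e))"
proof -
  have "dfn A (\<lambda>e. val (e (Suc 0)) = op (s (\<lambda>i. e (Suc (Suc i)))) (val (e 0)))"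
    by (rule dfn_substG[where P = "\<lambda>e y. val (e (Suc 0)) = op y (val (e 0))" and
          t = "\<lambda>e. s (\<lambda>i. e (Suc (Suc i)))"])
      (rule assms(1) dfnG_rename[OF assms(2)])+
  then show ?thesis unfolding dfnG_def
    by (rule dfn_substG[where P = "\<lambda>e y. val (e 0) = op (s (\<lambda>i. e (Suc i))) y" and
          t = "\<lambda>e. t (\<lambda>i. e (Suc i))"])
      (rule dfnG_rename[OF assms(3)])
qed

lemma dfn_val_add: "dfn A (\<lambda>e. val (e i) = val (e j) + val (e k))"
proof -
  have "dfn A (\<lambda>e. \<exists>x. \<exists>y. x \<noteq> 0 \<and> y \<noteq> 0 \<and> val x = val (e j) \<and> val y = val (e k) \<and>
    val (e i) = val (x * y))"
    by (intro dfn_ex dfn_conj dfn_neg dfn_eqK dfn_eqG dfnG_val dfnK_mult dfnK_0 dfnK_var)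
  moreover have "(\<exists>x. \<exists>y. x \<noteq> 0 \<and> y \<noteq> 0 \<and> val x = val (e j) \<and> val y = val (e k) \<and>
    val (e i) = val (x * y)) \<longleftrightarrow> val (e i) = val (e j) + val (e k)" for e
    using ex_val[of "val (e j)"] ex_val[of "val (e k)"] val_mult by (metis (no_types, lifting))
  ultimately show ?thesis by simp
qed

lemma dfnG_add: "dfnG A s \<Longrightarrow> dfnG A t \<Longrightarrow> dfnG A (\<lambda>e. s e + t e)"
  by (rule dfnG_binop[where op = plus, OF dfn_val_add])

lemma dfnG_diff: "dfnG A s \<Longrightarrow> dfnG A t \<Longrightarrow> dfnG A (\<lambda>e. s e - t e)"
proof (rule dfnG_binop[where op = minus])
  fix i j k :: nat
  have "(\<lambda>e. val (e i) = val (e j) - val (e k)) = (\<lambda>e. val (e j) = val (e i) + val (e k))"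
    by (auto simp: fun_eq_iff algebra_simps)
  then show "dfn A (\<lambda>e. val (e i) = val (e j) - val (e k))"
    by (simp only: dfn_val_add)
qed

lemma dfnG_uminus: "dfnG A s \<Longrightarrow> dfnG A (\<lambda>e. - s e)"
  using dfnG_diff[OF dfnG_0, of A s] by simp

text \<open>The means by which functions to the value group are built below: a supremum with a
  default is total and needs no new constants.\<close>

lemma dfnG_lub:
  assumes "dfn A (\<lambda>e. P (\<lambda>i. e (Suc i)) (val (e 0)))"
  shows "dfnG A (\<lambda>e. lub {\<gamma>. P e \<gamma>})"
proof -
  have P: "dfn A (\<lambda>e. P (\<lambda>i. e (\<rho> i)) (val (e j)))" for \<rho> j
    using dfn_rename[OF assms, of "case_nat j \<rho>"] by simp
  show ?thesis
    unfolding dfnG_def eq_commute[of "val _"] lub_eq_iff is_lub_def mem_Collect_eq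
    by (intro dfn_disj dfn_conj dfn_neg dfn_exG dfn_allG dfn_iff dfn_imp dfn_le dfn_eqG
        dfnG_0 dfnG_val_var P)
qed

lemma dfn_app1:
  assumes "dfn A (\<lambda>e. P (e 0))" "dfnK A t"
  shows "dfn A (\<lambda>e. P (t e))"
  by (rule dfn_substK[of A "\<lambda>e. P", OF assms])

lemma dfn_app1G:
  assumes "dfn A (\<lambda>e. P (val (e 0)))" "dfnG A t"
  shows "dfn A (\<lambda>e. P (t e))"
  by (rule dfn_substG[of A "\<lambda>e. P", OF assms])

lemma dfnG_app1:
  assumes "dfnG A (\<lambda>e. h (e 0))" "dfnK A s"
  shows "dfnG A (\<lambda>e. h (s e))"
proof -
  have "dfn A (\<lambda>e. val (e i) = h (e j))" for i j
    using dfn_rename[OF assms(1)[unfolded dfnG_def], of "case_nat i (\<lambda>_. j)"]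
    by simp
  then show ?thesis unfolding dfnG_def
    by (rule dfn_substK[where t = "\<lambda>e. s (\<lambda>i. e (Suc i))"]) (rule dfnK_rename[OF assms(2)])
qed

lemma dfnG_app1G:
  assumes "dfnG A (\<lambda>e. h (val (e 0)))" "dfnG A s"
  shows "dfnG A (\<lambda>e. h (s e))"
proof -
  have "dfn A (\<lambda>e. val (e i) = h (val (e j)))" for i j
    using dfn_rename[OF assms(1)[unfolded dfnG_def], of "case_nat i (\<lambda>_. j)"]
    by simp
  then show ?thesis unfolding dfnG_def
    by (rule dfn_substG[where t = "\<lambda>e. s (\<lambda>i. e (Suc i))"]) (rule dfnG_rename[OF assms(2)])
qed

lemmas dfn_intros = dfn_conj dfn_disj dfn_imp dfn_iff dfn_neg dfn_ex dfn_all dfn_exG dfn_allG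
  dfn_eqK dfn_le dfn_less dfn_eqG dfnK_0 dfnK_diff dfnK_mult dfnK_var dfnG_0 dfnG_add dfnG_diff
  dfnG_uminus dfnG_val

lemmas dfnU_intros = dfn_intros dfnG_const dfnK_const[OF UNIV_I]

section \<open>Consequences of C-minimality\<close>

text \<open>A square root halves the value. Density of the value group and the doubling arguments
  for slopes rest on this.\<close>

lemma half: "\<exists>h::'g. h + h = a"
proof -
  obtain z where z: "z \<noteq> 0" "val z = a" using ex_val by blast
  obtain w where w: "w ^ 2 = z" using nth_root_exists[of 2 z] by auto
  then have "w \<noteq> 0" using z by auto
  then show ?thesis using w z val_mult[of w w] by (auto simp: power2_eq_square)
qed

lemma dense: "a < b \<Longrightarrow> \<exists>c::'g. a < c \<and> c < b"
proof -
  assume ab: "a < b"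
  obtain w where h: "w + w = b - a" using half by blast
  then have "0 < w + w" using ab by simp
  then have w: "0 < w" by simp
  moreover have "a + w < a + (w + w)" using w by simp
  then have "a + w < b" unfolding h by simp
  ultimately have "a < a + w" "a + w < b" by simp_all
  then show ?thesis by blast
qed

lemma ex_pos: "\<exists>p::'g. p > 0"
  using nontrivial by (metis neg_0_less_iff_less not_less_iff_gr_or_eq)

lemma gt_ex: "\<exists>b. a < (b::'g)"
  using ex_pos by (metis less_add_same_cancel1)

lemma lt_ex: "\<exists>b. b < (a::'g)"
  using ex_pos by (metis diff_less_eq less_add_same_cancel1)

lemma above_finite: "finite C \<Longrightarrow> \<exists>b>a. \<forall>c\<in>C. c < (b::'g)"
proof -
  assume "finite C"
  then obtain b where "Max (insert a C) < b" using gt_ex by blast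
  with \<open>finite C\<close> show ?thesis by auto
qed

text \<open>Here and in \<open>ob\<close> the disjunct \<open>x = a\<close> stands for an infinite
  value, as \<open>val 0\<close> is 0.\<close>

definition cb :: "'k \<Rightarrow> 'g \<Rightarrow> 'k set" where
  "cb a r = {x. x = a \<or> r \<le> val (x - a)}"

definition ob :: "'k \<Rightarrow> 'g \<Rightarrow> 'k set" where
  "ob a r = {x. x = a \<or> r < val (x - a)}"

lemma val_diff_le: "x \<noteq> y \<Longrightarrow> y \<noteq> z \<Longrightarrow> x \<noteq> z \<Longrightarrow> min (val (x - y)) (val (y - z)) \<le> val (x - z)"
  using val_add[of "x - y" "y - z"] by simp

lemma val_diff_eq:
  assumes "x \<noteq> y" "y = z \<or> val (x - y) < val (y - z)"
  shows "x \<noteq> z" "val (x - z) = val (x - y)"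
proof -
  show "x \<noteq> z" using assms val_diff_commute[of x y] by auto
  then show "val (x - z) = val (x - y)"
    using assms val_diff_le[of x y z] val_diff_le[of x z y] val_diff_commute[of y z]
    by (cases "y = z") (auto simp: min_def split: if_splits)
qed

lemma cb_refl [simp]: "a \<in> cb a r" by (simp add: cb_def)
lemma ob_refl [simp]: "a \<in> ob a r" by (simp add: ob_def)

lemma cb_sym: "x \<in> cb a r \<longleftrightarrow> a \<in> cb x r"
  using val_diff_commute[of x a] by (auto simp: cb_def)

lemma ob_sym: "x \<in> ob a r \<longleftrightarrow> a \<in> ob x r"
  using val_diff_commute[of x a] by (auto simp: ob_def)

lemma cb_trans: "x \<in> cb y r \<Longrightarrow> y \<in> cb z r \<Longrightarrow> x \<in> cb z r"
  using val_diff_le[of x y z]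
  by (cases "x = y"; cases "y = z"; cases "x = z") (auto simp: cb_def min_le_iff_disj)

lemma ob_trans: "x \<in> ob y r \<Longrightarrow> y \<in> ob z r \<Longrightarrow> x \<in> ob z r"
  using val_diff_le[of x y z]
  by (cases "x = y"; cases "y = z"; cases "x = z") (auto simp: ob_def min_le_iff_disj)

lemma cb_eq: "x \<in> cb a r \<Longrightarrow> cb x r = cb a r"
  using cb_trans cb_sym by blast

lemma ob_eq: "x \<in> ob a r \<Longrightarrow> ob x r = ob a r"
  using ob_trans ob_sym by blast

lemma cb_mono: "s \<le> r \<Longrightarrow> cb a r \<subseteq> cb a s"
  by (auto simp: cb_def)

lemma ob_subset_cb: "ob a r \<subseteq> cb a r"
  by (auto simp: cb_def ob_def)

text \<open>The whole field is left out: it separates no two points, so a support can omit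
  it.\<close>

definition is_ball :: "'k set \<Rightarrow> bool" where
  "is_ball B \<longleftrightarrow> (\<exists>a r. B = cb a r) \<or> (\<exists>a r. B = ob a r) \<or> (\<exists>a. B = {a})"

lemma is_ball_nonempty: "is_ball B \<Longrightarrow> \<exists>a. a \<in> B"
  unfolding is_ball_def using cb_refl ob_refl by blast

lemma is_ball_center:
  assumes "is_ball B" "a \<in> B"
  obtains r where "B = cb a r" | r where "B = ob a r" | "B = {a}"
  using assms cb_eq ob_eq unfolding is_ball_def by blast

lemma is_ball_convex:
  assumes "is_ball B" "x \<in> B" "a \<in> B" "x \<noteq> a" "y \<in> cb x (val (x - a))"
  shows "y \<in> B"
proof -
  have v: "val (a - x) = val (x - a)" by (rule val_diff_commute)
  from assms(1,2) show ?thesis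
  proof (cases rule: is_ball_center)
    case (1 r)
    then show ?thesis using assms(3-5) v by (auto simp: cb_def)
  next
    case (2 r)
    then show ?thesis using assms(3-5) v by (auto simp: cb_def ob_def)
  next
    case 3
    then show ?thesis using assms(3-5) by auto
  qed
qed

text \<open>A common point would have the same distance from \<open>a\<close> as \<open>x\<close>,
  and with \<open>a\<close> it would span a closed ball inside \<open>B\<close> that contains
  \<open>x\<close>.\<close>

lemma is_ball_separate:
  assumes B: "is_ball B" and x: "x \<notin> B" and a: "a \<in> B" and s: "val (x - a) < s"
  shows "cb x s \<inter> B = {}"
proof (rule ccontr)
  assume "cb x s \<inter> B \<noteq> {}"
  then obtain y where y: "y \<in> cb x s" "y \<in> B" by blast
  have xa: "x \<noteq> a" using x a by auto
  have v: "val (a - x) = val (x - a)" "val (a - y) = val (y - a)"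
    by (rule val_diff_commute)+
  have xy: "x = y \<or> s \<le> val (x - y)" using y(1) by (auto simp: cb_def val_diff_commute[of y x])
  then have "x = y \<or> val (a - x) < val (x - y)" using s v(1) by auto
  then have ay: "a \<noteq> y" "val (a - y) = val (a - x)"
    using val_diff_eq[of a x y] xa by auto
  have "x \<in> cb y (val (y - a))" using xy s ay v by (auto simp: cb_def)
  then show False using is_ball_convex[OF B y(2) a] ay x by auto
qed

section \<open>Definable sets and their supporting balls\<close>

definition dset :: "'k set \<Rightarrow> bool" where
  "dset S \<longleftrightarrow> dfn UNIV (\<lambda>e. e 0 \<in> S)"

definition gset :: "'g set \<Rightarrow> bool" where
  "gset S \<longleftrightarrow> dfn UNIV (\<lambda>e. val (e 0) \<in> S)"

lemma dset_Collect: "dfn UNIV (\<lambda>e. P (e 0)) \<Longrightarrow> dset {x. P x}"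
  by (simp add: dset_def)

lemma gset_Collect: "dfn UNIV (\<lambda>e. P (val (e 0))) \<Longrightarrow> gset {x. P x}"
  by (simp add: gset_def)

lemma dfn_mem: "dset S \<Longrightarrow> dfnK UNIV t \<Longrightarrow> dfn UNIV (\<lambda>e. t e \<in> S)"
  unfolding dset_def by (rule dfn_app1)

lemma dfn_memG: "gset S \<Longrightarrow> dfnG UNIV t \<Longrightarrow> dfn UNIV (\<lambda>e. t e \<in> S)"
  unfolding gset_def by (rule dfn_app1G)

lemma dfn_cb: "dfnK A s \<Longrightarrow> dfnK A t \<Longrightarrow> dfnG A r \<Longrightarrow> dfn A (\<lambda>e. s e \<in> cb (t e) (r e))"
  unfolding cb_def mem_Collect_eq by (intro dfn_intros)

lemma dfn_ob: "dfnK A s \<Longrightarrow> dfnK A t \<Longrightarrow> dfnG A r \<Longrightarrow> dfn A (\<lambda>e. s e \<in> ob (t e) (r e))"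
  unfolding ob_def mem_Collect_eq by (intro dfn_intros)

lemma dset_boolean_combination:
  assumes "dset S"
  shows "S \<in> boolean_combinations UNIV (balls M)"
proof -
  obtain p \<tau> where p: "wf_fm L p" and \<tau>: "\<And>i. var_or_const UNIV (\<tau> i)"
    and S: "(\<lambda>e. e 0 \<in> S) = (\<lambda>e. sat M (\<lambda>i. \<tau> i e) p)"
    using assms by (auto simp: dset_def dfn_def)
  \<comment> \<open>Membership of entry 0 in \<open>S\<close> does not depend on the other entries.
    These are set to 0 and, like the constants, become parameters; they move up by one to leave
    variable 0 to the element.\<close>
  define \<rho> where "\<rho> i = (if \<tau> i = (\<lambda>e. e 0) then 0 else Suc i)" for i
  define e where "e i = \<tau> (i - 1) (\<lambda>_. 0)" for i
  have \<tau>_upd: "\<tau> i ((\<lambda>_. 0)(0 := x)) = \<tau> i (\<lambda>_. 0)" if "\<tau> i \<noteq> (\<lambda>e. e 0)" for i x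
    using \<tau>[of i] that by (auto simp: var_or_const_def)
  have "x \<in> S \<longleftrightarrow> sat M (e(0 := x)) (ren_fm \<rho> p)" for x
  proof -
    have "x \<in> S \<longleftrightarrow> sat M (\<lambda>i. \<tau> i ((\<lambda>_. 0)(0 := x))) p"
      using fun_cong[OF S, of "(\<lambda>_. 0)(0 := x)"] by simp
    also have "(\<lambda>i. \<tau> i ((\<lambda>_. 0)(0 := x))) = (\<lambda>i. (e(0 := x)) (\<rho> i))"
    proof
      fix i
      show "\<tau> i ((\<lambda>_. 0)(0 := x)) = (e(0 := x)) (\<rho> i)"
      proof (cases "\<tau> i = (\<lambda>e. e 0)")
        case True
        then show ?thesis by (simp add: \<rho>_def)
      next
        case False
        then show ?thesis using \<tau>_upd[OF False] by (simp add: \<rho>_def e_def)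
      qed
    qed
    finally show ?thesis by (simp add: sat_ren_fm)
  qed
  then have "S = {x \<in> carr M. sat M (e(0 := x)) (ren_fm \<rho> p)}" by auto
  then have "definable L M 1 ((\<lambda>x. [x]) ` S)"
    unfolding definable_def singletons_eq_solutions using p
    by (intro exI[of _ "ren_fm \<rho> p"] exI[of _ e]) (simp add: wf_ren_fm)
  moreover have "definable_subsets_from_balls L M"
  proof (rule C_minimal_all_types[OF extends_L C_minimal])
    show "is_struct L M" by (simp add: is_struct_def)
    show "elem_equiv L M M" unfolding elem_equiv_def by (auto intro!: sat_cong)
  qed
  ultimately show ?thesis unfolding definable_subsets_from_balls_def by simp
qed

lemma balls_M: "B \<in> balls M \<Longrightarrow> is_ball B \<or> B = UNIV"
proof -
  assume "B \<in> balls M"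
  then consider a \<gamma> where "B = {x. v (x - a) \<ge> \<gamma>}" "\<gamma> \<noteq> -\<infinity>"
    | a \<gamma> where "B = {x. v (x - a) > \<gamma>}" "\<gamma> \<noteq> \<infinity>"
    unfolding balls_valued[OF expands] by blast
  then show ?thesis
  proof cases
    case 1
    then show ?thesis
    proof (cases \<gamma>)
      case (Fin r)
      then have "B = cb a r" using 1 by (auto simp: cb_def v_eq split: if_splits)
      then show ?thesis by (auto simp: is_ball_def)
    next
      case Pinf
      then have "B = {a}" using 1 by (auto simp: v_eq split: if_splits)
      then show ?thesis by (auto simp: is_ball_def)
    qed simp
  next
    case 2
    then show ?thesis
    proof (cases \<gamma>)
      case (Fin r)
      then have "B = ob a r" using 2 by (auto simp: ob_def v_eq split: if_splits)
      then show ?thesis by (auto simp: is_ball_def)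
    next
      case Minf
      then have "B = UNIV" using 2 by (auto simp: v_eq split: if_splits)
      then show ?thesis by simp
    qed simp
  qed
qed

lemma boolean_combination_support:
  assumes "S \<in> boolean_combinations UNIV (balls M)"
  shows "\<exists>\<B>. finite \<B> \<and> (\<forall>B\<in>\<B>. is_ball B) \<and>
    (\<forall>x y. (\<forall>B\<in>\<B>. x \<in> B \<longleftrightarrow> y \<in> B) \<longrightarrow> (x \<in> S \<longleftrightarrow> y \<in> S))"
  using assms
proof induction
  case (basic S)
  from balls_M[OF basic] show ?case
  proof
    assume "is_ball S"
    then show ?thesis by (intro exI[of _ "{S}"]) auto
  next
    assume "S = UNIV"
    then show ?thesis by (intro exI[of _ "{}"]) auto
  qed
next
  case (compl S)
  then show ?case by (metis Diff_iff UNIV_I)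
next
  case (union S T)
  then obtain \<B> \<C> where "finite \<B>" "\<forall>B\<in>\<B>. is_ball B"
    "\<forall>x y. (\<forall>B\<in>\<B>. x \<in> B \<longleftrightarrow> y \<in> B) \<longrightarrow> (x \<in> S \<longleftrightarrow> y \<in> S)"
    and "finite \<C>" "\<forall>B\<in>\<C>. is_ball B"
    "\<forall>x y. (\<forall>B\<in>\<C>. x \<in> B \<longleftrightarrow> y \<in> B) \<longrightarrow> (x \<in> T \<longleftrightarrow> y \<in> T)" by blast
  then have "x \<in> S \<union> T \<longleftrightarrow> y \<in> S \<union> T" if "\<forall>B\<in>\<B> \<union> \<C>. x \<in> B \<longleftrightarrow> y \<in> B" for x y
    using that by (metis UnCI Un_iff)
  moreover have "finite (\<B> \<union> \<C>)" "\<forall>B\<in>\<B> \<union> \<C>. is_ball B"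
    using \<open>finite \<B>\<close> \<open>finite \<C>\<close> \<open>\<forall>B\<in>\<B>. is_ball B\<close> \<open>\<forall>B\<in>\<C>. is_ball B\<close> by auto
  ultimately show ?case by blast
qed

lemma dset_support:
  assumes "dset S"
  obtains \<B> pt where "finite \<B>" "\<And>B. B \<in> \<B> \<Longrightarrow> is_ball B" "\<And>B. B \<in> \<B> \<Longrightarrow> pt B \<in> B"
    "\<And>x y. (\<And>B. B \<in> \<B> \<Longrightarrow> x \<in> B \<longleftrightarrow> y \<in> B) \<Longrightarrow> x \<in> S \<longleftrightarrow> y \<in> S"
proof -
  obtain \<B> where \<B>: "finite \<B>" "\<And>B. B \<in> \<B> \<Longrightarrow> is_ball B"
    "\<And>x y. (\<And>B. B \<in> \<B> \<Longrightarrow> x \<in> B \<longleftrightarrow> y \<in> B) \<Longrightarrow> x \<in> S \<longleftrightarrow> y \<in> S"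
    using boolean_combination_support[OF dset_boolean_combination[OF assms]] by metis
  obtain pt where "\<And>B. B \<in> \<B> \<Longrightarrow> pt B \<in> B" using is_ball_nonempty \<B>(2) by metis
  with \<B> that show ?thesis by blast
qed

text \<open>If \<open>a\<close> lies in \<open>B\<close>, the radius of \<open>B\<close>, if any, is
  critical. Otherwise all points of \<open>B\<close> have the same distance from \<open>a\<close>,
  and that value is critical: a point of \<open>B\<close> at another distance would span with
  \<open>b\<close> a closed ball containing \<open>a\<close>.\<close>

lemma ball_center_critical:
  assumes B: "is_ball B"
  shows "\<exists>c. \<forall>x y. x \<noteq> a \<and> y \<noteq> a \<and> val (x - a) \<le> val (y - a) \<and>
    \<not> (val (x - a) \<le> c \<and> c \<le> val (y - a)) \<longrightarrow> (x \<in> B \<longleftrightarrow> y \<in> B)"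
proof (cases "a \<in> B")
  case True
  from B True show ?thesis
  proof (cases rule: is_ball_center)
    case (1 r)
    then show ?thesis by (intro exI[of _ r]) (auto simp: cb_def)
  next
    case (2 r)
    then show ?thesis by (intro exI[of _ r]) (auto simp: ob_def)
  next
    case 3
    then show ?thesis by auto
  qed
next
  case False
  obtain b where b: "b \<in> B" using is_ball_nonempty[OF B] by blast
  have "x \<notin> B" if "x \<noteq> a" "val (x - a) \<noteq> val (b - a)" for x
  proof
    assume x: "x \<in> B"
    have "x \<noteq> b" using that by auto
    moreover have "val (x - b) \<le> val (x - a)"
    proof (cases "val (x - a) < val (b - a)")
      case True
      then show ?thesis using val_diff_eq(2)[of x a b] that(1) val_diff_commute[of b a] by simp
    next
      case less: False
      then have "val (b - a) < val (x - a)" using that(2) by simp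
      then have "val (b - x) = val (b - a)"
        using val_diff_eq(2)[of b a x] b False val_diff_commute[of x a] by auto
      then show ?thesis using less val_diff_commute[of x b] by simp
    qed
    then have "a \<in> cb x (val (x - b))" using val_diff_commute[of x a] by (auto simp: cb_def)
    ultimately show False using is_ball_convex[OF B x b] False by blast
  qed
  then show ?thesis by (intro exI[of _ "val (b - a)"]) auto
qed

lemma dset_center:
  assumes "dset S"
  shows "\<exists>C. finite C \<and> (\<forall>x y. x \<noteq> a \<and> y \<noteq> a \<and> val (x - a) \<le> val (y - a) \<and>
    (\<forall>c\<in>C. \<not> (val (x - a) \<le> c \<and> c \<le> val (y - a))) \<longrightarrow> (x \<in> S \<longleftrightarrow> y \<in> S))"
proof -
  obtain \<B> pt where \<B>: "finite \<B>" "\<And>B. B \<in> \<B> \<Longrightarrow> is_ball B"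
    "\<And>x y. (\<And>B. B \<in> \<B> \<Longrightarrow> x \<in> B \<longleftrightarrow> y \<in> B) \<Longrightarrow> x \<in> S \<longleftrightarrow> y \<in> S"
    using dset_support[OF assms] by metis
  have "\<exists>c. \<forall>B\<in>\<B>. \<forall>x y. x \<noteq> a \<and> y \<noteq> a \<and> val (x - a) \<le> val (y - a) \<and>
    \<not> (val (x - a) \<le> c B \<and> c B \<le> val (y - a)) \<longrightarrow> (x \<in> B \<longleftrightarrow> y \<in> B)"
    by (intro bchoice ballI ball_center_critical \<B>(2))
  then obtain c where c: "\<forall>B\<in>\<B>. \<forall>x y. x \<noteq> a \<and> y \<noteq> a \<and> val (x - a) \<le> val (y - a) \<and>
    \<not> (val (x - a) \<le> c B \<and> c B \<le> val (y - a)) \<longrightarrow> (x \<in> B \<longleftrightarrow> y \<in> B)" ..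
  have "x \<in> S \<longleftrightarrow> y \<in> S" if "x \<noteq> a" "y \<noteq> a" "val (x - a) \<le> val (y - a)"
    "\<forall>c\<in>c ` \<B>. \<not> (val (x - a) \<le> c \<and> c \<le> val (y - a))" for x y
    by (rule \<B>(3)) (use that c in blast)
  with \<B>(1) show ?thesis by (intro exI[of _ "c ` \<B>"]) blast
qed

definition few :: "'g \<Rightarrow> 'k set \<Rightarrow> bool" where
  "few r S \<longleftrightarrow> (\<exists>F. finite F \<and> S \<subseteq> (\<Union>a\<in>F. cb a r))"

text \<open>Inside a closed ball of radius \<open>r\<close> the balls \<open>ob a r\<close> are the
  residue classes, so only finitely many residue classes are met.\<close>

definition few_open :: "'g \<Rightarrow> 'k set \<Rightarrow> bool" where
  "few_open r S \<longleftrightarrow> (\<exists>F. finite F \<and> S \<subseteq> (\<Union>a\<in>F. ob a r))"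

lemma few_subset: "few r T \<Longrightarrow> S \<subseteq> T \<Longrightarrow> few r S"
  unfolding few_def by (meson order_trans)

lemma few_open_subset: "few_open r T \<Longrightarrow> S \<subseteq> T \<Longrightarrow> few_open r S"
  unfolding few_open_def by (meson order_trans)

lemma few_finite_image:
  assumes "few r S" "\<And>x y. x \<in> S \<Longrightarrow> y \<in> S \<Longrightarrow> y \<in> cb x r \<Longrightarrow> u y = u x"
  shows "finite (u ` S)"
proof -
  obtain F where F: "finite F" "S \<subseteq> (\<Union>a\<in>F. cb a r)" using assms(1) by (auto simp: few_def)
  have "\<exists>w. \<forall>x\<in>S. x \<in> cb a r \<longrightarrow> u x = w" for a
  proof (cases "\<exists>x\<in>S. x \<in> cb a r")
    case True
    then obtain x where "x \<in> S" "x \<in> cb a r" by blast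
    then have "u y = u x" if "y \<in> S" "y \<in> cb a r" for y
      using assms(2)[of x y] that cb_eq by blast
    then show ?thesis by blast
  qed blast
  then obtain w where "\<And>a x. x \<in> S \<Longrightarrow> x \<in> cb a r \<Longrightarrow> u x = w a" by metis
  then have "u ` S \<subseteq> w ` F" using F(2) by blast
  then show ?thesis using F(1) finite_subset by blast
qed

lemma few_open_finite_image:
  assumes "few_open r S" "\<And>x y. x \<in> S \<Longrightarrow> y \<in> S \<Longrightarrow> y \<in> ob x r \<Longrightarrow> u y = u x"
  shows "finite (u ` S)"
proof -
  obtain F where F: "finite F" "S \<subseteq> (\<Union>a\<in>F. ob a r)" using assms(1) by (auto simp: few_open_def)
  have "\<exists>w. \<forall>x\<in>S. x \<in> ob a r \<longrightarrow> u x = w" for a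
  proof (cases "\<exists>x\<in>S. x \<in> ob a r")
    case True
    then obtain x where "x \<in> S" "x \<in> ob a r" by blast
    then have "u y = u x" if "y \<in> S" "y \<in> ob a r" for y
      using assms(2)[of x y] that ob_eq by blast
    then show ?thesis by blast
  qed blast
  then obtain w where "\<And>a x. x \<in> S \<Longrightarrow> x \<in> ob a r \<Longrightarrow> u x = w a" by metis
  then have "u ` S \<subseteq> w ` F" using F(2) by blast
  then show ?thesis using F(1) finite_subset by blast
qed

text \<open>A point far enough from the chosen points \<open>pt B\<close> has, for each supporting
  ball, a closed ball around it that lies inside or outside; the finitely many radii have a maximum.
  In the second claim this maximum stays below \<open>r\<close>, so the ball is larger than one of
  radius \<open>r\<close>.\<close>

lemma dset_contains_ball:
  assumes "dset S"
  shows "\<exists>F. finite F \<and> (\<forall>x\<in>S - F. \<exists>s. cb x s \<subseteq> S)"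
    and "\<exists>F. finite F \<and> (\<forall>x\<in>S. cb x r \<inter> F = {} \<longrightarrow> (\<exists>s<r. cb x s \<subseteq> S))"
proof -
  obtain \<B> pt where \<B>: "finite \<B>" "\<And>B. B \<in> \<B> \<Longrightarrow> is_ball B" "\<And>B. B \<in> \<B> \<Longrightarrow> pt B \<in> B"
    "\<And>x y. (\<And>B. B \<in> \<B> \<Longrightarrow> x \<in> B \<longleftrightarrow> y \<in> B) \<Longrightarrow> x \<in> S \<longleftrightarrow> y \<in> S"
    using dset_support[OF assms] by metis
  have ball: "\<exists>s<r. \<forall>y\<in>cb x s. x \<in> B \<longleftrightarrow> y \<in> B"
    if asm: "B \<in> \<B>" "x \<noteq> pt B" "val (x - pt B) < r" for x B r
  proof (cases "x \<in> B")
    case True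
    then have "\<forall>y\<in>cb x (val (x - pt B)). y \<in> B" using is_ball_convex \<B>(2,3) that by blast
    then show ?thesis using that True by blast
  next
    case False
    obtain s where s: "val (x - pt B) < s" "s < r" using dense asm(3) by blast
    have "cb x s \<inter> B = {}"
      by (rule is_ball_separate[OF \<B>(2)[OF asm(1)] False \<B>(3)[OF asm(1)] s(1)])
    then show ?thesis using False s(2) by blast
  qed
  have combine: "\<exists>s<r. cb x s \<subseteq> S"
    if "x \<in> S" and *: "\<And>B. B \<in> \<B> \<Longrightarrow> x \<noteq> pt B \<and> val (x - pt B) < r" for x r
  proof -
    have "\<exists>s. \<forall>B\<in>\<B>. s B < r \<and> (\<forall>y\<in>cb x (s B). x \<in> B \<longleftrightarrow> y \<in> B)"
      by (intro bchoice ballI ball) (use * in auto)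
    then obtain s where s: "\<And>B. B \<in> \<B> \<Longrightarrow> s B < r"
      "\<And>B y. B \<in> \<B> \<Longrightarrow> y \<in> cb x (s B) \<Longrightarrow> x \<in> B \<longleftrightarrow> y \<in> B" by blast
    obtain t where t: "t < r" using lt_ex by blast
    define m where "m = Max (insert t (s ` \<B>))"
    have "m < r" using \<B>(1) s(1) t by (auto simp: m_def)
    moreover have "cb x m \<subseteq> S"
    proof
      fix y assume y: "y \<in> cb x m"
      have "x \<in> B \<longleftrightarrow> y \<in> B" if B: "B \<in> \<B>" for B
      proof (rule s(2)[OF B])
        have "s B \<le> m" using \<B>(1) B by (auto simp: m_def)
        then show "y \<in> cb x (s B)" using y cb_mono by blast
      qed
      then show "y \<in> S" using \<B>(4)[of x y] that(1) by blast
    qed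
    ultimately show ?thesis by blast
  qed
  show "\<exists>F. finite F \<and> (\<forall>x\<in>S - F. \<exists>s. cb x s \<subseteq> S)"
  proof (intro exI[of _ "pt ` \<B>"] conjI ballI)
    fix x assume x: "x \<in> S - pt ` \<B>"
    obtain r where "\<forall>c\<in>(\<lambda>B. val (x - pt B)) ` \<B>. c < r" using above_finite \<B>(1) by blast
    then show "\<exists>s. cb x s \<subseteq> S" using combine[of x r] x by blast
  qed (use \<B>(1) in simp)
  show "\<exists>F. finite F \<and> (\<forall>x\<in>S. cb x r \<inter> F = {} \<longrightarrow> (\<exists>s<r. cb x s \<subseteq> S))"
  proof (intro exI[of _ "pt ` \<B>"] conjI ballI impI)
    fix x assume x: "x \<in> S" "cb x r \<inter> pt ` \<B> = {}"
    have "x \<noteq> pt B \<and> val (x - pt B) < r" if "B \<in> \<B>" for B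
    proof -
      have "pt B \<notin> cb x r" using x(2) that by blast
      then show ?thesis using val_diff_commute[of x "pt B"] by (auto simp: cb_def)
    qed
    then show "\<exists>s<r. cb x s \<subseteq> S" using combine x(1) by blast
  qed (use \<B>(1) in simp)
qed

lemma dset_infinite_ball: "dset S \<Longrightarrow> infinite S \<Longrightarrow> \<exists>x\<in>S. \<exists>s. cb x s \<subseteq> S"
proof -
  assume "dset S" "infinite S"
  then obtain F where F: "finite F" "\<And>x. x \<in> S - F \<Longrightarrow> \<exists>s. cb x s \<subseteq> S"
    using dset_contains_ball(1) by metis
  then have "S - F \<noteq> {}" using \<open>infinite S\<close> by (auto dest: finite_subset)
  then show ?thesis using F(2) by blast
qed

lemma dset_not_few_ball:
  assumes "dset S" "\<not> few r S"
  shows "\<exists>x\<in>S. \<exists>s<r. cb x s \<subseteq> S"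
proof -
  obtain F where F: "finite F" "\<And>x. x \<in> S \<Longrightarrow> cb x r \<inter> F = {} \<Longrightarrow> \<exists>s<r. cb x s \<subseteq> S"
    using dset_contains_ball(2)[OF assms(1)] by metis
  have "\<not> S \<subseteq> (\<Union>a\<in>F. cb a r)" using assms(2) F(1) by (auto simp: few_def)
  then obtain x where "x \<in> S" "\<And>a. a \<in> F \<Longrightarrow> x \<notin> cb a r" by blast
  then show ?thesis using F(2)[of x] cb_sym by blast
qed

text \<open>A supporting ball that contains a point of \<open>cb c r\<close> outside the open balls
  around the \<open>pt B\<close> contains all of \<open>cb c r\<close>, so such points agree on
  \<open>S\<close>. This plays the role of strong minimality of the residue field.\<close>

lemma dset_residue:
  assumes "dset S"
  shows "few_open r (S \<inter> cb c r) \<or> few_open r (cb c r - S)"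
proof -
  obtain \<B> pt where \<B>: "finite \<B>" "\<And>B. B \<in> \<B> \<Longrightarrow> is_ball B" "\<And>B. B \<in> \<B> \<Longrightarrow> pt B \<in> B"
    "\<And>x y. (\<And>B. B \<in> \<B> \<Longrightarrow> x \<in> B \<longleftrightarrow> y \<in> B) \<Longrightarrow> x \<in> S \<longleftrightarrow> y \<in> S"
    using dset_support[OF assms] by metis
  define E where "E = (\<Union>a\<in>pt ` \<B>. ob a r)"
  have "x \<in> B \<longleftrightarrow> cb c r \<subseteq> B" if B: "B \<in> \<B>" and x: "x \<in> cb c r" "x \<notin> E" for x B
  proof
    assume xB: "x \<in> B"
    have "x \<noteq> pt B" "val (x - pt B) \<le> r" using x(2) B by (auto simp: E_def ob_def not_less)
    then have "cb x r \<subseteq> B"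
      using is_ball_convex[OF \<B>(2)[OF B] xB \<B>(3)[OF B]] cb_mono by blast
    then show "cb c r \<subseteq> B" using cb_eq[OF x(1)] by simp
  qed (use x in blast)
  then have same: "x \<in> S \<longleftrightarrow> y \<in> S" if "x \<in> cb c r - E" "y \<in> cb c r - E" for x y
    using \<B>(4)[of x y] that by blast
  have "finite (pt ` \<B>)" using \<B>(1) by simp
  moreover have "S \<inter> cb c r \<subseteq> E \<or> cb c r - S \<subseteq> E" using same by blast
  ultimately show ?thesis unfolding few_open_def E_def by blast
qed

section \<open>Definable sets of values\<close>

text \<open>Centre 0 in \<open>dset_center\<close>; this is o-minimality of the value group, with
  the critical values as possible endpoints.\<close>

lemma gset_critical:
  assumes "gset S"
  obtains C where "finite C"
    "\<And>a b. a \<le> b \<Longrightarrow> (\<And>c. c \<in> C \<Longrightarrow> \<not> (a \<le> c \<and> c \<le> b)) \<Longrightarrow> a \<in> S \<longleftrightarrow> b \<in> S"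
proof -
  have "dset {x. val x \<in> S}" using assms by (simp add: dset_def gset_def)
  from dset_center[OF this, of 0] obtain C where C: "finite C"
    "\<And>x y. x \<noteq> 0 \<Longrightarrow> y \<noteq> 0 \<Longrightarrow> val x \<le> val y \<Longrightarrow>
      (\<And>c. c \<in> C \<Longrightarrow> \<not> (val x \<le> c \<and> c \<le> val y)) \<Longrightarrow> (val x \<in> S \<longleftrightarrow> val y \<in> S)"
    by auto
  have "a \<in> S \<longleftrightarrow> b \<in> S" if "a \<le> b" "\<And>c. c \<in> C \<Longrightarrow> \<not> (a \<le> c \<and> c \<le> b)" for a b
  proof -
    obtain x y where "x \<noteq> 0" "val x = a" "y \<noteq> 0" "val y = b" using ex_val by metis
    then show ?thesis using C(2)[of x y] that by blast
  qed
  with C(1) that show ?thesis by blast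
qed

lemma gset_right:
  assumes "gset S"
  shows "\<exists>\<epsilon>>\<delta>. (\<forall>\<gamma>. \<delta> < \<gamma> \<and> \<gamma> < \<epsilon> \<longrightarrow> \<gamma> \<in> S) \<or> (\<forall>\<gamma>. \<delta> < \<gamma> \<and> \<gamma> < \<epsilon> \<longrightarrow> \<gamma> \<notin> S)"
proof -
  obtain C where C: "finite C"
    "\<And>a b. a \<le> b \<Longrightarrow> (\<And>c. c \<in> C \<Longrightarrow> \<not> (a \<le> c \<and> c \<le> b)) \<Longrightarrow> a \<in> S \<longleftrightarrow> b \<in> S"
    using gset_critical[OF assms] by metis
  obtain d where d: "\<delta> < d" using gt_ex by blast
  define \<epsilon> where "\<epsilon> = Min (insert d {c\<in>C. \<delta> < c})"
  have \<epsilon>: "\<delta> < \<epsilon>" using C(1) d by (auto simp: \<epsilon>_def)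
  have no: "\<not> c < \<epsilon>" if "c \<in> C" "\<delta> < c" for c using that C(1) by (auto simp: \<epsilon>_def)
  have "a \<in> S \<longleftrightarrow> b \<in> S" if "\<delta> < a" "a \<le> b" "b < \<epsilon>" for a b
    by (rule C(2)[OF that(2)]) (use that no in force)
  then have same: "a \<in> S \<longleftrightarrow> b \<in> S" if "\<delta> < a" "\<delta> < b" "a < \<epsilon>" "b < \<epsilon>" for a b
    using that by (cases a b rule: le_cases) blast+
  show ?thesis
    by (rule exI[of _ \<epsilon>]) (use \<epsilon> same in blast)
qed

lemma gset_at_top:
  assumes "gset S"
  shows "\<exists>T. (\<forall>\<gamma>>T. \<gamma> \<in> S) \<or> (\<forall>\<gamma>>T. \<gamma> \<notin> S)"
proof -
  obtain C where C: "finite C"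
    "\<And>a b. a \<le> b \<Longrightarrow> (\<And>c. c \<in> C \<Longrightarrow> \<not> (a \<le> c \<and> c \<le> b)) \<Longrightarrow> a \<in> S \<longleftrightarrow> b \<in> S"
    using gset_critical[OF assms] by metis
  obtain T where T: "\<And>c. c \<in> C \<Longrightarrow> c < T" using above_finite[OF C(1)] by blast
  have "a \<in> S \<longleftrightarrow> b \<in> S" if "T < a" "a \<le> b" for a b
    by (rule C(2)[OF that(2)]) (use that T in force)
  then have "a \<in> S \<longleftrightarrow> b \<in> S" if "T < a" "T < b" for a b
    using that by (cases a b rule: le_cases) blast+
  then show ?thesis by blast
qed

lemma infinite_open_interval: "a < b \<Longrightarrow> infinite {\<gamma>::'g. a < \<gamma> \<and> \<gamma> < b}"
proof
  assume ab: "a < b" and fin: "finite {\<gamma>. a < \<gamma> \<and> \<gamma> < b}"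
  have ne: "{\<gamma>. a < \<gamma> \<and> \<gamma> < b} \<noteq> {}" using dense ab by auto
  let ?m = "Max {\<gamma>. a < \<gamma> \<and> \<gamma> < b}"
  have "a < ?m" "?m < b" using Max_in[OF fin ne] by auto
  moreover obtain m' where "?m < m'" "m' < b" using dense \<open>?m < b\<close> by blast
  ultimately have "m' \<le> ?m" using Max_ge[OF fin, of m'] by auto
  then show False using \<open>?m < m'\<close> by simp
qed

lemma gset_infinite_interval:
  assumes "gset S" "infinite S"
  shows "\<exists>p q. p < q \<and> (\<forall>\<gamma>. p < \<gamma> \<and> \<gamma> < q \<longrightarrow> \<gamma> \<in> S)"
proof -
  obtain C where C: "finite C"
    "\<And>a b. a \<le> b \<Longrightarrow> (\<And>c. c \<in> C \<Longrightarrow> \<not> (a \<le> c \<and> c \<le> b)) \<Longrightarrow> a \<in> S \<longleftrightarrow> b \<in> S"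
    using gset_critical[OF assms(1)] by metis
  have "\<not> S \<subseteq> C" using C(1) assms(2) finite_subset by blast
  then obtain q where q: "q \<in> S" "q \<notin> C" by blast
  obtain d where d: "d < q" using lt_ex by blast
  define p where "p = Max (insert d {c\<in>C. c < q})"
  have "p < q" using C(1) d by (auto simp: p_def)
  moreover have "\<gamma> \<in> S" if "p < \<gamma>" "\<gamma> < q" for \<gamma>
  proof -
    have "\<not> (\<gamma> \<le> c \<and> c \<le> q)" if c: "c \<in> C" for c
    proof
      assume a: "\<gamma> \<le> c \<and> c \<le> q"
      then have "c < q" using q c by (metis order.not_eq_order_implies_strict)
      then have "c \<le> p" using c C(1) by (auto simp: p_def)
      then show False using a \<open>p < \<gamma>\<close> by (meson leD le_less_trans less_le_trans)
    qed
    then show ?thesis using C(2)[of \<gamma> q] that q by auto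
  qed
  ultimately show ?thesis by blast
qed

text \<open>Definable completeness: once \<open>S\<close> is closed downwards, membership can only
  change at the ends of the gap between the last critical value inside and the first one
  outside.\<close>

lemma gset_lub:
  assumes "gset S" and ne: "s0 \<in> S" and bd: "\<And>s. s \<in> S \<Longrightarrow> s \<le> b0"
  shows "is_lub S (lub S)"
proof -
  define S' where "S' = {a. \<exists>s. s \<in> S \<and> a \<le> s}"
  have "gset S'" unfolding S'_def
    by (intro gset_Collect dfnU_intros dfn_memG[OF assms(1)])
  then obtain C where C: "finite C"
    "\<And>a b. a \<le> b \<Longrightarrow> (\<And>c. c \<in> C \<Longrightarrow> \<not> (a \<le> c \<and> c \<le> b)) \<Longrightarrow> a \<in> S' \<longleftrightarrow> b \<in> S'"
    using gset_critical by metis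
  obtain b where "b0 < b" using gt_ex by blast
  then have b: "b \<notin> S'" using bd by (force simp: S'_def)
  have a: "s0 \<in> S'" using ne by (auto simp: S'_def)
  have down: "y \<in> S'" if "x \<in> S'" "y \<le> x" for x y
    using that by (auto simp: S'_def intro: order_trans)
  define p where "p = Max (insert s0 (C \<inter> S'))"
  define q where "q = Min (insert b (C - S'))"
  have fin: "finite (insert s0 (C \<inter> S'))" "finite (insert b (C - S'))" using C(1) by auto
  have "p \<in> insert s0 (C \<inter> S')" unfolding p_def by (rule Max_in[OF fin(1)]) simp
  then have p: "p \<in> S'" using a by auto
  have "q \<in> insert b (C - S')" unfolding q_def by (rule Min_in[OF fin(2)]) simp
  then have q: "q \<notin> S'" using b by auto
  have pq: "p < q" using down[OF p] q by (meson not_less)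
  have no: "c \<le> p \<or> q \<le> c" if "c \<in> C" for c
    using that fin unfolding p_def q_def by (cases "c \<in> S'") auto
  have same: "x \<in> S' \<longleftrightarrow> y \<in> S'" if "p < x" "x \<le> y" "y < q" for x y
    by (rule C(2)[OF that(2)]) (use that no in force)
  have upper: "(\<forall>\<alpha>. \<alpha> \<in> S \<longrightarrow> \<alpha> \<le> \<beta>) \<longleftrightarrow> (\<forall>\<alpha>. \<alpha> \<in> S' \<longrightarrow> \<alpha> \<le> \<beta>)" for \<beta>
    by (auto simp: S'_def intro: order_trans)
  \<comment> \<open>Membership is constant in the gap, so any point of it decides which end is the
    supremum.\<close>
  obtain m where m: "p < m" "m < q" using dense pq by blast
  have "\<exists>\<delta>. is_lub S \<delta>"
  proof (cases "m \<in> S'")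
    case True
    have "x \<in> S'" if "x < q" for x
      using same[of m x] down[OF True, of x] True m that by (cases "x \<le> m") auto
    moreover have "x \<le> q" if "x \<in> S'" for x using down[OF that] q by (meson linear)
    ultimately have "is_lub S q" unfolding is_lub_def upper
      by (metis dense not_less order_trans)
    then show ?thesis by blast
  next
    case False
    have "x \<le> p" if x: "x \<in> S'" for x
    proof (rule ccontr)
      assume "\<not> x \<le> p"
      then have "p < min x m" by (simp add: m)
      then show False using same[of "min x m" m] down[OF x, of "min x m"] False m by auto
    qed
    then have "is_lub S p" unfolding is_lub_def upper using p by (meson order_trans)
    then show ?thesis by blast
  qed
  then show ?thesis using lub_eqI by metis
qed

lemma gset_glb:
  assumes "gset S" and ne: "s0 \<in> S" and bd: "\<And>s. s \<in> S \<Longrightarrow> b0 \<le> s"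
  shows "\<exists>d. \<forall>\<beta>. (\<forall>\<alpha>. \<alpha> \<in> S \<longrightarrow> \<beta> \<le> \<alpha>) \<longleftrightarrow> \<beta> \<le> d"
proof -
  have "gset {\<gamma>. - \<gamma> \<in> S}"
    by (intro gset_Collect dfnU_intros dfn_memG[OF assms(1)])
  then have "is_lub {\<gamma>. - \<gamma> \<in> S} (lub {\<gamma>. - \<gamma> \<in> S})"
  proof (rule gset_lub)
    show "- s0 \<in> {\<gamma>. - \<gamma> \<in> S}" using ne by simp
    show "\<gamma> \<le> - b0" if "\<gamma> \<in> {\<gamma>. - \<gamma> \<in> S}" for \<gamma>
      using bd[of "- \<gamma>"] that by (simp add: le_minus_iff)
  qed
  then obtain \<delta> where "\<And>\<beta>. (\<forall>\<alpha>. - \<alpha> \<in> S \<longrightarrow> \<alpha> \<le> \<beta>) \<longleftrightarrow> \<delta> \<le> \<beta>" unfolding is_lub_def by blast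
  then have "(\<forall>\<alpha>. \<alpha> \<in> S \<longrightarrow> \<beta> \<le> \<alpha>) \<longleftrightarrow> \<beta> \<le> - \<delta>" for \<beta>
    by (metis le_minus_iff minus_minus neg_le_iff_le)
  then show ?thesis by blast
qed

text \<open>Infinitely many values would give two disjoint definable sets, each with infinitely many
  residue classes, contradicting \<open>dset_residue\<close>.\<close>

lemma residue_finite_image:
  assumes U: "dset U" "U \<subseteq> cb c r" and u: "dfnG UNIV (\<lambda>e. u (e 0))"
    and const: "\<And>x y. x \<in> U \<Longrightarrow> y \<in> U \<Longrightarrow> y \<in> ob x r \<Longrightarrow> u y = u x"
  shows "finite (u ` U)"
proof (rule ccontr)
  assume inf: "infinite (u ` U)"
  have "gset {\<gamma>. \<exists>x. x \<in> U \<and> \<gamma> = u x}" by (intro gset_Collect dfnU_intros dfn_mem[OF U(1)] dfnG_app1[OF u])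
  moreover have "{\<gamma>. \<exists>x. x \<in> U \<and> \<gamma> = u x} = u ` U" by auto
  ultimately obtain p q where pq: "p < q" "\<And>\<gamma>. p < \<gamma> \<Longrightarrow> \<gamma> < q \<Longrightarrow> \<gamma> \<in> u ` U"
    using gset_infinite_interval[OF _ inf] by auto
  \<comment> \<open>Splitting the interval of values at \<open>m\<close> gives two disjoint sets,
    each of which meets infinitely many residue classes.\<close>
  obtain m where m: "p < m" "m < q" using dense pq(1) by blast
  have not_few: "\<not> few_open r {x. x \<in> U \<and> a < u x \<and> u x < b}" if ab: "p \<le> a" "a < b" "b \<le> q" for a b
  proof
    assume f: "few_open r {x. x \<in> U \<and> a < u x \<and> u x < b}"
    have "finite (u ` {x. x \<in> U \<and> a < u x \<and> u x < b})"
      by (rule few_open_finite_image[OF f]) (use const in blast)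
    moreover have "u ` {x. x \<in> U \<and> a < u x \<and> u x < b} = {\<gamma>. a < \<gamma> \<and> \<gamma> < b}"
    proof
      show "{\<gamma>. a < \<gamma> \<and> \<gamma> < b} \<subseteq> u ` {x. x \<in> U \<and> a < u x \<and> u x < b}"
      proof
        fix \<gamma> assume \<gamma>: "\<gamma> \<in> {\<gamma>. a < \<gamma> \<and> \<gamma> < b}"
        then have "\<gamma> \<in> u ` U" using pq(2)[of \<gamma>] ab by auto
        then show "\<gamma> \<in> u ` {x. x \<in> U \<and> a < u x \<and> u x < b}" using \<gamma> by blast
      qed
    qed auto
    moreover note infinite_open_interval[OF ab(2)]
    ultimately show False by simp
  qed
  have S: "dset {x. x \<in> U \<and> p < u x \<and> u x < m}"
    by (intro dset_Collect dfnU_intros dfn_mem[OF U(1)] dfnG_app1[OF u])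
  show False
    using dset_residue[OF S, of r c]
  proof
    assume "few_open r ({x. x \<in> U \<and> p < u x \<and> u x < m} \<inter> cb c r)"
    then have "few_open r {x. x \<in> U \<and> p < u x \<and> u x < m}"
      by (rule few_open_subset) (use U(2) in blast)
    then show False using not_few[of p m] m by simp
  next
    assume "few_open r (cb c r - {x. x \<in> U \<and> p < u x \<and> u x < m})"
    then have "few_open r {x. x \<in> U \<and> m < u x \<and> u x < q}"
      by (rule few_open_subset) (use U(2) in auto)
    then show False using not_few[of m q] m by simp
  qed
qed

section \<open>Annuli around a point and increasing families of sets\<close>

lemma below_finite: "finite C \<Longrightarrow> (\<And>c. c \<in> C \<Longrightarrow> c < r) \<Longrightarrow> \<exists>q<r. \<forall>c\<in>C. c < (q::'g)"
proof -
  assume C: "finite C" "\<And>c. c \<in> C \<Longrightarrow> c < r"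
  obtain t where "t < r" using lt_ex by blast
  then have "Max (insert t C) < r" using C by auto
  then obtain q where "Max (insert t C) < q" "q < r" using dense by blast
  with C(1) show ?thesis by auto
qed

lemma dset_annulus:
  assumes "dset S"
  shows "\<exists>\<gamma><r. \<forall>y z. y \<noteq> x \<and> \<gamma> < val (y - x) \<and> val (y - x) < r \<and>
    z \<noteq> x \<and> \<gamma> < val (z - x) \<and> val (z - x) < r \<longrightarrow> (y \<in> S \<longleftrightarrow> z \<in> S)"
proof -
  obtain C where C: "finite C" "\<And>y z. y \<noteq> x \<Longrightarrow> z \<noteq> x \<Longrightarrow> val (y - x) \<le> val (z - x) \<Longrightarrow>
    (\<And>c. c \<in> C \<Longrightarrow> \<not> (val (y - x) \<le> c \<and> c \<le> val (z - x))) \<Longrightarrow> (y \<in> S \<longleftrightarrow> z \<in> S)"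
    using dset_center[OF assms, of x] by auto
  have "finite {c\<in>C. c < r}" "\<And>c. c \<in> {c\<in>C. c < r} \<Longrightarrow> c < r" using C(1) by simp_all
  from below_finite[OF this] obtain \<gamma> where \<gamma>': "\<gamma> < r" "\<forall>c\<in>{c\<in>C. c < r}. c < \<gamma>" by blast
  then have \<gamma>: "\<gamma> < r" "\<And>c. c \<in> C \<Longrightarrow> c < r \<Longrightarrow> c < \<gamma>" by blast+
  have *: "y \<in> S \<longleftrightarrow> z \<in> S"
    if "y \<noteq> x" "z \<noteq> x" "\<gamma> < val (y - x)" "val (y - x) \<le> val (z - x)" "val (z - x) < r" for y z
  proof (rule C(2)[OF that(1,2,4)])
    fix c assume c: "c \<in> C"
    show "\<not> (val (y - x) \<le> c \<and> c \<le> val (z - x))"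
    proof
      assume *: "val (y - x) \<le> c \<and> c \<le> val (z - x)"
      then have "c < \<gamma>" using \<gamma>(2)[OF c] that(5) by (meson le_less_trans)
      then show False using * that(3) by (meson less_trans not_less)
    qed
  qed
  have "y \<in> S \<longleftrightarrow> z \<in> S" if "y \<noteq> x" "\<gamma> < val (y - x)" "val (y - x) < r"
    "z \<noteq> x" "\<gamma> < val (z - x)" "val (z - x) < r" for y z
    using that *[of y z] *[of z y] by (cases "val (y - x)" "val (z - x)" rule: le_cases) blast+
  with \<gamma>(1) show ?thesis by blast
qed

lemma val_between_balls:
  assumes "a \<noteq> b" "val (b - a) < r" "x \<in> cb a r" "y \<in> cb b r"
  shows "y \<noteq> x" "val (y - x) = val (b - a)"
proof -
  have yb: "b = y \<or> r \<le> val (b - y)" using assms(4) by (auto simp: cb_def val_diff_commute[of b y])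
  have xa: "a = x \<or> r \<le> val (a - x)" using assms(3) by (auto simp: cb_def val_diff_commute[of a x])
  have "b = y \<or> val (a - b) < val (b - y)"
    using yb assms(2) less_le_trans unfolding val_diff_commute[of a b] by blast
  then have ay: "a \<noteq> y" "val (y - a) = val (b - a)"
    using val_diff_eq[of a b y] assms(1) val_diff_commute[of a b] val_diff_commute[of y a] by simp_all
  then have "a = x \<or> val (y - a) < val (a - x)"
    using xa assms(2) less_le_trans by metis
  then show "y \<noteq> x" "val (y - x) = val (b - a)"
    using val_diff_eq[of y a x] ay by auto
qed

text \<open>The distance from \<open>x\<close>, made constant on \<open>cb x r\<close>, is constant
  on closed balls of radius \<open>r\<close> but takes infinitely many values on
  \<open>cb x s\<close>.\<close>

lemma not_few_cb: "s < r \<Longrightarrow> \<not> few r (cb x s)"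
proof
  assume sr: "s < r" and f: "few r (cb x s)"
  define u where "u y = (if y \<in> cb x r then 0 else val (y - x))" for y
  have "finite (u ` cb x s)"
  proof (rule few_finite_image[OF f])
    fix y y' assume y': "y' \<in> cb y r"
    show "u y' = u y"
    proof (cases "y \<in> cb x r")
      case True
      then show ?thesis using y' cb_trans by (auto simp: u_def)
    next
      case False
      then have "x \<noteq> y" "val (y - x) < r" by (auto simp: cb_def)
      then show ?thesis using val_between_balls[of x y r x y'] y' False cb_eq[OF y'] cb_sym
        by (auto simp: u_def)
    qed
  qed
  moreover have "{\<gamma>. s < \<gamma> \<and> \<gamma> < r} \<subseteq> u ` cb x s"
  proof
    fix \<gamma> assume "\<gamma> \<in> {\<gamma>. s < \<gamma> \<and> \<gamma> < r}"
    then have \<gamma>: "s < \<gamma>" "\<gamma> < r" by auto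
    obtain p where "p \<noteq> 0" "val p = \<gamma>" using ex_val by blast
    then have "x + p \<in> cb x s" "u (x + p) = \<gamma>" using \<gamma> by (auto simp: cb_def u_def)
    then show "\<gamma> \<in> u ` cb x s" by blast
  qed
  ultimately show False using infinite_open_interval[OF sr] finite_subset by blast
qed

text \<open>Each closed ball of radius \<open>r\<close> that is met at all is met from some
  threshold on. Infinitely many thresholds would fill an interval, and a single set of the family
  would meet infinitely many of these balls. So some \<open>q\<close> below \<open>r\<close> lies
  above all thresholds, and \<open>A q\<close> meets every ball in question.\<close>

lemma few_increasing:
  assumes A: "dfn UNIV (\<lambda>e. e 0 \<in> A (val (e 1)))"
    and mono: "\<And>\<alpha> \<beta>. \<alpha> \<le> \<beta> \<Longrightarrow> \<beta> < r \<Longrightarrow> A \<alpha> \<subseteq> A \<beta>"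
    and few: "\<And>\<gamma>. \<gamma> < r \<Longrightarrow> few r (A \<gamma>)"
  shows "few r (\<Union>\<gamma>\<in>{..<r}. A \<gamma>)"
proof -
  have dA: "dfn UNIV (\<lambda>e. s e \<in> A (t e))" if "dfnK UNIV s" "dfnG UNIV t" for s t
  proof -
    have "dfn UNIV (\<lambda>e. e i \<in> A (val (e j)))" for i j
      using dfn_rename[OF A, of "case_nat i (\<lambda>_. j)"] by simp
    then have "dfn UNIV (\<lambda>e. s (\<lambda>i. e (Suc i)) \<in> A (val (e 0)))"
      by (rule dfn_substK[where t = "\<lambda>e. s (\<lambda>i. e (Suc i))"]) (rule dfnK_rename[OF that(1)])
    then show ?thesis by (rule dfn_substG) (rule that(2))
  qed
  define meets where "meets \<beta> x \<longleftrightarrow> (\<exists>y. y \<in> A \<beta> \<and> y \<in> cb x r)" for \<beta> x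
  have d_meets: "dfn UNIV (\<lambda>e. meets (t e) (s e))" if "dfnK UNIV s" "dfnG UNIV t" for s t
    unfolding meets_def
    by (intro dfnU_intros dA dfn_cb dfnK_rename[OF that(1)] dfnG_rename[OF that(2)])
  have meets_mono: "meets \<beta> x" if "meets \<alpha> x" "\<alpha> \<le> \<beta>" "\<beta> < r" for \<alpha> \<beta> x
    using that mono unfolding meets_def by blast
  \<comment> \<open>The thresholds; whether the ball is already met at the threshold itself is left
    open.\<close>
  define J where "J = {\<gamma>. \<gamma> < r \<and>
    (\<exists>x. (\<forall>\<beta>. \<gamma> < \<beta> \<and> \<beta> < r \<longrightarrow> meets \<beta> x) \<and> (\<forall>\<beta>. \<beta> < \<gamma> \<longrightarrow> \<not> meets \<beta> x))}"
  have "finite J"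
  proof (rule ccontr)
    assume inf: "infinite J"
    have "gset J" unfolding J_def by (intro gset_Collect dfnU_intros d_meets)
    from gset_infinite_interval[OF this inf] obtain p q
      where pq: "p < q" "\<And>\<gamma>. p < \<gamma> \<Longrightarrow> \<gamma> < q \<Longrightarrow> \<gamma> \<in> J" by blast
    obtain m where m: "p < m" "m < q" using dense pq(1) by blast
    have mr: "m < r" using pq(2)[OF m] by (simp add: J_def)
    have "\<exists>y. y \<in> A m \<and> (\<forall>\<beta>'. \<beta> < \<beta>' \<and> \<beta>' < r \<longrightarrow> meets \<beta>' y) \<and> (\<forall>\<beta>'<\<beta>. \<not> meets \<beta>' y)"
      if \<beta>: "p < \<beta>" "\<beta> < m" for \<beta>
    proof -
      have "\<beta> \<in> J" using pq(2) \<beta> m by (meson less_trans)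
      then obtain x where x: "\<And>\<beta>'. \<beta> < \<beta>' \<Longrightarrow> \<beta>' < r \<Longrightarrow> meets \<beta>' x" "\<And>\<beta>'. \<beta>' < \<beta> \<Longrightarrow> \<not> meets \<beta>' x"
        unfolding J_def by blast
      from x(1)[OF \<beta>(2) mr] obtain y where y: "y \<in> A m" "y \<in> cb x r" unfolding meets_def by blast
      have "meets \<beta>' y = meets \<beta>' x" for \<beta>' unfolding meets_def cb_eq[OF y(2)] ..
      with x y(1) show ?thesis by blast
    qed
    then obtain y where y: "\<And>\<beta>. p < \<beta> \<Longrightarrow> \<beta> < m \<Longrightarrow> y \<beta> \<in> A m \<and>
      (\<forall>\<beta>'. \<beta> < \<beta>' \<and> \<beta>' < r \<longrightarrow> meets \<beta>' (y \<beta>)) \<and> (\<forall>\<beta>'<\<beta>. \<not> meets \<beta>' (y \<beta>))" by metis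
    have "finite ((\<lambda>y. cb y r) ` A m)"
      by (rule few_finite_image[OF few[OF mr]]) (rule cb_eq)
    moreover have "(\<lambda>\<beta>. cb (y \<beta>) r) ` {\<beta>. p < \<beta> \<and> \<beta> < m} \<subseteq> (\<lambda>y. cb y r) ` A m"
      using y by blast
    ultimately have fin: "finite ((\<lambda>\<beta>. cb (y \<beta>) r) ` {\<beta>. p < \<beta> \<and> \<beta> < m})"
      using finite_subset by blast
    have neq: "cb (y \<alpha>) r \<noteq> cb (y \<beta>) r" if asm: "p < \<alpha>" "\<alpha> < \<beta>" "\<beta> < m" for \<alpha> \<beta>
    proof
      assume eq: "cb (y \<alpha>) r = cb (y \<beta>) r"
      obtain \<delta> where \<delta>: "\<alpha> < \<delta>" "\<delta> < \<beta>" using dense asm(2) by blast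
      have "\<delta> < r" "\<alpha> < m" "p < \<beta>" using \<delta> asm mr by (meson less_trans)+
      then have "meets \<delta> (y \<alpha>)" "\<not> meets \<delta> (y \<beta>)" using y \<delta> asm by blast+
      then show False unfolding meets_def eq by blast
    qed
    have "inj_on (\<lambda>\<beta>. cb (y \<beta>) r) {\<beta>. p < \<beta> \<and> \<beta> < m}"
    proof (rule linorder_inj_onI)
      fix \<alpha> \<beta> assume "\<alpha> < \<beta>" "\<alpha> \<in> {\<beta>. p < \<beta> \<and> \<beta> < m}" "\<beta> \<in> {\<beta>. p < \<beta> \<and> \<beta> < m}"
      then show "cb (y \<alpha>) r \<noteq> cb (y \<beta>) r" using neq by blast
    qed (use linear in blast)
    then show False using fin finite_imageD infinite_open_interval[OF m(1)] by blast
  qed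
  then obtain q where q: "q < r" "\<And>j. j \<in> J \<Longrightarrow> j < q"
    using below_finite[of J r] unfolding J_def by blast
  have "meets q x" if x: "x \<in> A \<gamma>" "\<gamma> < r" for x \<gamma>
  proof -
    define G where "G = {\<beta>. \<beta> < r \<and> meets \<beta> x}"
    have G: "gset G" unfolding G_def by (intro gset_Collect dfnU_intros d_meets)
    have \<gamma>: "\<gamma> \<in> G" using x by (auto simp: G_def meets_def)
    show ?thesis
    proof (cases "\<exists>\<beta>\<in>G. \<beta> \<le> q")
      case True
      then show ?thesis using meets_mono q(1) by (auto simp: G_def)
    next
      case False
      then have "\<And>\<beta>. \<beta> \<in> G \<Longrightarrow> q \<le> \<beta>" by (meson linear)
      \<comment> \<open>If the ball around \<open>x\<close> were met only beyond \<open>q\<close>,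
        the infimum of its meeting values would be a threshold not below \<open>q\<close>.\<close>
      from gset_glb[OF G \<gamma> this] obtain d where d: "\<And>\<beta>. (\<forall>\<alpha>. \<alpha> \<in> G \<longrightarrow> \<beta> \<le> \<alpha>) \<longleftrightarrow> \<beta> \<le> d" by blast
      have low: "d \<le> \<alpha>" if "\<alpha> \<in> G" for \<alpha> using d[of d] that by blast
      have "d < r" using low[OF \<gamma>] x(2) by simp
      have "meets \<beta> x" if \<beta>: "d < \<beta>" "\<beta> < r" for \<beta>
      proof -
        obtain \<alpha> where "\<alpha> \<in> G" "\<not> \<beta> \<le> \<alpha>" using d[of \<beta>] \<beta>(1) by (meson not_less)
        then show ?thesis using meets_mono[of \<alpha> x \<beta>] \<beta>(2) by (auto simp: G_def)
      qed
      moreover have "\<not> meets \<beta> x" if "\<beta> < d" for \<beta>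
      proof
        assume "meets \<beta> x"
        then have "\<beta> \<in> G" using that \<open>d < r\<close> by (simp add: G_def)
        then show False using low that by (meson not_less)
      qed
      ultimately have "d \<in> J" using \<open>d < r\<close> unfolding J_def by blast
      then have "d < q" by (rule q(2))
      then show ?thesis using False d[of q] by (meson linear not_less)
    qed
  qed
  moreover obtain F where F: "finite F" "A q \<subseteq> (\<Union>a\<in>F. cb a r)"
    using few[OF q(1)] by (auto simp: few_def)
  ultimately have "(\<Union>\<gamma>\<in>{..<r}. A \<gamma>) \<subseteq> (\<Union>a\<in>F. cb a r)"
  proof (intro subsetI)
    fix x assume "x \<in> (\<Union>\<gamma>\<in>{..<r}. A \<gamma>)"
    then have "meets q x" using \<open>\<And>x \<gamma>. x \<in> A \<gamma> \<Longrightarrow> \<gamma> < r \<Longrightarrow> meets q x\<close> by blast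
    then obtain y where y: "y \<in> A q" "y \<in> cb x r" by (auto simp: meets_def)
    then obtain a where a: "a \<in> F" "y \<in> cb a r" using F(2) by blast
    have "x \<in> cb y r" using y(2) by (simp add: cb_sym[of y x])
    then have "x \<in> cb a r" using a(2) by (rule cb_trans)
    then show "x \<in> (\<Union>a\<in>F. cb a r)" using a(1) by blast
  qed
  with F(1) show ?thesis unfolding few_def by blast
qed

section \<open>Families of functions on the value group\<close>

definition fam :: "'k set \<Rightarrow> ((nat \<Rightarrow> 'k) \<Rightarrow> 'k \<Rightarrow> 'g \<Rightarrow> 'g) \<Rightarrow> bool" where
  "fam A h \<longleftrightarrow> dfnG A (\<lambda>e. h (\<lambda>i. e (Suc (Suc i))) (e 0) (val (e 1)))"

lemma fam_app:
  assumes "fam A h" "dfnK A s" "dfnG A t"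
  shows "dfnG A (\<lambda>e. h (\<lambda>i. e (\<rho> i)) (s e) (t e))"
proof -
  have "dfn A (\<lambda>e. val (e i) = h (\<lambda>l. e (\<rho> l)) (e j) (val (e k)))" for i j k \<rho>
    using dfn_rename[OF assms(1)[unfolded fam_def dfnG_def],
        of "case_nat i (case_nat j (case_nat k \<rho>))"] by simp
  then have "dfn A (\<lambda>e. val (e (Suc 0)) = h (\<lambda>l. e (Suc (Suc (\<rho> l)))) (s (\<lambda>i. e (Suc (Suc i)))) (val (e 0)))"
    by (rule dfn_substK[where t = "\<lambda>e. s (\<lambda>i. e (Suc (Suc i)))" and
          P = "\<lambda>e x. val (e (Suc 0)) = h (\<lambda>l. e (Suc (Suc (\<rho> l)))) x (val (e 0))"])
      (rule dfnK_rename[OF assms(2)])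
  then show ?thesis unfolding dfnG_def
    by (rule dfn_substG[where t = "\<lambda>e. t (\<lambda>i. e (Suc i))" and
          P = "\<lambda>e x. val (e 0) = h (\<lambda>l. e (Suc (\<rho> l))) (s (\<lambda>i. e (Suc i))) x"])
      (rule dfnG_rename[OF assms(3)])
qed

text \<open>Restricting to positive values bounds the set of differences from below, which gives it
  an infimum; only large values matter in the end.\<close>

definition eqv :: "('k \<Rightarrow> 'g \<Rightarrow> 'g) \<Rightarrow> 'k \<Rightarrow> 'k \<Rightarrow> bool" where
  "eqv H x y \<longleftrightarrow> (\<forall>\<gamma>. 0 < \<gamma> \<longrightarrow> H x \<gamma> = H y \<gamma>)"

text \<open>Comparison of \<open>H x\<close> and \<open>H y\<close> where they first differ on the positive values.\<close>

definition lt :: "('k \<Rightarrow> 'g \<Rightarrow> 'g) \<Rightarrow> 'k \<Rightarrow> 'k \<Rightarrow> bool" where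
  "lt H x y \<longleftrightarrow> (\<exists>\<epsilon>. 0 < \<epsilon> \<and> (\<forall>\<gamma>. 0 < \<gamma> \<and> \<gamma> \<le> \<epsilon> \<longrightarrow> H x \<gamma> \<le> H y \<gamma>) \<and>
     (\<exists>\<gamma>. 0 < \<gamma> \<and> \<gamma> \<le> \<epsilon> \<and> H x \<gamma> < H y \<gamma>))"

definition mixed :: "('k \<Rightarrow> 'g \<Rightarrow> 'g) \<Rightarrow> 'k \<Rightarrow> 'g \<Rightarrow> bool" where
  "mixed H x r \<longleftrightarrow> (\<exists>y z. y \<in> cb x r \<and> z \<in> cb x r \<and> \<not> eqv H y z)"

lemma dfn_eqv:
  assumes "fam A h" "dfnK A s" "dfnK A t"
  shows "dfn A (\<lambda>e. eqv (h (\<lambda>i. e (\<rho> i))) (s e) (t e))"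
  unfolding eqv_def
  by (intro dfn_intros fam_app[OF assms(1)] dfnK_rename[OF assms(2)] dfnK_rename[OF assms(3)])

lemma dfn_lt:
  assumes "fam A h" "dfnK A s" "dfnK A t"
  shows "dfn A (\<lambda>e. lt (h (\<lambda>i. e (\<rho> i))) (s e) (t e))"
  unfolding lt_def
  by (intro dfn_intros fam_app[OF assms(1)] dfnK_rename[OF assms(2)] dfnK_rename[OF assms(3)])

lemma dfn_mixed:
  assumes "fam A h" "dfnK A s" "dfnG A t"
  shows "dfn A (\<lambda>e. mixed (h (\<lambda>i. e (\<rho> i))) (s e) (t e))"
  unfolding mixed_def
  by (intro dfn_intros dfn_cb dfn_eqv[OF assms(1)] dfnK_rename[OF assms(2)] dfnG_rename[OF assms(3)])

lemma lt_antisym: "lt H x y \<Longrightarrow> \<not> lt H y x"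
proof
  assume "lt H x y" "lt H y x"
  then obtain \<epsilon> \<epsilon>' \<gamma> \<gamma>' where
    1: "\<And>\<gamma>. 0 < \<gamma> \<Longrightarrow> \<gamma> \<le> \<epsilon> \<Longrightarrow> H x \<gamma> \<le> H y \<gamma>" "0 < \<gamma>" "\<gamma> \<le> \<epsilon>" "H x \<gamma> < H y \<gamma>" and
    2: "\<And>\<gamma>. 0 < \<gamma> \<Longrightarrow> \<gamma> \<le> \<epsilon>' \<Longrightarrow> H y \<gamma> \<le> H x \<gamma>" "0 < \<gamma>'" "\<gamma>' \<le> \<epsilon>'" "H y \<gamma>' < H x \<gamma>'"
    unfolding lt_def by blast
  show False
  proof (cases "\<epsilon> \<le> \<epsilon>'")
    case True
    then show False using 2(1)[of \<gamma>] 1(2-4) order_trans[of \<gamma> \<epsilon> \<epsilon>'] by simp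
  next
    case False
    then have "\<gamma>' \<le> \<epsilon>" using 2(3) by simp
    then show False using 1(1)[of \<gamma>'] 2(2,4) by simp
  qed
qed

text \<open>At the infimum \<open>d\<close> of the differences, either \<open>d\<close> itself is a
  difference and decides, or the outcome of the comparison is constant on an interval to the right
  of \<open>d\<close>.\<close>

lemma lt_total:
  assumes H: "fam UNIV (\<lambda>_. H)" and ne: "\<not> eqv H x y"
  shows "lt H x y \<or> lt H y x"
proof -
  note app = fam_app[OF H]
  define D where "D = {\<gamma>. 0 < \<gamma> \<and> H x \<gamma> \<noteq> H y \<gamma>}"
  have "gset D" unfolding D_def by (intro gset_Collect dfnU_intros app)
  moreover obtain \<gamma>0 where "\<gamma>0 \<in> D" using ne by (auto simp: D_def eqv_def)
  moreover have "\<And>\<gamma>. \<gamma> \<in> D \<Longrightarrow> 0 \<le> \<gamma>" by (auto simp: D_def)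
  ultimately obtain d where d: "\<And>\<beta>. (\<forall>\<alpha>. \<alpha> \<in> D \<longrightarrow> \<beta> \<le> \<alpha>) \<longleftrightarrow> \<beta> \<le> d"
    using gset_glb by blast
  have low: "d \<le> \<alpha>" if "\<alpha> \<in> D" for \<alpha> using d[of d] that by blast
  have d0: "0 \<le> d" using d[of 0] by (auto simp: D_def)
  have eq: "H x \<gamma> = H y \<gamma>" if "0 < \<gamma>" "\<gamma> < d" for \<gamma>
  proof (rule ccontr)
    assume "H x \<gamma> \<noteq> H y \<gamma>"
    then have "d \<le> \<gamma>" using low[of \<gamma>] that(1) by (simp add: D_def)
    then show False using that(2) by simp
  qed
  show ?thesis
  proof (cases "d \<in> D")
    case True
    then have dpos: "0 < d" and "H x d \<noteq> H y d" by (auto simp: D_def)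
    have split: "H x \<gamma> = H y \<gamma> \<or> \<gamma> = d" if "0 < \<gamma>" "\<gamma> \<le> d" for \<gamma>
      using eq[of \<gamma>] that by (auto simp: le_less)
    show ?thesis
    proof (cases "H x d < H y d")
      case less: True
      then have "\<forall>\<gamma>. 0 < \<gamma> \<and> \<gamma> \<le> d \<longrightarrow> H x \<gamma> \<le> H y \<gamma>" using split by (metis order.order_iff_strict)
      then have "lt H x y" unfolding lt_def using dpos less by blast
      then show ?thesis ..
    next
      case False
      then have less: "H y d < H x d" using \<open>H x d \<noteq> H y d\<close> by simp
      then have "\<forall>\<gamma>. 0 < \<gamma> \<and> \<gamma> \<le> d \<longrightarrow> H y \<gamma> \<le> H x \<gamma>" using split by (metis order.order_iff_strict)
      then have "lt H y x" unfolding lt_def using dpos less by blast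
      then show ?thesis ..
    qed
  next
    case False
    have "gset {\<gamma>. H x \<gamma> < H y \<gamma>}" "gset {\<gamma>. H y \<gamma> < H x \<gamma>}"
      by (intro gset_Collect dfnU_intros app)+
    from gset_right[OF this(1), of d] gset_right[OF this(2), of d]
    obtain \<epsilon>1 \<epsilon>2 where \<epsilon>: "d < \<epsilon>1" "d < \<epsilon>2" and
      1: "(\<forall>\<gamma>. d < \<gamma> \<and> \<gamma> < \<epsilon>1 \<longrightarrow> H x \<gamma> < H y \<gamma>) \<or> (\<forall>\<gamma>. d < \<gamma> \<and> \<gamma> < \<epsilon>1 \<longrightarrow> \<not> H x \<gamma> < H y \<gamma>)" and
      2: "(\<forall>\<gamma>. d < \<gamma> \<and> \<gamma> < \<epsilon>2 \<longrightarrow> H y \<gamma> < H x \<gamma>) \<or> (\<forall>\<gamma>. d < \<gamma> \<and> \<gamma> < \<epsilon>2 \<longrightarrow> \<not> H y \<gamma> < H x \<gamma>)"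
      by auto
    have "\<not> min \<epsilon>1 \<epsilon>2 \<le> d" using \<epsilon> by (simp add: not_le)
    then obtain \<gamma> where \<gamma>: "\<gamma> \<in> D" "\<gamma> < min \<epsilon>1 \<epsilon>2" using d by (meson not_less)
    have "d \<noteq> \<gamma>" using \<gamma>(1) False by blast
    then have \<gamma>': "d < \<gamma>" "\<gamma> < \<epsilon>1" "\<gamma> < \<epsilon>2" "0 < \<gamma>" "H x \<gamma> \<noteq> H y \<gamma>"
      using \<gamma> low[OF \<gamma>(1)] by (simp_all add: D_def)
    have split: "H x \<beta> = H y \<beta> \<or> (d < \<beta> \<and> \<beta> < \<epsilon>1 \<and> \<beta> < \<epsilon>2)" if "0 < \<beta>" "\<beta> \<le> \<gamma>" for \<beta>
    proof (cases "d < \<beta>")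
      case True
      then show ?thesis using that \<gamma>' by auto
    next
      case not_less: False
      then show ?thesis using that eq[of \<beta>] False by (cases "\<beta> = d") (auto simp: D_def)
    qed
    show ?thesis
    proof (cases "H x \<gamma> < H y \<gamma>")
      case True
      then have "\<forall>\<gamma>. d < \<gamma> \<and> \<gamma> < \<epsilon>1 \<longrightarrow> H x \<gamma> < H y \<gamma>" using 1 \<gamma>' by blast
      then have "\<forall>\<beta>. 0 < \<beta> \<and> \<beta> \<le> \<gamma> \<longrightarrow> H x \<beta> \<le> H y \<beta>" using split by (metis order.order_iff_strict)
      then have "lt H x y" unfolding lt_def using True \<gamma>'(4) by blast
      then show ?thesis ..
    next
      case False
      then have yx: "H y \<gamma> < H x \<gamma>" using \<gamma>'(5) by simp
      then have "\<forall>\<gamma>. d < \<gamma> \<and> \<gamma> < \<epsilon>2 \<longrightarrow> H y \<gamma> < H x \<gamma>" using 2 \<gamma>' by blast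
      then have "\<forall>\<beta>. 0 < \<beta> \<and> \<beta> \<le> \<gamma> \<longrightarrow> H y \<beta> \<le> H x \<beta>" using split by (metis order.order_iff_strict)
      then have "lt H y x" unfolding lt_def using yx \<gamma>'(4) by blast
      then show ?thesis ..
    qed
  qed
qed

text \<open>
  Any definable tournament on the classes of a definable equivalence relation has this property:
  three disjoint balls whose surroundings compare uniformly to a point in them are impossible.
\<close>

lemma few_mixed:
  assumes H: "fam UNIV (\<lambda>_. H)"
  shows "few r {x. mixed H x r}"
proof (rule ccontr)
  define ann where "ann x \<gamma> y \<longleftrightarrow> y \<noteq> x \<and> \<gamma> < val (y - x) \<and> val (y - x) < r" for x \<gamma> y
  \<comment> \<open>\<open>A\<close> increases with \<gamma>, as the annulus becomes thinner, and by
    \<open>dset_annulus\<close> it exhausts the mixed points; so \<open>few_increasing\<close>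
    leaves one \<open>A \<gamma>\<close> that is not few.\<close>
  define A where "A \<gamma> = {x. mixed H x r \<and> (\<exists>x'. x' \<in> cb x r \<and>
    ((\<forall>y. ann x' \<gamma> y \<longrightarrow> lt H y x') \<or> (\<forall>y. ann x' \<gamma> y \<longrightarrow> lt H x' y) \<or>
     (\<forall>y. ann x' \<gamma> y \<longrightarrow> eqv H y x')))}" for \<gamma>
  assume not_few: "\<not> few r {x. mixed H x r}"
  have "x \<in> (\<Union>\<gamma>\<in>{..<r}. A \<gamma>)" if x: "mixed H x r" for x
  proof -
    have "dset {y. lt H y x}" "dset {y. lt H x y}"
      by (intro dset_Collect dfn_lt[OF H] dfnU_intros)+
    note d = this
    obtain \<gamma>1 where \<gamma>1: "\<gamma>1 < r" "\<forall>y z. y \<noteq> x \<and> \<gamma>1 < val (y - x) \<and> val (y - x) < r \<and>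
        z \<noteq> x \<and> \<gamma>1 < val (z - x) \<and> val (z - x) < r \<longrightarrow> (y \<in> {y. lt H y x} \<longleftrightarrow> z \<in> {y. lt H y x})"
      using dset_annulus[OF d(1), of r x] by (elim exE conjE)
    obtain \<gamma>2 where \<gamma>2: "\<gamma>2 < r" "\<forall>y z. y \<noteq> x \<and> \<gamma>2 < val (y - x) \<and> val (y - x) < r \<and>
        z \<noteq> x \<and> \<gamma>2 < val (z - x) \<and> val (z - x) < r \<longrightarrow> (y \<in> {y. lt H x y} \<longleftrightarrow> z \<in> {y. lt H x y})"
      using dset_annulus[OF d(2), of r x] by (elim exE conjE)
    have 1: "lt H y x = lt H z x" if "ann x \<gamma>1 y" "ann x \<gamma>1 z" for y z
      using \<gamma>1(2)[rule_format, of y z] that unfolding ann_def mem_Collect_eq by blast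
    have 2: "lt H x y = lt H x z" if "ann x \<gamma>2 y" "ann x \<gamma>2 z" for y z
      using \<gamma>2(2)[rule_format, of y z] that unfolding ann_def mem_Collect_eq by blast
    define \<gamma> where "\<gamma> = max \<gamma>1 \<gamma>2"
    have ann: "ann x \<gamma>1 y" "ann x \<gamma>2 y" if "ann x \<gamma> y" for y
      using that by (auto simp: ann_def \<gamma>_def)
    have "(\<forall>y. ann x \<gamma> y \<longrightarrow> lt H y x) \<or> (\<forall>y. ann x \<gamma> y \<longrightarrow> lt H x y) \<or> (\<forall>y. ann x \<gamma> y \<longrightarrow> eqv H y x)"
    proof (cases "\<exists>y. ann x \<gamma> y")
      case True
      then obtain y where y: "ann x \<gamma> y" by blast
      have "lt H z x = lt H y x" "lt H x z = lt H x y" if "ann x \<gamma> z" for z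
        using 1[of z y] 2[of z y] ann[OF that] ann[OF y] by simp_all
      then show ?thesis using lt_total[OF H] by (cases "lt H y x"; cases "lt H x y") metis+
    qed blast
    then have "x \<in> A \<gamma>" unfolding A_def using x cb_refl by blast
    moreover have "\<gamma> < r" using \<gamma>1(1) \<gamma>2(1) by (simp add: \<gamma>_def)
    ultimately show ?thesis by blast
  qed
  then have "{x. mixed H x r} \<subseteq> (\<Union>\<gamma>\<in>{..<r}. A \<gamma>)" by blast
  from few_subset[OF _ this] have "\<not> few r (\<Union>\<gamma>\<in>{..<r}. A \<gamma>)" using not_few by blast
  moreover have "dfn UNIV (\<lambda>e. e 0 \<in> A (val (e 1)))"
    unfolding A_def ann_def mem_Collect_eq
    by (intro dfn_mixed[OF H] dfn_lt[OF H] dfn_eqv[OF H] dfn_cb dfnU_intros)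
  moreover have "A \<alpha> \<subseteq> A \<beta>" if "\<alpha> \<le> \<beta>" for \<alpha> \<beta>
  proof -
    have "ann x \<alpha> y" if "ann x \<beta> y" for x y using that \<open>\<alpha> \<le> \<beta>\<close> by (auto simp: ann_def)
    then show ?thesis unfolding A_def by blast
  qed
  ultimately obtain \<gamma> where \<gamma>: "\<gamma> < r" "\<not> few r (A \<gamma>)" using few_increasing[of A r] by blast
  have "dset (A \<gamma>)"
    unfolding A_def ann_def
    by (intro dset_Collect dfn_mixed[OF H] dfn_lt[OF H] dfn_eqv[OF H] dfn_cb dfnU_intros)
  from dset_not_few_ball[OF this \<gamma>(2)] obtain z s where s: "s < r" "cb z s \<subseteq> A \<gamma>" by blast
  \<comment> \<open>The ball has radius below \<open>r\<close>, which leaves room for three points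
    whose mutual distances lie strictly between \<open>max s \<gamma>\<close> and
    \<open>r\<close>.\<close>
  obtain s1 where s1: "max s \<gamma> < s1" "s1 < r" using dense[of "max s \<gamma>" r] s(1) \<gamma>(1) by auto
  obtain s2 where s2: "s1 < s2" "s2 < r" using dense s1(2) by blast
  obtain p q where p: "p \<noteq> 0" "val p = s1" and q: "q \<noteq> 0" "val q = s2" using ex_val by metis
  have pq: "p \<noteq> q" "val (p - q) = s1"
    using val_diff_eq[of p 0 q] p q s2(1) by auto
  have in_A: "z \<in> A \<gamma>" "z + p \<in> A \<gamma>" "z + q \<in> A \<gamma>"
    using s s1 s2 p q by (auto simp: cb_def)
  define far where "far a b \<longleftrightarrow> a \<noteq> b \<and> \<gamma> < val (b - a) \<and> val (b - a) < r" for a b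
  have far_sym: "far a b \<Longrightarrow> far b a" for a b
    using val_diff_commute[of a b] by (auto simp: far_def)
  have fars: "far z (z + p)" "far z (z + q)" "far (z + q) (z + p)"
    using p q pq s1 s2 by (auto simp: far_def)
  have ann_far: "ann x \<gamma> y" if "far a b" "x \<in> cb a r" "y \<in> cb b r" for a b x y
    using val_between_balls[OF _ _ that(2,3)] that(1) by (auto simp: far_def ann_def)
  have choice: "\<exists>x. x \<in> cb a r \<and> ((\<forall>y. ann x \<gamma> y \<longrightarrow> lt H y x) \<or> (\<forall>y. ann x \<gamma> y \<longrightarrow> lt H x y))"
    if asm: "a \<in> A \<gamma>" "b \<in> A \<gamma>" "far a b" for a b
  proof -
    obtain x where x: "x \<in> cb a r" "(\<forall>y. ann x \<gamma> y \<longrightarrow> lt H y x) \<or> (\<forall>y. ann x \<gamma> y \<longrightarrow> lt H x y) \<or>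
      (\<forall>y. ann x \<gamma> y \<longrightarrow> eqv H y x)" using asm(1) unfolding A_def by blast
    \<comment> \<open>Equality would make all of \<open>cb b r\<close> equivalent to
      \<open>x\<close>, although that ball is mixed.\<close>
    have "\<not> (\<forall>y. ann x \<gamma> y \<longrightarrow> eqv H y x)"
    proof
      assume "\<forall>y. ann x \<gamma> y \<longrightarrow> eqv H y x"
      then have "\<forall>y\<in>cb b r. eqv H y x" using ann_far[OF asm(3) x(1)] by blast
      then have "\<not> mixed H b r" unfolding mixed_def eqv_def by auto
      then show False using asm(2) by (auto simp: A_def)
    qed
    with x show ?thesis by blast
  qed
  obtain x1 where x1: "x1 \<in> cb z r" "(\<forall>y. ann x1 \<gamma> y \<longrightarrow> lt H y x1) \<or> (\<forall>y. ann x1 \<gamma> y \<longrightarrow> lt H x1 y)"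
    using choice[OF in_A(1,2) fars(1)] by blast
  obtain x2 where x2: "x2 \<in> cb (z + p) r" "(\<forall>y. ann x2 \<gamma> y \<longrightarrow> lt H y x2) \<or> (\<forall>y. ann x2 \<gamma> y \<longrightarrow> lt H x2 y)"
    using choice[OF in_A(2,1) far_sym[OF fars(1)]] by blast
  obtain x3 where x3: "x3 \<in> cb (z + q) r" "(\<forall>y. ann x3 \<gamma> y \<longrightarrow> lt H y x3) \<or> (\<forall>y. ann x3 \<gamma> y \<longrightarrow> lt H x3 y)"
    using choice[OF in_A(3,1) far_sym[OF fars(2)]] by blast
  \<comment> \<open>Two of the three centres have the same alternative, and each lies in the annulus
    of the other; they would compare in both directions.\<close>
  have "ann x1 \<gamma> x2" "ann x2 \<gamma> x1" "ann x1 \<gamma> x3" "ann x3 \<gamma> x1" "ann x2 \<gamma> x3" "ann x3 \<gamma> x2"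
    using ann_far far_sym fars x1(1) x2(1) x3(1) by blast+
  then show False using x1(2) x2(2) x3(2) lt_antisym by metis
qed

section \<open>Points with the same mixed radii\<close>

definition level :: "('k \<Rightarrow> 'g \<Rightarrow> 'g) \<Rightarrow> ('g \<Rightarrow> bool) \<Rightarrow> 'k set" where
  "level H J = {x. \<forall>r. mixed H x r \<longleftrightarrow> J r}"

definition initial_segments :: "'g \<Rightarrow> ('g \<Rightarrow> bool) set" where
  "initial_segments \<rho> = {\<lambda>r. False, \<lambda>r. True, \<lambda>r. r < \<rho>, \<lambda>r. r \<le> \<rho>}"

lemma level_few: "fam UNIV (\<lambda>_. H) \<Longrightarrow> J r \<Longrightarrow> few r (level H J)"
  by (rule few_subset[OF few_mixed]) (auto simp: level_def)

lemma level_eqv: "x \<in> level H J \<Longrightarrow> \<not> J r \<Longrightarrow> y \<in> cb x r \<Longrightarrow> eqv H y x"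
  using cb_refl unfolding level_def mixed_def by blast

lemma dset_level:
  assumes "fam UNIV (\<lambda>_. H)" "J \<in> initial_segments \<rho>"
  shows "dset (level H J)"
proof -
  have "dfn UNIV (\<lambda>e. J (val (e 0)))"
    using assms(2) unfolding initial_segments_def
    by (auto intro!: dfn_const dfn_less dfn_le dfnG_const dfnG_val_var)
  then show ?thesis unfolding level_def
    by (intro dset_Collect dfnU_intros dfn_mixed[OF assms(1)])
qed

text \<open>A level with a mixed radius \<open>r\<close> is few at \<open>r\<close>, so it contains
  no larger ball; hence it is finite if all radii are mixed, and few at \<rho> if precisely those
  below \<rho> are. If \<rho> is mixed too, \<open>H\<close> is still constant on the residue
  classes of balls of radius \<rho>, and \<open>residue_finite_image\<close> applies.\<close>

lemma level_finite_image:
  assumes H: "fam UNIV (\<lambda>_. H)" and J: "J \<in> initial_segments \<rho>" and \<gamma>: "0 < \<gamma>"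
  shows "finite ((\<lambda>x. H x \<gamma>) ` level H J)"
proof -
  note d = dset_level[OF H J]
  have no_ball: "\<not> cb x s \<subseteq> level H J" if "s < r" "J r" for x s r
    using level_few[OF H, of J r] that not_few_cb few_subset by blast
  consider (never) "\<And>r. \<not> J r" | (always) "\<And>r. J r" | (less) "\<And>r. J r \<longleftrightarrow> r < \<rho>"
    | (le) "\<And>r. J r \<longleftrightarrow> r \<le> \<rho>"
    using J by (auto simp: initial_segments_def)
  then show ?thesis
  proof cases
    case never
    have *: "H y \<gamma> = H x \<gamma>" if "x \<in> level H J" for x y
    proof -
      have "eqv H y x" by (rule level_eqv[OF that never, of y "val (y - x)"]) (simp add: cb_def)
      then show ?thesis using \<gamma> by (simp add: eqv_def)
    qed
    have "(\<lambda>x. H x \<gamma>) ` level H J \<subseteq> {H 0 \<gamma>}" using *[where y = 0] by auto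
    then show ?thesis using finite_subset by blast
  next
    case always
    have "finite (level H J)"
      using dset_infinite_ball[OF d] no_ball always gt_ex by blast
    then show ?thesis by simp
  next
    case less
    have "few \<rho> (level H J)"
    proof (rule ccontr)
      assume "\<not> few \<rho> (level H J)"
      from dset_not_few_ball[OF d this] obtain x s where xs: "s < \<rho>" "cb x s \<subseteq> level H J" by blast
      obtain r where "s < r" "r < \<rho>" using dense xs(1) by blast
      then show False using no_ball[of s r x] xs(2) less by blast
    qed
    then show ?thesis
    proof (rule few_finite_image)
      fix x y assume "x \<in> level H J" "y \<in> cb x \<rho>"
      then have "eqv H y x" using level_eqv[of x H J \<rho> y] less by blast
      then show "H y \<gamma> = H x \<gamma>" using \<gamma> by (simp add: eqv_def)
    qed
  next
    case le
    have "few \<rho> (level H J)" by (rule level_few[OF H]) (simp add: le)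
    then obtain F where F: "finite F" "level H J \<subseteq> (\<Union>a\<in>F. cb a \<rho>)" by (auto simp: few_def)
    have "finite ((\<lambda>x. H x \<gamma>) ` {x. x \<in> level H J \<and> x \<in> cb a \<rho>})" for a
    proof (rule residue_finite_image[where r = \<rho> and c = a])
      show "dset {x. x \<in> level H J \<and> x \<in> cb a \<rho>}"
        by (intro dset_Collect dfn_mem[OF d] dfn_cb dfnU_intros)
      show "dfnG UNIV (\<lambda>e. H (e 0) \<gamma>)" by (intro fam_app[OF H] dfnU_intros)
      fix x y assume x: "x \<in> {x. x \<in> level H J \<and> x \<in> cb a \<rho>}" and y: "y \<in> ob x \<rho>"
      show "H y \<gamma> = H x \<gamma>"
      proof (cases "y = x")
        case False
        then have "\<rho> < val (y - x)" using y by (auto simp: ob_def)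
        then have "eqv H y x"
          using level_eqv[of x H J "val (y - x)" y] le x by (auto simp: cb_def)
        then show ?thesis using \<gamma> by (simp add: eqv_def)
      qed simp
    qed auto
    then have "finite (\<Union>a\<in>F. (\<lambda>x. H x \<gamma>) ` {x. x \<in> level H J \<and> x \<in> cb a \<rho>})" using F(1) by blast
    then show ?thesis by (rule rev_finite_subset) (use F(2) in blast)
  qed
qed

lemma ex_level:
  assumes H: "fam UNIV (\<lambda>_. H)"
  shows "\<exists>\<rho>. \<exists>J\<in>initial_segments \<rho>. x \<in> level H J"
proof -
  define I where "I = {r. mixed H x r}"
  have I: "gset I" unfolding I_def by (intro gset_Collect dfnU_intros dfn_mixed[OF H])
  have down: "s \<in> I" if "r \<in> I" "s \<le> r" for r s
    using that cb_mono[of s r x] unfolding I_def mixed_def by blast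
  show ?thesis
  proof (cases "I = {} \<or> I = UNIV")
    case True
    then show ?thesis by (auto simp: level_def initial_segments_def I_def)
  next
    case False
    then obtain a b where ab: "a \<in> I" "b \<notin> I" by blast
    then have "\<And>s. s \<in> I \<Longrightarrow> s \<le> b" using down by (meson linear)
    from gset_lub[OF I ab(1) this] have lub: "is_lub I (lub I)" .
    define \<rho> where "\<rho> = lub I"
    have le: "s \<le> \<rho>" if "s \<in> I" for s using lub that unfolding is_lub_def \<rho>_def by blast
    have less: "s \<in> I" if "s < \<rho>" for s
    proof (rule ccontr)
      assume "s \<notin> I"
      then have "\<forall>\<alpha>. \<alpha> \<in> I \<longrightarrow> \<alpha> \<le> s" using down by (meson linear)
      then have "\<rho> \<le> s" using lub unfolding is_lub_def \<rho>_def by blast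
      then show False using that by simp
    qed
    show ?thesis
    proof (cases "\<rho> \<in> I")
      case True
      then have "r \<in> I \<longleftrightarrow> r \<le> \<rho>" for r using le down by blast
      then have "mixed H x r \<longleftrightarrow> r \<le> \<rho>" for r by (simp add: I_def)
      then show ?thesis by (auto simp: level_def initial_segments_def)
    next
      case False
      then have "r \<in> I \<longleftrightarrow> r < \<rho>" for r using le less by (metis order.order_iff_strict)
      then have "mixed H x r \<longleftrightarrow> r < \<rho>" for r by (simp add: I_def)
      then show ?thesis by (auto simp: level_def initial_segments_def)
    qed
  qed
qed

section \<open>Elimination of parameters from the field\<close>

definition gfam :: "'k set \<Rightarrow> ((nat \<Rightarrow> 'k) \<Rightarrow> 'g \<Rightarrow> 'g) \<Rightarrow> bool" where
  "gfam A h \<longleftrightarrow> dfnG A (\<lambda>e. h (\<lambda>i. e (Suc i)) (val (e 0)))"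

lemma gfam_subst:
  assumes h: "gfam A h" and \<tau>: "\<And>i. var_or_const B (\<tau> i)" and "A \<subseteq> B" "dfnG B t"
  shows "dfnG B (\<lambda>e. h (\<lambda>i. \<tau> i e) (t e))"
proof -
  define \<sigma> where "\<sigma> = case_nat (\<lambda>e. e (Suc 0)) (case_nat (\<lambda>e. e 0) (\<lambda>i e. \<tau> i (\<lambda>j. e (Suc (Suc j)))))"
  have "var_or_const B (\<lambda>e. \<tau> i (\<lambda>j. e (Suc (Suc j))))" for i
    using \<tau>[of i] by (auto simp: var_or_const_def)
  then have "var_or_const B (\<sigma> i)" for i
    unfolding \<sigma>_def by (auto simp: var_or_const_var split: nat.split)
  from dfn_subst[where \<tau> = \<sigma>, OF dfn_mono[OF h[unfolded gfam_def dfnG_def] assms(3)] this]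
  have "dfn B (\<lambda>e. val (e (Suc 0)) = h (\<lambda>i. \<tau> i (\<lambda>j. e (Suc (Suc j)))) (val (e 0)))"
    by (simp add: \<sigma>_def)
  then show ?thesis unfolding dfnG_def
    by (rule dfn_substG[where t = "\<lambda>e. t (\<lambda>i. e (Suc i))" and
          P = "\<lambda>e x. val (e 0) = h (\<lambda>i. \<tau> i (\<lambda>j. e (Suc j))) x"])
      (rule dfnG_rename[OF assms(4)])
qed

lemma gfam_app: "gfam A h \<Longrightarrow> dfnG A t \<Longrightarrow> dfnG A (\<lambda>e. h (\<lambda>i. e (\<rho> i)) (t e))"
  by (rule gfam_subst) (auto intro: var_or_const_var)

lemma gfam_const: "gfam A h \<Longrightarrow> dfnG UNIV t \<Longrightarrow> dfnG UNIV (\<lambda>e. h e' (t e))"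
  by (rule gfam_subst[where \<tau> = "\<lambda>i _. e' i"]) (auto intro: var_or_const_const)

text \<open>Entries from \<open>m\<close> on are parameters from the value group, given by a representative.\<close>

definition depends :: "nat \<Rightarrow> ((nat \<Rightarrow> 'k) \<Rightarrow> 'b) \<Rightarrow> bool" where
  "depends m h \<longleftrightarrow>
     (\<forall>e e'. (\<forall>i<m. e i = e' i) \<and> (\<forall>i. val (e i) = val (e' i)) \<longrightarrow> h e = h e')"

lemma dependsD:
  "depends m h \<Longrightarrow> (\<And>i. i < m \<Longrightarrow> e i = e' i) \<Longrightarrow> (\<And>i. val (e i) = val (e' i)) \<Longrightarrow> h e = h e'"
  unfolding depends_def by blast

text \<open>Entry \<open>m\<close> keeps its place, but from now on only its value counts: it
  represents the \<rho> that describes the level of the old parameter. The supremum over the level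
  is a maximum by \<open>level_finite_image\<close>, so it dominates \<open>h e\<close>.\<close>

lemma eliminate_parameter:
  assumes h: "gfam {} h" and dep: "depends (Suc m) h"
  shows "\<exists>g e'. gfam {} g \<and> depends m g \<and> (\<forall>\<gamma>>0. h e \<gamma> \<le> g e' \<gamma>)"
proof -
  define H where "H e x = h (e(m := x))" for e x
  have "(\<lambda>i. e (Suc (Suc i)))(m := e 0) = (\<lambda>i. e (if i = m then 0 else Suc (Suc i)))" for e :: "nat \<Rightarrow> 'k"
    by auto
  then have H: "fam {} H"
    unfolding fam_def H_def by (simp only:) (intro gfam_app[OF h] dfn_intros)
  have He: "fam UNIV (\<lambda>_. H e)" for e
  proof -
    have eq: "e(m := x) = (\<lambda>i. if i = m then x else e i)" for x by auto
    have "dfnG UNIV (\<lambda>e'. h (\<lambda>i. if i = m then e' 0 else e i) (val (e' 1)))"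
    proof (rule gfam_subst[OF h, of UNIV "\<lambda>i e'. if i = m then e' 0 else e i" "\<lambda>e. val (e 1)"])
      show "var_or_const UNIV (\<lambda>e'. if i = m then e' 0 else e i)" for i
        by (cases "i = m") (simp_all add: var_or_const_var var_or_const_const)
    qed (simp_all add: dfnG_val_var)
    then show ?thesis unfolding fam_def H_def eq .
  qed
  obtain \<rho> J where J: "J \<in> initial_segments \<rho>" and e: "e m \<in> level (H e) J"
    using ex_level[OF He] by blast
  \<comment> \<open>The shape of the initial segment, as a parameter-free relation between \<rho>
    and a radius. It may depend on \<open>e\<close>, and so may \<open>g\<close>.\<close>
  obtain K where K: "J = K \<rho>" and dK: "\<And>s t. dfnG {} s \<Longrightarrow> dfnG {} t \<Longrightarrow> dfn {} (\<lambda>e. K (s e) (t e))"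
  proof -
    consider "J = (\<lambda>_. False)" | "J = (\<lambda>_. True)" | "J = (\<lambda>r. r < \<rho>)" | "J = (\<lambda>r. r \<le> \<rho>)"
      using J unfolding initial_segments_def by blast
    then show ?thesis
    proof cases
      case 1
      then show ?thesis by (rule that[of "\<lambda>_ _. False"]) (rule dfn_const)
    next
      case 2
      then show ?thesis by (rule that[of "\<lambda>_ _. True"]) (rule dfn_const)
    next
      case 3
      then show ?thesis by (rule that[of "\<lambda>\<rho> r. r < \<rho>"]) (rule dfn_less)
    next
      case 4
      then show ?thesis by (rule that[of "\<lambda>\<rho> r. r \<le> \<rho>"]) (rule dfn_le)
    qed
  qed
  define g where "g e \<gamma> = lub {\<delta>. \<exists>x. (\<forall>r. mixed (H e) x r \<longleftrightarrow> K (val (e m)) r) \<and> \<delta> = H e x \<gamma>}"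
    for e \<gamma>
  have "gfam {} g"
    unfolding gfam_def g_def by (intro dfnG_lub dfn_intros dfn_mixed[OF H] fam_app[OF H] dK)
  moreover have "depends m g"
    unfolding depends_def
  proof (intro allI impI)
    fix e e' :: "nat \<Rightarrow> 'k" assume *: "(\<forall>i<m. e i = e' i) \<and> (\<forall>i. val (e i) = val (e' i))"
    have "H e = H e'"
      unfolding H_def by (intro ext fun_cong[OF dependsD[OF dep]]) (use * in auto)
    then show "g e = g e'" using * by (intro ext) (simp add: g_def)
  qed
  moreover obtain z where z: "val z = \<rho>" using ex_val by blast
  have "h e \<gamma> \<le> g (e(m := z)) \<gamma>" if "0 < \<gamma>" for \<gamma>
  proof -
    have "H (e(m := z)) = H e" by (simp add: H_def fun_eq_iff)
    then have "g (e(m := z)) \<gamma> = lub ((\<lambda>x. H e x \<gamma>) ` level (H e) J)"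
      unfolding g_def level_def by (simp add: z K image_def)
    moreover have "H e (e m) \<gamma> \<le> lub ((\<lambda>x. H e x \<gamma>) ` level (H e) J)"
      by (intro lub_le_finite level_finite_image[OF He J that] imageI e)
    ultimately show ?thesis by (simp add: H_def)
  qed
  ultimately show ?thesis by blast
qed

lemma eliminate_parameters:
  assumes "gfam {} h" "depends m h"
  shows "\<exists>g e'. gfam {} g \<and> depends 0 g \<and> (\<forall>\<gamma>>0. h e \<gamma> \<le> g e' \<gamma>)"
  using assms
proof (induction m arbitrary: h e)
  case (Suc m)
  obtain g e' where g: "gfam {} g" "depends m g" "\<And>\<gamma>. \<gamma> > 0 \<Longrightarrow> h e \<gamma> \<le> g e' \<gamma>"
    using eliminate_parameter[OF Suc.prems] by blast
  obtain g' e'' where "gfam {} g'" "depends 0 g'" "\<And>\<gamma>. \<gamma> > 0 \<Longrightarrow> g e' \<gamma> \<le> g' e'' \<gamma>"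
    using Suc.IH[OF g(1,2)] by blast
  with g(3) show ?case by (meson order_trans)
qed blast

lemma sat_case_nat_dfn:
  assumes "wf_fm L p"
  shows "dfn A (\<lambda>e. sat M (case_nat (e i) (case_nat (e j) (\<lambda>l. e (\<rho> l)))) p)"
proof -
  have "case_nat (e i) (case_nat (e j) (\<lambda>l. e (\<rho> l))) = (\<lambda>n. e (case_nat i (case_nat j \<rho>) n))"
    for e :: "nat \<Rightarrow> 'k" by (auto split: nat.split)
  then show ?thesis by (simp add: dfn_sat_var[OF assms])
qed

text \<open>The constants of the definition become variables, and their values are collected in
  \<open>e\<close>. For other environments the formula need not define a function; the supremum
  makes \<open>h\<close> total.\<close>

lemma gfam_of_function:
  assumes "dfnG UNIV (\<lambda>e. k (val (e 0)))"
  shows "\<exists>h m e. gfam {} h \<and> depends m h \<and> h e = k"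
proof -
  obtain p \<tau> where p: "wf_fm L p" and \<tau>: "\<And>i. var_or_const UNIV (\<tau> i)"
    and P: "(\<lambda>e. val (e 0) = k (val (e (Suc 0)))) = (\<lambda>e. sat M (\<lambda>i. \<tau> i e) p)"
    using assms by (auto simp: dfnG_def dfn_def)
  \<comment> \<open>Variables 0 and 1 represent the value and the argument; everything else moves up
    by two.\<close>
  define \<rho> where "\<rho> i = (if \<tau> i = (\<lambda>e. e 0) then 0 else if \<tau> i = (\<lambda>e. e (Suc 0)) then Suc 0 else Suc (Suc i))" for i
  define e where "e i = \<tau> i (\<lambda>_. 0)" for i
  define q where "q = ren_fm \<rho> p"
  have q: "sat M (case_nat y (case_nat x e)) q \<longleftrightarrow> val y = k (val x)" for x y
  proof -
    define E where "E = case_nat y (case_nat x (\<lambda>_. 0::'k))"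
    have "case_nat y (case_nat x e) (\<rho> i) = \<tau> i E" for i
    proof -
      consider j where "\<tau> i = (\<lambda>e. e j)" | a where "\<tau> i = (\<lambda>_. a)"
        using \<tau>[of i] by (auto simp: var_or_const_def)
      then show ?thesis
      proof cases
        case 1
        have neq: "(\<lambda>e::nat \<Rightarrow> 'k. e a) = (\<lambda>e. e b) \<longleftrightarrow> a = b" for a b
        proof
          assume "(\<lambda>e::nat \<Rightarrow> 'k. e a) = (\<lambda>e. e b)"
          from fun_cong[OF this, of "\<lambda>i. if i = a then 1 else 0"] show "a = b" by (simp split: if_splits)
        qed simp
        show ?thesis using 1 by (auto simp: \<rho>_def e_def E_def neq split: nat.split)
      next
        case 2
        have "(\<lambda>_::nat \<Rightarrow> 'k. a) \<noteq> (\<lambda>e. e b)" for b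
        proof
          assume "(\<lambda>_::nat \<Rightarrow> 'k. a) = (\<lambda>e. e b)"
          from fun_cong[OF this, of "\<lambda>_. a + 1"] show False by simp
        qed
        then show ?thesis using 2 by (simp add: \<rho>_def e_def)
      qed
    qed
    then have "sat M (case_nat y (case_nat x e)) q = sat M (\<lambda>i. \<tau> i E) p"
      by (simp add: q_def sat_ren_fm)
    also have "\<dots> = (val y = k (val x))" using fun_cong[OF P, of E] by (simp add: E_def)
    finally show ?thesis .
  qed
  have wf: "wf_fm L q" using p by (simp add: q_def wf_ren_fm)
  define h where "h e \<gamma> = lub {\<delta>. \<exists>x y. val x = \<gamma> \<and> val y = \<delta> \<and> sat M (case_nat y (case_nat x e)) q}"
    for e \<gamma>
  have "gfam {} h"
    unfolding gfam_def h_def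
    by (intro dfnG_lub dfn_intros sat_case_nat_dfn[OF wf])
  moreover obtain m where m: "\<And>j. j \<in> fv q \<Longrightarrow> j < m"
    using finite_fv[of q] by (metis finite_nat_set_iff_bounded)
  have "depends m h"
    unfolding depends_def
  proof (intro allI impI)
    fix e e' :: "nat \<Rightarrow> 'k" assume *: "(\<forall>i<m. e i = e' i) \<and> (\<forall>i. val (e i) = val (e' i))"
    have "sat M (case_nat y (case_nat x e)) q = sat M (case_nat y (case_nat x e')) q" for x y
      by (rule sat_cong) (use m * in \<open>force split: nat.split\<close>)
    then show "h e = h e'" by (simp add: h_def fun_eq_iff)
  qed
  moreover have "h e \<gamma> = k \<gamma>" for \<gamma>
  proof -
    have "(\<exists>x y. val x = \<gamma> \<and> val y = \<delta> \<and> val y = k (val x)) \<longleftrightarrow> \<delta> = k \<gamma>" for \<delta>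
      using ex_val[of \<gamma>] ex_val[of \<delta>] by auto
    then show ?thesis unfolding h_def q using lub_singleton[of "k \<gamma>"] by simp
  qed
  ultimately show ?thesis by blast
qed

lemma dfn_empty_formula:
  assumes "dfn {} P"
  obtains q where "wf_fm L q" "\<And>e. P e \<longleftrightarrow> sat M e q"
proof -
  obtain p \<tau> where p: "wf_fm L p" "\<And>i. var_or_const {} (\<tau> i)" "P = (\<lambda>e. sat M (\<lambda>i. \<tau> i e) p)"
    using assms by (auto simp: dfn_def)
  then obtain \<rho> where "\<And>i. \<tau> i = (\<lambda>e. e (\<rho> i))" unfolding var_or_const_def by (metis empty_iff)
  then have "P e \<longleftrightarrow> sat M e (ren_fm \<rho> p)" for e by (simp add: p(3) sat_ren_fm)
  then show ?thesis using that[of "ren_fm \<rho> p"] p(1) by (simp add: wf_ren_fm)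
qed

text \<open>Tuples in a \<open>pullback\<close> have nonzero entries, whereas \<open>val\<close>
  also assigns a value to 0.\<close>

primrec nonzero_vars :: "nat \<Rightarrow> ('f vf_fun, 'r vf_rel) fm \<Rightarrow> ('f vf_fun, 'r vf_rel) fm" where
  "nonzero_vars 0 q = q"
| "nonzero_vars (Suc n) q = Conj (Neg (Equal (Var n) (Fun Zero []))) (nonzero_vars n q)"

lemma wf_nonzero_vars: "wf_fm L (nonzero_vars n q) \<longleftrightarrow> wf_fm L q"
  by (induction n) (simp_all add: funs_L)

lemma fv_nonzero_vars: "fv (nonzero_vars n q) = {..<n} \<union> fv q"
  by (induction n) (simp_all add: lessThan_Suc)

lemma sat_nonzero_vars: "sat M e (nonzero_vars n q) \<longleftrightarrow> (\<forall>i<n. e i \<noteq> 0) \<and> sat M e q"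
  by (induction n) (simp_all add: fn_Zero All_less_Suc)

lemmas nonzero_vars = wf_nonzero_vars fv_nonzero_vars sat_nonzero_vars

text \<open>By \<open>depends 0\<close> the truth of the formula for the graph depends only on the
  values of its variables. The set of value tuples satisfying it is thus a relation symbol of the
  induced language, and one atomic formula, with values of entries of \<open>e\<close> as
  parameters, defines the graph.\<close>

lemma definable_induced:
  assumes g: "gfam {} g" and dep: "depends 0 g"
  shows "definable (L_ind L M v) Gamma_ind 2 (range (\<lambda>x. [x, g e x]))"
proof -
  have "dfn {} (\<lambda>e. val (e (Suc 0)) = g (\<lambda>i. e (Suc (Suc i))) (val (e 0)))"
    by (intro dfn_eqG gfam_app[OF g] dfnG_val_var)
  then obtain q where wf: "wf_fm L q"
    and q: "\<And>e. sat M e q \<longleftrightarrow> val (e (Suc 0)) = g (\<lambda>i. e (Suc (Suc i))) (val (e 0))"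
    by (rule dfn_empty_formula) blast
  have q_val: "sat M e q = sat M e' q" if "\<And>i. val (e i) = val (e' i)" for e e'
  proof -
    have "g (\<lambda>i. e (Suc (Suc i))) = g (\<lambda>i. e' (Suc (Suc i)))"
      by (rule dependsD[OF dep]) (use that in auto)
    then show ?thesis unfolding q using that by simp
  qed
  obtain N where N: "\<And>j. j \<in> fv q \<Longrightarrow> j < N" "2 \<le> N"
  proof -
    obtain N where "\<And>j. j \<in> fv q \<Longrightarrow> j < N"
      using finite_fv[of q] by (metis finite_nat_set_iff_bounded)
    then show ?thesis using that[of "N + 2"] by (meson le_add2 less_le_trans trans_less_add1)
  qed
  define D where "D = {gs. length gs = N \<and> (\<exists>ys. map v ys = map Fin gs \<and> sat M (assign ys (\<lambda>_. 0)) q)}"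
  have vals: "ys ! i \<noteq> 0 \<and> val (ys ! i) = gs ! i" if "map v ys = map Fin gs" "i < length ys" for ys gs i
  proof -
    have "length gs = length ys" using that(1) by (metis length_map)
    then have "v (ys ! i) = Fin (gs ! i)" using that by (metis nth_map)
    then show ?thesis by (auto simp: v_eq split: if_splits)
  qed
  have len: "length ys = length gs" if "map v ys = map Fin gs" for ys gs
    using that by (metis length_map)
  have inv: "sat M (assign ys (\<lambda>_. 0)) q = sat M (assign ys' (\<lambda>_. 0)) q"
    if "map v ys = map Fin gs" "map v ys' = map Fin gs" for ys ys' gs
    by (rule q_val) (use vals[OF that(1)] vals[OF that(2)] len[OF that(1)] len[OF that(2)] in
        \<open>simp add: assign_def\<close>)
  have "pullback v ({[]} \<times> D) = solutions M N (\<lambda>_. 0) (nonzero_vars N q)"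
  proof (intro set_eqI iffI)
    fix ys assume "ys \<in> pullback v ({[]} \<times> D)"
    then obtain gs where gs: "gs \<in> D" "map v ys = map Fin gs" by (auto simp: pullback_def)
    then have len_ys: "length ys = N" using len by (simp add: D_def)
    obtain ys' where "map v ys' = map Fin gs" "sat M (assign ys' (\<lambda>_. 0)) q"
      using gs(1) by (auto simp: D_def)
    then have "sat M (assign ys (\<lambda>_. 0)) q" using inv[OF gs(2)] by blast
    moreover have "\<forall>i<N. assign ys (\<lambda>_. 0) i \<noteq> 0"
      using vals[OF gs(2)] len_ys by (simp add: assign_def)
    ultimately show "ys \<in> solutions M N (\<lambda>_. 0) (nonzero_vars N q)"
      using len_ys by (simp add: solutions_def nonzero_vars)
  next
    fix ys assume ys: "ys \<in> solutions M N (\<lambda>_. 0) (nonzero_vars N q)"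
    then have len_ys: "length ys = N" and nz: "\<And>i. i < N \<Longrightarrow> ys ! i \<noteq> 0"
      and sat: "sat M (assign ys (\<lambda>_. 0)) q"
      by (auto simp: solutions_def nonzero_vars assign_def)
    have "map v ys = map Fin (map val ys)"
      using nz len_ys by (auto simp: v_eq in_set_conv_nth)
    moreover from this have "map val ys \<in> D" using sat len_ys unfolding D_def
      by (intro CollectI conjI exI[of _ ys]) simp_all
    ultimately show "ys \<in> pullback v ({[]} \<times> D)" by (fastforce simp: pullback_def)
  qed
  moreover have "fv (nonzero_vars N q) \<subseteq> {..<N}" using N by (auto simp: nonzero_vars)
  moreover have "wf_fm L (nonzero_vars N q)" using wf by (simp add: nonzero_vars)
  ultimately have "zero_definable L M N (pullback v ({[]} \<times> D))"
    unfolding zero_definable_def by (metis carr_M subset_UNIV)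
  then have D: "(D, N) \<in> rels (L_ind L M v)"
    by (auto simp: L_ind_def zero_interpretable_def D_def)
  \<comment> \<open>Places 0 and 1 belong to the argument and the value of the function.\<close>
  define E where "E i = val (e (i - 2))" for i
  have mem: "map (assign [x, y] E) [0..<N] \<in> D \<longleftrightarrow> y = g e x" for x y
  proof -
    have "\<exists>Y. \<forall>i. Y i \<noteq> 0 \<and> val (Y i) = assign [x, y] E i" by (intro choice allI ex_val)
    then obtain Y where Y: "\<And>i. Y i \<noteq> 0 \<and> val (Y i) = assign [x, y] E i" by blast
    define ys where "ys = map Y [0..<N]"
    have map_ys: "map v ys = map Fin (map (assign [x, y] E) [0..<N])"
      using Y by (simp add: ys_def v_eq)
    have "map (assign [x, y] E) [0..<N] \<in> D \<longleftrightarrow> sat M (assign ys (\<lambda>_. 0)) q"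
    proof
      assume "map (assign [x, y] E) [0..<N] \<in> D"
      then obtain ys' where "map v ys' = map Fin (map (assign [x, y] E) [0..<N])"
        "sat M (assign ys' (\<lambda>_. 0)) q" unfolding D_def by blast
      then show "sat M (assign ys (\<lambda>_. 0)) q" using inv[OF map_ys] by blast
    next
      assume "sat M (assign ys (\<lambda>_. 0)) q"
      then show "map (assign [x, y] E) [0..<N] \<in> D" using map_ys unfolding D_def by fastforce
    qed
    also have "\<dots> \<longleftrightarrow> sat M Y q"
      by (rule sat_cong) (use N in \<open>auto simp: assign_def ys_def\<close>)
    also have "\<dots> \<longleftrightarrow> y = g (\<lambda>i. Y (Suc (Suc i))) x"
      using Y[of 0] Y[of "Suc 0"] by (simp add: q assign_def)
    also have "g (\<lambda>i. Y (Suc (Suc i))) = g e"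
      by (rule dependsD[OF dep]) (use Y in \<open>auto simp: assign_def E_def\<close>)
    finally show ?thesis .
  qed
  have "range (\<lambda>x. [x, g e x]) = solutions Gamma_ind 2 E (Rel D (map Var [0..<N]))"
  proof (intro set_eqI iffI)
    fix xs assume "xs \<in> range (\<lambda>x. [x, g e x])"
    then obtain x where xs: "xs = [x, g e x]" by blast
    show "xs \<in> solutions Gamma_ind 2 E (Rel D (map Var [0..<N]))"
      unfolding solutions_def xs using mem[of x "g e x"] by (simp add: Gamma_ind_def comp_def)
  next
    fix xs assume xs: "xs \<in> solutions Gamma_ind 2 E (Rel D (map Var [0..<N]))"
    then have "length xs = 2" by (simp add: solutions_def)
    then obtain x y where xy: "xs = [x, y]" by (auto simp: numeral_2_eq_2 length_Suc_conv)
    then have "map (assign [x, y] E) [0..<N] \<in> D"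
      using xs by (simp add: solutions_def Gamma_ind_def comp_def)
    then show "xs \<in> range (\<lambda>x. [x, g e x])" using mem xy by auto
  qed
  moreover have "wf_fm (L_ind L M v) (Rel D (map Var [0..<N]))"
    using D by (simp add: list_all_iff)
  ultimately show ?thesis
    unfolding definable_def by (intro exI[of _ "Rel D (map Var [0..<N])"] exI[of _ E]) (simp add: Gamma_ind_def)
qed

lemma dfnG_mul: "dfnG A t \<Longrightarrow> dfnG A (\<lambda>e. mul n (t e))"
  by (induction n) (simp_all add: dfnG_0 dfnG_add)

lemma linear_bound:
  assumes "Q_linearly_bounded (L_ind L M v) (Gamma_ind :: ('g, unit, 'g list set) struct)"
    and k: "dfnG UNIV (\<lambda>e. k (val (e 0)))"
  shows "\<exists>n T. \<forall>\<gamma>>T. k \<gamma> < mul n \<gamma>"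
proof -
  obtain h m e where h: "gfam {} h" "depends m h" and he: "h e = k" using gfam_of_function[OF k] by blast
  obtain g e' where g: "gfam {} g" "depends 0 g" and le: "\<And>\<gamma>. \<gamma> > 0 \<Longrightarrow> h e \<gamma> \<le> g e' \<gamma>"
    using eliminate_parameters[OF h] by blast
  obtain n a where na: "\<And>x. \<bar>x\<bar> > \<bar>a\<bar> \<Longrightarrow> \<bar>g e' x\<bar> < \<bar>int_mult n x\<bar>"
    using assms(1) definable_induced[OF g] unfolding Q_linearly_bounded_def by blast
  have "k \<gamma> < mul (nat \<bar>n\<bar>) \<gamma>" if "\<bar>a\<bar> < \<gamma>" for \<gamma>
  proof -
    have pos: "0 < \<gamma>" using that abs_ge_zero[of a] by (rule le_less_trans[rotated])
    have "k \<gamma> \<le> g e' \<gamma>" using le[OF pos] he by simp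
    also have "\<dots> \<le> \<bar>g e' \<gamma>\<bar>" by (rule abs_ge_self)
    also have "\<dots> < \<bar>int_mult n \<gamma>\<bar>" using na[of \<gamma>] that pos by simp
    also have "\<dots> = mul (nat \<bar>n\<bar>) \<gamma>" using pos by (simp add: abs_int_mult)
    finally show ?thesis .
  qed
  then show ?thesis by blast
qed

section \<open>Functions on the field near infinity\<close>

text \<open>The residue field is infinite: a root of \<open>\<Prod>(X - a) + 1\<close>, with \<open>a\<close> ranging over a finite set
  of elements of non-negative value, lies in none of their residue classes.\<close>

lemma new_residue_class:
  assumes F: "finite F" "\<And>a. a \<in> F \<Longrightarrow> a \<in> cb 0 0"
  shows "\<exists>x\<in>cb 0 0. \<forall>a\<in>F. x \<notin> ob a 0"
proof -
  \<comment> \<open>Adjoining 0 makes the product nonempty, hence \<open>P\<close> nonconstant, and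
    the root nonzero.\<close>
  define F' where "F' = insert 0 F"
  have F': "finite F'" "\<And>a. a \<in> F' \<Longrightarrow> a = 0 \<or> 0 \<le> val a" "F' \<noteq> {}"
    using F by (auto simp: F'_def cb_def)
  define P where "P = (\<Prod>a\<in>F'. [:-a, 1:]) + [:1:]"
  have "degree (\<Prod>a\<in>F'. [:-a, 1::'k:]) = card F'"
    using degree_prod_eq_sum_degree[of F' "\<lambda>a. [:-a, 1:]"] by simp
  then have "0 < degree P"
    unfolding P_def using F'(1,3) by (subst degree_add_eq_left) (auto simp: card_gt_0_iff)
  then obtain x where "poly P x = 0" using alg_closed_imp_poly_has_root by blast
  then have prod: "(\<Prod>a\<in>F'. x - a) = -1"
    by (simp add: P_def poly_prod eq_neg_iff_add_eq_0)
  then have nz: "x - a \<noteq> 0" if "a \<in> F'" for a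
    using that F'(1) prod_zero_iff[of F' "\<lambda>a. x - a"] by (metis neg_equal_0_iff_equal zero_neq_one)
  have val_prod: "val (\<Prod>a\<in>G. x - a) = (\<Sum>a\<in>G. val (x - a))" if "finite G" "G \<subseteq> F'" for G
    using that
  proof (induction G)
    case (insert a G)
    have "(\<Prod>a\<in>G. x - a) \<noteq> 0" using insert nz by auto
    then show ?case using insert nz val_mult by auto
  qed simp
  \<comment> \<open>Once the values of the factors are known to be nonnegative, this makes all of
    them 0.\<close>
  have sum: "(\<Sum>a\<in>F'. val (x - a)) = 0"
    using val_prod[OF F'(1)] prod by simp
  have x0: "x \<noteq> 0" using nz[of 0] by (auto simp: F'_def)
  have "0 \<le> val x"
  proof (rule ccontr)
    assume "\<not> 0 \<le> val x"
    then have neg: "val x < 0" by simp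
    have "val (x - a) = val x" if "a \<in> F'" for a
    proof (cases "a = 0")
      case False
      then have "val (x - 0) < val (0 - a)" using F'(2)[OF that] neg by simp
      then show ?thesis using val_diff_eq(2)[of x 0 a] x0 by simp
    qed simp
    then have "(\<Sum>a\<in>F'. val (x - a)) < (\<Sum>a\<in>F'. 0)"
      by (intro sum_strict_mono F'(1,3)) (simp add: neg)
    then show False using sum by simp
  qed
  then have ge: "0 \<le> val (x - a)" if "a \<in> F'" for a
    using cb_trans[of x 0 0 a] cb_sym[of 0 a] F'(2)[OF that] nz[OF that] by (auto simp: cb_def)
  have "val (x - a) = 0" if "a \<in> F'" for a
    using sum sum_nonneg_eq_0_iff[of F' "\<lambda>a. val (x - a)"] F'(1) ge that by blast
  then show ?thesis using nz by (intro bexI[of _ x]) (auto simp: F'_def cb_def ob_def \<open>0 \<le> val x\<close>)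
qed

text \<open>Scaling by an element of value \<gamma> reduces this to radius 0; the class of 0 is
  avoided as well, so that the new point has value 0.\<close>

lemma not_few_open_annulus: "\<not> few_open \<gamma> {x. x \<noteq> 0 \<and> val x = \<gamma>}"
proof
  assume "few_open \<gamma> {x. x \<noteq> 0 \<and> val x = \<gamma>}"
  then obtain F where F: "finite F" "{x. x \<noteq> 0 \<and> val x = \<gamma>} \<subseteq> (\<Union>a\<in>F. ob a \<gamma>)"
    by (auto simp: few_open_def)
  obtain c where c: "c \<noteq> 0" "val c = \<gamma>" using ex_val by blast
  have val_div: "val (y / c) = val y - \<gamma>" if "y \<noteq> 0" for y
    using val_mult[of "y / c" c] that c by (simp add: eq_diff_eq)
  define G where "G = insert 0 ((\<lambda>a. a / c) ` F) \<inter> cb 0 0"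
  obtain x where x: "x \<in> cb 0 0" "\<And>a. a \<in> G \<Longrightarrow> x \<notin> ob a 0"
    using new_residue_class[of G] F(1) unfolding G_def by blast
  have "x \<notin> ob 0 0" using x(2)[of 0] by (simp add: G_def)
  then have x0: "x \<noteq> 0" "val x = 0" using x(1) by (auto simp: ob_def cb_def)
  then have xc: "x * c \<noteq> 0" "val (x * c) = \<gamma>" using c val_mult by auto
  then obtain a where a: "a \<in> F" "x * c \<in> ob a \<gamma>" using F(2) by blast
  have "x \<in> ob (a / c) 0"
  proof (cases "x * c = a")
    case True
    then have "x = a / c" using c(1) by (simp add: field_simps)
    then show ?thesis by simp
  next
    case False
    then have "\<gamma> < val (x * c - a)" using a(2) by (simp add: ob_def)
    moreover have "x - a / c = (x * c - a) / c" using c(1) by (simp add: field_simps)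
    ultimately show ?thesis using val_div[of "x * c - a"] False by (simp add: ob_def)
  qed
  moreover have "a / c \<in> cb 0 0"
    using calculation x(1) ob_subset_cb ob_sym cb_trans by blast
  moreover have "a / c \<in> (\<lambda>a. a / c) ` F" using a(1) by (rule imageI)
  ultimately show False using x(2)[of "a / c"] unfolding G_def by blast
qed

text \<open>For values near minus infinity, \<open>q\<close> is unbounded on every residue class of
  the annuli or on none. If on every class, some \<beta> above the finitely many infima leaves in
  each class points above \<beta> and points not above it, against \<open>dset_residue\<close>. If
  on none, the suprema over the classes of an annulus take finitely many values.\<close>

lemma bounded_on_annuli:
  assumes q: "dfnG UNIV (\<lambda>e. q (e 0))" and q0: "\<And>x. 0 \<le> q x"
  shows "\<exists>\<gamma>0. \<forall>\<gamma><\<gamma>0. \<exists>b. \<forall>x. x \<noteq> 0 \<and> val x = \<gamma> \<longrightarrow> q x \<le> b"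
proof -
  note app = dfnG_app1[OF q]
  define V where "V = {x. \<not> (\<exists>b. \<forall>y. y \<in> ob x (val x) \<longrightarrow> q y \<le> b)}"
  have "dset V" unfolding V_def by (intro dset_Collect dfnU_intros dfn_ob app)
  from dset_center[OF this, of 0] obtain C where C: "finite C"
    "\<And>x y. x \<noteq> 0 \<Longrightarrow> y \<noteq> 0 \<Longrightarrow> val x \<le> val y \<Longrightarrow>
      (\<And>c. c \<in> C \<Longrightarrow> \<not> (val x \<le> c \<and> c \<le> val y)) \<Longrightarrow> (x \<in> V \<longleftrightarrow> y \<in> V)"
    by auto
  obtain g where g: "\<forall>c\<in>uminus ` C. c < g" using above_finite C(1) by blast
  define \<gamma>0 where "\<gamma>0 = - g"
  have \<gamma>0: "\<gamma>0 < c" if "c \<in> C" for c using g that by (auto simp: \<gamma>0_def minus_less_iff)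
  have le: "x \<in> V \<longleftrightarrow> y \<in> V" if "x \<noteq> 0" "y \<noteq> 0" "val x \<le> val y" "val y < \<gamma>0" for x y
    by (rule C(2)[OF that(1-3)]) (use \<gamma>0 that(4) in \<open>meson less_trans not_less\<close>)
  have same: "x \<in> V \<longleftrightarrow> y \<in> V" if "x \<noteq> 0" "y \<noteq> 0" "val x < \<gamma>0" "val y < \<gamma>0" for x y
    using that le[of x y] le[of y x] by (cases "val x" "val y" rule: le_cases) blast+
  define ann where "ann \<gamma> = {x. x \<noteq> 0 \<and> val x = \<gamma>}" for \<gamma>
  have ann: "dset (ann \<gamma>)" "ann \<gamma> \<subseteq> cb 0 \<gamma>" for \<gamma>
    unfolding ann_def by (intro dset_Collect dfnU_intros) (auto simp: cb_def)
  have not_V: "x \<notin> V" if x: "x \<noteq> 0" "val x < \<gamma>0" for x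
  proof
    assume "x \<in> V"
    define \<gamma> where "\<gamma> = val x"
    have allV: "y \<in> V" if "y \<in> ann \<gamma>" for y
      using same[of y x] x that \<open>x \<in> V\<close> by (simp add: ann_def \<gamma>_def)
    define d where "d y = lub {b. \<forall>z. z \<in> ob y \<gamma> \<longrightarrow> b \<le> q z}" for y
    have d_lub: "is_lub {b. \<forall>z. z \<in> ob y \<gamma> \<longrightarrow> b \<le> q z} (d y)" for y
      unfolding d_def
    proof (rule gset_lub)
      show "gset {b. \<forall>z. z \<in> ob y \<gamma> \<longrightarrow> b \<le> q z}"
        by (intro gset_Collect dfnU_intros dfn_ob app)
      show "0 \<in> {b. \<forall>z. z \<in> ob y \<gamma> \<longrightarrow> b \<le> q z}" using q0 by simp
      show "b \<le> q y" if "b \<in> {b. \<forall>z. z \<in> ob y \<gamma> \<longrightarrow> b \<le> q z}" for b using that by simp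
    qed
    have "finite (d ` ann \<gamma>)"
    proof (rule residue_finite_image[OF ann])
      show "dfnG UNIV (\<lambda>e. d (e 0))"
        unfolding d_def by (intro dfnG_lub dfnU_intros dfn_ob app)
      show "d y = d x" if "y \<in> ob x \<gamma>" for x y unfolding d_def ob_eq[OF that] ..
    qed
    from above_finite[OF this] obtain \<beta> where \<beta>: "\<And>y. y \<in> ann \<gamma> \<Longrightarrow> d y < \<beta>" by blast
    define U where "U = {y. y \<in> ann \<gamma> \<and> \<beta> < q y}"
    have U: "dset U" unfolding U_def by (intro dset_Collect dfnU_intros dfn_mem[OF ann(1)] app)
    have ob_ann: "z \<in> ann \<gamma>" if "y \<in> ann \<gamma>" "z \<in> ob y \<gamma>" for y z
    proof -
      have y: "y \<noteq> 0" "val y = \<gamma>" using that(1) by (auto simp: ann_def)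
      have "y = z \<or> \<gamma> < val (y - z)"
        using that(2) unfolding ob_def val_diff_commute[of y z] by blast
      then show ?thesis using val_diff_eq[of 0 y z] y by (simp add: ann_def)
    qed
    from dset_residue[OF U, of \<gamma> 0] show False
    proof
      assume "few_open \<gamma> (U \<inter> cb 0 \<gamma>)"
      then obtain F where F: "finite F" "U \<inter> cb 0 \<gamma> \<subseteq> (\<Union>a\<in>F. ob a \<gamma>)" by (auto simp: few_open_def)
      have "ann \<gamma> \<subseteq> (\<Union>a\<in>F. ob a \<gamma>)"
      proof
        fix y assume y: "y \<in> ann \<gamma>"
        then have "\<not> (\<forall>z. z \<in> ob y \<gamma> \<longrightarrow> q z \<le> \<beta>)" using allV[OF y] by (auto simp: V_def ann_def)
        then obtain z where z: "z \<in> ob y \<gamma>" "\<beta> < q z" by (auto simp: not_le)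
        then have "z \<in> U \<inter> cb 0 \<gamma>" using ob_ann[OF y z(1)] ann(2) by (auto simp: U_def)
        then obtain a where a: "a \<in> F" "z \<in> ob a \<gamma>" using F(2) by blast
        have "y \<in> ob z \<gamma>" using z(1) by (simp add: ob_sym[of z y])
        then have "y \<in> ob a \<gamma>" using a(2) by (rule ob_trans)
        then show "y \<in> (\<Union>a\<in>F. ob a \<gamma>)" using a(1) by blast
      qed
      then have "few_open \<gamma> (ann \<gamma>)" using F(1) by (auto simp: few_open_def)
      then show False using not_few_open_annulus by (simp add: ann_def)
    next
      assume "few_open \<gamma> (cb 0 \<gamma> - U)"
      then obtain F where F: "finite F" "cb 0 \<gamma> - U \<subseteq> (\<Union>a\<in>F. ob a \<gamma>)" by (auto simp: few_open_def)
      have "\<not> ann \<gamma> \<subseteq> (\<Union>a\<in>F. ob a \<gamma>)"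
        using not_few_open_annulus[of \<gamma>] F(1) by (auto simp: few_open_def ann_def)
      then obtain y where y: "y \<in> ann \<gamma>" "\<And>a. a \<in> F \<Longrightarrow> y \<notin> ob a \<gamma>" by blast
      have "\<beta> \<le> q z" if z: "z \<in> ob y \<gamma>" for z
      proof -
        have "z \<in> cb 0 \<gamma>" using ob_ann[OF y(1) z] ann(2) by blast
        moreover have "z \<notin> ob a \<gamma>" if "a \<in> F" for a
          using ob_trans[of y z \<gamma> a] z ob_sym[of z y] y(2)[OF that] by blast
        ultimately have "z \<in> U" using F(2) by blast
        then show ?thesis by (simp add: U_def less_imp_le)
      qed
      then have "\<beta> \<in> {b. \<forall>z. z \<in> ob y \<gamma> \<longrightarrow> b \<le> q z}" by blast
      then have "\<beta> \<le> d y" using d_lub[of y] unfolding is_lub_def by blast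
      then show False using \<beta>[OF y(1)] by simp
    qed
  qed
  have "\<exists>b. \<forall>x. x \<noteq> 0 \<and> val x = \<gamma> \<longrightarrow> q x \<le> b" if \<gamma>: "\<gamma> < \<gamma>0" for \<gamma>
  proof -
    define d where "d x = lub {\<beta>. \<exists>y. y \<in> ob x \<gamma> \<and> \<beta> = q y}" for x
    have "finite (d ` ann \<gamma>)"
    proof (rule residue_finite_image[OF ann])
      show "dfnG UNIV (\<lambda>e. d (e 0))"
        unfolding d_def by (intro dfnG_lub dfnU_intros dfn_ob app)
      show "d y = d x" if "y \<in> ob x \<gamma>" for x y unfolding d_def ob_eq[OF that] ..
    qed
    from above_finite[OF this] obtain b where b: "\<And>y. y \<in> ann \<gamma> \<Longrightarrow> d y < b" by blast
    have "q x \<le> b" if x: "x \<noteq> 0" "val x = \<gamma>" for x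
    proof -
      have "x \<notin> V" using not_V x \<gamma> by blast
      then obtain b0 where b0: "\<And>y. y \<in> ob x \<gamma> \<Longrightarrow> q y \<le> b0" using x by (auto simp: V_def)
      have "is_lub {\<beta>. \<exists>y. y \<in> ob x \<gamma> \<and> \<beta> = q y} (d x)"
        unfolding d_def
      proof (rule gset_lub)
        show "gset {\<beta>. \<exists>y. y \<in> ob x \<gamma> \<and> \<beta> = q y}"
          by (intro gset_Collect dfnU_intros dfn_ob app)
        show "q x \<in> {\<beta>. \<exists>y. y \<in> ob x \<gamma> \<and> \<beta> = q y}" using ob_refl by blast
        show "\<beta> \<le> b0" if "\<beta> \<in> {\<beta>. \<exists>y. y \<in> ob x \<gamma> \<and> \<beta> = q y}" for \<beta> using that b0 by blast
      qed
      then have "q x \<le> d x" unfolding is_lub_def using ob_refl by blast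
      then show ?thesis using b[of x] x by (simp add: ann_def)
    qed
    then show ?thesis by blast
  qed
  then show ?thesis by blast
qed

section \<open>Slopes at infinity\<close>

lemma eventually_cases:
  assumes "gset {\<gamma>. P \<gamma>}"
  shows "(\<exists>T. \<forall>\<gamma>>T. P \<gamma>) \<or> (\<exists>T. \<forall>\<gamma>>T. \<not> P \<gamma>)"
  using gset_at_top[OF assms] by auto

lemma eventually_conj:
  "(\<exists>T. \<forall>\<gamma>>T. P \<gamma>) \<Longrightarrow> (\<exists>T. \<forall>\<gamma>>T. Q \<gamma>) \<Longrightarrow> \<exists>T::'g. \<forall>\<gamma>>T. P \<gamma> \<and> Q \<gamma>"
proof -
  assume "\<exists>T. \<forall>\<gamma>>T. P \<gamma>" "\<exists>T. \<forall>\<gamma>>T. Q \<gamma>"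
  then obtain S T where "\<forall>\<gamma>>S. P \<gamma>" "\<forall>\<gamma>>T. Q \<gamma>" by blast
  then show ?thesis by (intro exI[of _ "max S T"]) simp
qed

text \<open>The values from \<open>\<gamma>1\<close> on at which \<open>c\<close> is at least
  \<open>c \<gamma>1\<close> are bounded above and closed under adding \<open>t\<close>, but a point
  within \<open>t\<close> of their supremum is moved beyond it. In a non-archimedean group the
  multiples of \<open>t\<close> need not reach the bound, so iterating the step would not
  do.\<close>

lemma no_drift:
  assumes c: "dfnG UNIV (\<lambda>e. c (val (e 0)))" and t: "0 < t"
    and step: "\<exists>T. \<forall>\<gamma>>T. c \<gamma> \<le> c (\<gamma> + t)" and drift: "\<And>b. \<exists>T. \<forall>\<gamma>>T. c \<gamma> < b"
  shows False
proof -
  obtain T where T: "\<And>\<gamma>. T < \<gamma> \<Longrightarrow> c \<gamma> \<le> c (\<gamma> + t)" using step by blast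
  obtain \<gamma>1 where \<gamma>1: "T < \<gamma>1" using gt_ex by blast
  obtain T' where T': "\<And>\<gamma>. T' < \<gamma> \<Longrightarrow> c \<gamma> < c \<gamma>1" using drift by blast
  define A where "A = {\<gamma>. \<gamma>1 \<le> \<gamma> \<and> c \<gamma>1 \<le> c \<gamma>}"
  have "is_lub A (lub A)"
  proof (rule gset_lub)
    show "gset A" unfolding A_def by (intro gset_Collect dfnU_intros dfnG_app1G[OF c])
    show "\<gamma>1 \<in> A" by (simp add: A_def)
    show "\<gamma> \<le> T'" if "\<gamma> \<in> A" for \<gamma>
    proof (rule ccontr)
      assume "\<not> \<gamma> \<le> T'"
      then have "c \<gamma> < c \<gamma>1" using T' by (simp add: not_le)
      then show False using that unfolding A_def by (auto dest: leD)
    qed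
  qed
  then have lub: "\<And>\<beta>. (\<forall>\<alpha>. \<alpha> \<in> A \<longrightarrow> \<alpha> \<le> \<beta>) \<longleftrightarrow> lub A \<le> \<beta>" unfolding is_lub_def by blast
  have "\<not> lub A \<le> lub A - t" using t by simp
  then obtain a where a: "a \<in> A" "lub A - t < a" using lub by (meson not_less)
  have aA: "\<gamma>1 \<le> a" "c \<gamma>1 \<le> c a" using a(1) by (simp_all add: A_def)
  have Ta: "T < a" using \<gamma>1 aA(1) by (rule less_le_trans)
  have "a \<le> a + t" using t by simp
  then have "a + t \<in> A"
    unfolding A_def using order_trans[OF aA(1)] order_trans[OF aA(2) T[OF Ta]] by blast
  then have "a + t \<le> lub A" using lub[of "lub A"] by blast
  then have "a \<le> lub A - t" by (simp add: le_diff_eq)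
  then show False using a(2) by (meson leD)
qed

text \<open>The infimum \<open>d\<close> of the counterexamples is positive. A counterexample below
  \<open>d + d\<close> has its half below \<open>d\<close>, where \<open>Q\<close> holds, and
  doubling contradicts it. Repeated doubling from below \<epsilon> need not reach
  \<open>t\<close>.\<close>

lemma halving:
  assumes "gset {t. Q t}" and \<epsilon>: "0 < \<epsilon>" "\<And>t. 0 < t \<Longrightarrow> t < \<epsilon> \<Longrightarrow> Q t"
    and double: "\<And>u. 0 < u \<Longrightarrow> Q u \<Longrightarrow> Q (u + u)" and "0 < t"
  shows "Q t"
proof (rule ccontr)
  assume "\<not> Q t"
  define B where "B = {t. 0 < t \<and> \<not> Q t}"
  have Q: "dfnG UNIV s \<Longrightarrow> dfn UNIV (\<lambda>e. Q (s e))" for s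
    using dfn_memG[OF assms(1)] by simp
  have B: "gset B" unfolding B_def by (intro gset_Collect dfnU_intros Q)
  have tB: "t \<in> B" using \<open>\<not> Q t\<close> \<open>0 < t\<close> by (simp add: B_def)
  have low: "\<epsilon> \<le> s" if "s \<in> B" for s
  proof (rule ccontr)
    assume "\<not> \<epsilon> \<le> s"
    then have "Q s" using \<epsilon>(2)[of s] that by (simp add: B_def not_le)
    then show False using that by (simp add: B_def)
  qed
  from gset_glb[OF B tB low] obtain d where d: "\<And>\<beta>. (\<forall>\<alpha>. \<alpha> \<in> B \<longrightarrow> \<beta> \<le> \<alpha>) \<longleftrightarrow> \<beta> \<le> d" by blast
  have "\<epsilon> \<le> d" using d[of \<epsilon>] low by blast
  then have "0 < d" by (rule less_le_trans[OF \<epsilon>(1)])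
  then have "\<not> d + d \<le> d" by simp
  then obtain s where s: "s \<in> B" "s < d + d" using d by (meson not_less)
  obtain u where u: "u + u = s" using half by blast
  have "0 < u + u" using s(1) unfolding u B_def by simp
  then have "0 < u" by simp
  moreover have "u < d" using s(2) unfolding u[symmetric] by (meson add_mono not_less)
  then have "u \<notin> B" using d[of d] by (meson not_less order.refl)
  ultimately have "Q (u + u)" using double[of u] by (simp add: B_def)
  then show False using s(1) unfolding u B_def by simp
qed

text \<open>The limit of the increments: by \<open>eventually_cases\<close> every value is
  eventually a lower bound of them or eventually above them. As a supremum it is definable by
  \<open>dfnG_lub\<close>.\<close>

definition slope :: "('g \<Rightarrow> 'g) \<Rightarrow> 'g \<Rightarrow> 'g" where
  "slope k t = lub {s. \<exists>T. \<forall>\<gamma>. T < \<gamma> \<longrightarrow> s \<le> k (\<gamma> + t) - k \<gamma>}"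

context
  fixes k :: "'g \<Rightarrow> 'g" and N :: nat
  assumes k: "dfnG UNIV (\<lambda>e. k (val (e 0)))" and k_nonneg: "\<And>\<gamma>. 0 \<le> k \<gamma>"
    and k_bound: "\<exists>T. \<forall>\<gamma>>T. k \<gamma> < mul N \<gamma>"
begin

lemmas k_app = dfnG_app1G[OF k]

lemma eventually_less_uminus: "\<exists>T. \<forall>\<gamma>>T. - \<gamma> < (b::'g)"
  by (intro exI[of _ "- b"]) (auto simp: minus_less_iff)

lemma increment_upper:
  assumes t: "0 < t" and s: "\<exists>T. \<forall>\<gamma>>T. s \<le> k (\<gamma> + t) - k \<gamma>"
  shows "s \<le> mul (Suc N) t"
proof (rule ccontr)
  assume st: "\<not> s \<le> mul (Suc N) t"
  \<comment> \<open>The extra multiple puts \<open>c \<gamma>\<close> below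
    \<open>- \<gamma>\<close>, so \<open>c\<close> tends to minus infinity.\<close>
  define c where "c \<gamma> = k \<gamma> - mul (Suc N) \<gamma>" for \<gamma>
  show False
  proof (rule no_drift[OF _ t])
    show "dfnG UNIV (\<lambda>e. c (val (e 0)))"
      unfolding c_def by (intro dfnU_intros k_app dfnG_mul)
    obtain T where T: "\<And>\<gamma>. T < \<gamma> \<Longrightarrow> s \<le> k (\<gamma> + t) - k \<gamma>" using s by blast
    have "c \<gamma> \<le> c (\<gamma> + t)" if "T < \<gamma>" for \<gamma>
    proof -
      have "mul (Suc N) t \<le> k (\<gamma> + t) - k \<gamma>" using T[OF that] st by simp
      then show ?thesis unfolding c_def mul_add by (simp add: algebra_simps)
    qed
    then show "\<exists>T. \<forall>\<gamma>>T. c \<gamma> \<le> c (\<gamma> + t)" by blast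
    fix b :: 'g
    from eventually_conj[OF k_bound eventually_less_uminus[of b]]
    obtain T where "\<And>\<gamma>. T < \<gamma> \<Longrightarrow> k \<gamma> < mul N \<gamma> \<and> - \<gamma> < b" by blast
    then have "c \<gamma> < b" if "T < \<gamma>" for \<gamma>
    proof -
      have "c \<gamma> < - \<gamma>" using \<open>\<And>\<gamma>. T < \<gamma> \<Longrightarrow> _\<close>[OF that] by (simp add: c_def algebra_simps)
      then show ?thesis using \<open>\<And>\<gamma>. T < \<gamma> \<Longrightarrow> _\<close>[OF that] by (meson less_trans)
    qed
    then show "\<exists>T. \<forall>\<gamma>>T. c \<gamma> < b" by blast
  qed
qed

text \<open>If the increments stayed below \<open>mul n t\<close>, then
  \<open>mul n \<gamma> - k \<gamma>\<close> would not fall along steps of \<open>t\<close>, yet it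
  is at most \<open>- \<gamma>\<close>; one multiple is spent on this.\<close>

lemma increment_lower:
  assumes t: "0 < t" and n: "\<exists>T. \<forall>\<gamma>>T. mul (Suc n) \<gamma> \<le> k \<gamma>"
  shows "\<exists>T. \<forall>\<gamma>>T. mul n t \<le> k (\<gamma> + t) - k \<gamma>"
proof (rule ccontr)
  assume not: "\<not> ?thesis"
  define c where "c \<gamma> = mul n \<gamma> - k \<gamma>" for \<gamma>
  have "gset {\<gamma>. mul n t \<le> k (\<gamma> + t) - k \<gamma>}" by (intro gset_Collect dfnU_intros k_app)
  from eventually_cases[OF this] not
  obtain T where T: "\<And>\<gamma>. T < \<gamma> \<Longrightarrow> \<not> mul n t \<le> k (\<gamma> + t) - k \<gamma>" by blast
  show False
  proof (rule no_drift[OF _ t])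
    show "dfnG UNIV (\<lambda>e. c (val (e 0)))"
      unfolding c_def by (intro dfnU_intros k_app dfnG_mul)
    have "c \<gamma> \<le> c (\<gamma> + t)" if "T < \<gamma>" for \<gamma>
      using T[OF that] unfolding c_def mul_add by (simp add: algebra_simps)
    then show "\<exists>T. \<forall>\<gamma>>T. c \<gamma> \<le> c (\<gamma> + t)" by blast
    fix b :: 'g
    from eventually_conj[OF n eventually_less_uminus[of b]]
    obtain T where T: "\<And>\<gamma>. T < \<gamma> \<Longrightarrow> mul (Suc n) \<gamma> \<le> k \<gamma> \<and> - \<gamma> < b" by blast
    have "c \<gamma> < b" if "T < \<gamma>" for \<gamma>
    proof -
      have "c \<gamma> \<le> - \<gamma>" using T[OF that] by (simp add: c_def algebra_simps)
      then show ?thesis using T[OF that] by (meson le_less_trans)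
    qed
    then show "\<exists>T. \<forall>\<gamma>>T. c \<gamma> < b" by blast
  qed
qed

text \<open>Provides an element of the set whose supremum is the slope; as \<open>k\<close> is
  nonnegative, it cannot fall steadily.\<close>

lemma increment_ge:
  assumes t: "0 < t"
  shows "\<exists>T. \<forall>\<gamma>>T. - t \<le> k (\<gamma> + t) - k \<gamma>"
proof (rule ccontr)
  assume not: "\<not> ?thesis"
  define c where "c \<gamma> = - \<gamma> - k \<gamma>" for \<gamma>
  have "gset {\<gamma>. - t \<le> k (\<gamma> + t) - k \<gamma>}" by (intro gset_Collect dfnU_intros k_app)
  from eventually_cases[OF this] not
  obtain T where T: "\<And>\<gamma>. T < \<gamma> \<Longrightarrow> \<not> - t \<le> k (\<gamma> + t) - k \<gamma>" by blast
  show False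
  proof (rule no_drift[OF _ t])
    show "dfnG UNIV (\<lambda>e. c (val (e 0)))"
      unfolding c_def by (intro dfnU_intros k_app)
    have "c \<gamma> \<le> c (\<gamma> + t)" if "T < \<gamma>" for \<gamma>
    proof -
      have "k (\<gamma> + t) - k \<gamma> < - t" using T[OF that] by simp
      then show ?thesis unfolding c_def by (simp add: algebra_simps)
    qed
    then show "\<exists>T. \<forall>\<gamma>>T. c \<gamma> \<le> c (\<gamma> + t)" by blast
    fix b :: 'g
    obtain T where T: "\<And>\<gamma>. T < \<gamma> \<Longrightarrow> - \<gamma> < b" using eventually_less_uminus[of b] by auto
    have "c \<gamma> < b" if "T < \<gamma>" for \<gamma>
      using T[OF that] k_nonneg[of \<gamma>] unfolding c_def by (meson diff_le_eq le_add_same_cancel1 le_less_trans)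
    then show "\<exists>T. \<forall>\<gamma>>T. c \<gamma> < b" by blast
  qed
qed

lemma slope_is_lub:
  assumes t: "0 < t"
  shows "is_lub {s. \<exists>T. \<forall>\<gamma>. T < \<gamma> \<longrightarrow> s \<le> k (\<gamma> + t) - k \<gamma>} (slope k t)"
  unfolding slope_def
proof (rule gset_lub)
  show "gset {s. \<exists>T. \<forall>\<gamma>. T < \<gamma> \<longrightarrow> s \<le> k (\<gamma> + t) - k \<gamma>}"
    by (intro gset_Collect dfnU_intros k_app)
  show "- t \<in> {s. \<exists>T. \<forall>\<gamma>. T < \<gamma> \<longrightarrow> s \<le> k (\<gamma> + t) - k \<gamma>}" using increment_ge[OF t] by simp
  show "s \<le> mul (Suc N) t" if "s \<in> {s. \<exists>T. \<forall>\<gamma>. T < \<gamma> \<longrightarrow> s \<le> k (\<gamma> + t) - k \<gamma>}" for s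
    using increment_upper[OF t] that by blast
qed

lemma slope_geI: "0 < t \<Longrightarrow> \<exists>T. \<forall>\<gamma>>T. s \<le> k (\<gamma> + t) - k \<gamma> \<Longrightarrow> s \<le> slope k t"
  using slope_is_lub[of t] unfolding is_lub_def by blast

lemma slope_le: "0 < t \<Longrightarrow> slope k t \<le> mul (Suc N) t"
  using slope_is_lub[of t] increment_upper[of t] unfolding is_lub_def by blast

lemma below_slope:
  assumes "0 < t" "s < slope k t"
  shows "\<exists>T. \<forall>\<gamma>>T. s \<le> k (\<gamma> + t) - k \<gamma>"
proof -
  have "\<not> (\<forall>\<alpha>. \<alpha> \<in> {s. \<exists>T. \<forall>\<gamma>. T < \<gamma> \<longrightarrow> s \<le> k (\<gamma> + t) - k \<gamma>} \<longrightarrow> \<alpha> \<le> s)"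
    using slope_is_lub[OF assms(1)] assms(2) unfolding is_lub_def by (meson not_less)
  then obtain \<alpha> T where "\<And>\<gamma>. T < \<gamma> \<Longrightarrow> \<alpha> \<le> k (\<gamma> + t) - k \<gamma>" "\<not> \<alpha> \<le> s" by blast
  then show ?thesis by (meson le_cases order_trans)
qed

lemma above_slope:
  assumes "0 < t" "slope k t < s"
  shows "\<exists>T. \<forall>\<gamma>>T. k (\<gamma> + t) - k \<gamma> < s"
proof -
  have "gset {\<gamma>. s \<le> k (\<gamma> + t) - k \<gamma>}" by (intro gset_Collect dfnU_intros k_app)
  moreover have "\<not> (\<exists>T. \<forall>\<gamma>>T. s \<le> k (\<gamma> + t) - k \<gamma>)"
    using slope_geI[OF assms(1), of s] assms(2) by (meson not_less)
  ultimately show ?thesis using eventually_cases[of "\<lambda>\<gamma>. s \<le> k (\<gamma> + t) - k \<gamma>"]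
    unfolding not_le by blast
qed

lemma eventually_shift: "\<exists>T. \<forall>\<gamma>>T. P \<gamma> \<Longrightarrow> \<exists>T::'g. \<forall>\<gamma>>T. P (\<gamma> + t)"
proof -
  assume "\<exists>T. \<forall>\<gamma>>T. P \<gamma>"
  then obtain T where "\<forall>\<gamma>>T. P \<gamma>" by blast
  then show ?thesis by (intro exI[of _ "T - t"]) (simp add: diff_less_eq)
qed

text \<open>If the sides differ, density and halving give an \<open>a\<close> with
  \<open>a + a\<close> strictly between them. Two consecutive increments then lie on the same side
  of \<open>a\<close>, and their sum contradicts the slope at \<open>t + t\<close>.\<close>

lemma slope_double:
  assumes t: "0 < t"
  shows "slope k (t + t) = slope k t + slope k t"
proof (rule ccontr)
  assume ne: "slope k (t + t) \<noteq> slope k t + slope k t"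
  have tt: "0 < t + t" using t by simp
  have sum: "k (\<gamma> + (t + t)) - k \<gamma> = (k (\<gamma> + t + t) - k (\<gamma> + t)) + (k (\<gamma> + t) - k \<gamma>)" for \<gamma>
    by (simp add: algebra_simps)
  have ex_d: "\<exists>a::'g. a < x \<and> y < a + a" if "y < x + x" for x y
  proof -
    obtain w where w: "w + w = y" using half by blast
    have "w < x" using that unfolding w[symmetric] by (meson add_mono not_less)
    then obtain a where "w < a" "a < x" using dense by blast
    then show ?thesis using w add_strict_mono by blast
  qed
  have ex_u: "\<exists>a::'g. x < a \<and> a + a < y" if "x + x < y" for x y
  proof -
    obtain w where w: "w + w = y" using half by blast
    have "x < w" using that unfolding w[symmetric] by (meson add_mono not_less)
    then obtain a where "x < a" "a < w" using dense by blast
    then show ?thesis using w add_strict_mono by blast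
  qed
  from ne consider "slope k (t + t) < slope k t + slope k t" | "slope k t + slope k t < slope k (t + t)"
    by (meson linorder_neqE)
  then show False
  proof cases
    case 1
    obtain a where a: "a < slope k t" "slope k (t + t) < a + a" using ex_d[OF 1] by blast
    note ev = below_slope[OF t a(1)]
    obtain T where T: "\<And>\<gamma>. T < \<gamma> \<Longrightarrow> a \<le> k (\<gamma> + t) - k \<gamma> \<and> a \<le> k (\<gamma> + t + t) - k (\<gamma> + t)"
      using eventually_conj[OF ev eventually_shift[OF ev, of t]] by blast
    have "a + a \<le> k (\<gamma> + (t + t)) - k \<gamma>" if "T < \<gamma>" for \<gamma>
      unfolding sum using T[OF that] by (intro add_mono) auto
    then have "a + a \<le> slope k (t + t)" by (intro slope_geI[OF tt]) blast
    then show False using a(2) by simp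
  next
    case 2
    obtain a where a: "slope k t < a" "a + a < slope k (t + t)" using ex_u[OF 2] by blast
    note ev = above_slope[OF t a(1)]
    obtain T where T: "\<And>\<gamma>. T < \<gamma> \<Longrightarrow> k (\<gamma> + t) - k \<gamma> < a \<and> k (\<gamma> + t + t) - k (\<gamma> + t) < a"
      using eventually_conj[OF ev eventually_shift[OF ev, of t]] by blast
    obtain T' where T': "\<And>\<gamma>. T' < \<gamma> \<Longrightarrow> a + a \<le> k (\<gamma> + (t + t)) - k \<gamma>" using below_slope[OF tt a(2)] by blast
    obtain \<gamma> where "max T T' < \<gamma>" using gt_ex by blast
    then have \<gamma>: "T < \<gamma>" "T' < \<gamma>" by simp_all
    have "k (\<gamma> + (t + t)) - k \<gamma> < a + a"
      unfolding sum using T[OF \<gamma>(1)] by (intro add_strict_mono) simp_all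
    then show False using T'[OF \<gamma>(2)] by (meson leD)
  qed
qed

text \<open>Close to 0 the comparison with \<open>mul n\<close> has a constant outcome, which
  \<open>halving\<close> spreads to all positive values; the outcome below would contradict the
  strict inequality at \<open>t0\<close>.\<close>

lemma slope_sign:
  assumes t0: "0 < t0" "mul n t0 < slope k t0" and t: "0 < t"
  shows "mul n t \<le> slope k t"
proof -
  have "dfnG UNIV (\<lambda>e. slope k (val (e 0)))"
    unfolding slope_def by (intro dfnG_lub dfnU_intros k_app)
  note d = dfnG_app1G[OF this]
  have g: "gset {t. mul n t \<le> slope k t}" "gset {t. slope k t < mul n t}"
    by (intro gset_Collect dfnU_intros d dfnG_mul)+
  from gset_right[OF g(1), of 0] obtain \<epsilon> where \<epsilon>: "0 < \<epsilon>"
    "(\<forall>\<gamma>. 0 < \<gamma> \<and> \<gamma> < \<epsilon> \<longrightarrow> mul n \<gamma> \<le> slope k \<gamma>) \<or> (\<forall>\<gamma>. 0 < \<gamma> \<and> \<gamma> < \<epsilon> \<longrightarrow> \<not> mul n \<gamma> \<le> slope k \<gamma>)"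
    by auto
  from \<epsilon>(2) show ?thesis
  proof
    assume *: "\<forall>\<gamma>. 0 < \<gamma> \<and> \<gamma> < \<epsilon> \<longrightarrow> mul n \<gamma> \<le> slope k \<gamma>"
    show ?thesis
    proof (rule halving[OF g(1) \<epsilon>(1) _ _ t])
      show "mul n (u + u) \<le> slope k (u + u)" if "0 < u" "mul n u \<le> slope k u" for u
        using that slope_double[OF that(1)] by (simp add: mul_add add_mono)
    qed (use * in blast)
  next
    assume *: "\<forall>\<gamma>. 0 < \<gamma> \<and> \<gamma> < \<epsilon> \<longrightarrow> \<not> mul n \<gamma> \<le> slope k \<gamma>"
    have "slope k t0 < mul n t0"
    proof (rule halving[OF g(2) \<epsilon>(1) _ _ t0(1)])
      show "slope k (u + u) < mul n (u + u)" if "0 < u" "slope k u < mul n u" for u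
        using that slope_double[OF that(1)] by (simp add: mul_add add_strict_mono)
      show "slope k t < mul n t" if "0 < t" "t < \<epsilon>" for t
        using * that by (meson not_less)
    qed
    then show ?thesis using t0(2) by simp
  qed
qed

text \<open>One multiple is lost in \<open>increment_lower\<close>; the other makes the resulting
  lower bound of the slope exceed \<open>mul n t0\<close>.\<close>

lemma bound_of_slope:
  assumes t0: "0 < t0" and n: "slope k t0 \<le> mul n t0"
  shows "\<exists>T. \<forall>\<gamma>>T. k \<gamma> < mul (Suc (Suc n)) \<gamma>"
proof (rule ccontr)
  assume not: "\<not> ?thesis"
  have "gset {\<gamma>. mul (Suc (Suc n)) \<gamma> \<le> k \<gamma>}" by (intro gset_Collect dfnU_intros k_app dfnG_mul)
  from eventually_cases[OF this] not have "\<exists>T. \<forall>\<gamma>>T. mul (Suc (Suc n)) \<gamma> \<le> k \<gamma>" by (auto simp: not_le)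
  from slope_geI[OF t0 increment_lower[OF t0 this]] have "mul (Suc n) t0 \<le> slope k t0" .
  then have "mul n t0 + t0 \<le> mul n t0" using n unfolding mul_Suc by (rule order_trans)
  then show False using t0 by (simp add: not_le[symmetric])
qed

end

lemma lub_nonneg: "0 \<in> S \<Longrightarrow> 0 \<le> lub (S :: 'g set)"
  unfolding lub_def using is_lub_unique
  by (smt (verit) is_lub_def order.refl the_equality)

section \<open>Uniformity\<close>

text \<open>
  If the slopes at \<open>t0\<close> are unbounded in the value group, the infimum \<open>F s\<close> of the values at \<open>s\<close> of
  those slopes which are at least \<open>s\<close> at \<open>t0\<close> grows faster than every linear function.
\<close>

lemma uniform_slope:
  fixes \<K> :: "('g \<Rightarrow> 'g) set"
  assumes lin: "Q_linearly_bounded (L_ind L M v) (Gamma_ind :: ('g, unit, 'g list set) struct)"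
    and t0: "0 < t0"
    and k: "\<And>k. k \<in> \<K> \<Longrightarrow> dfnG UNIV (\<lambda>e. k (val (e 0)))" "\<And>k \<gamma>. k \<in> \<K> \<Longrightarrow> 0 \<le> k \<gamma>"
    and S: "gset {s. \<exists>k\<in>\<K>. s = slope k t0}"
    and R: "dfn UNIV (\<lambda>e. \<forall>k\<in>\<K>. val (e 1) \<le> slope k t0 \<longrightarrow> val (e 0) \<le> slope k (val (e 1)))"
  shows "\<exists>N. \<forall>k\<in>\<K>. slope k t0 \<le> mul N t0"
proof (cases "\<K> = {}")
  case False
  then obtain k0 where k0: "k0 \<in> \<K>" by blast
  note bound = linear_bound[OF lin k(1)]
  show ?thesis
  proof (cases "\<forall>s. \<exists>k\<in>\<K>. s \<le> slope k t0")
    case True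
    define B where "B s = {b. \<forall>k\<in>\<K>. s \<le> slope k t0 \<longrightarrow> b \<le> slope k s}" for s
    define F where "F s = lub (B s)" for s
    have dB: "dfn UNIV (\<lambda>e. t e \<in> B (s e))" if "dfnG UNIV s" "dfnG UNIV t" for s t
    proof -
      have "dfn UNIV (\<lambda>e. val (e i) \<in> B (val (e j)))" for i j
        using dfn_rename[OF R, of "case_nat i (\<lambda>_. j)"] by (simp add: B_def)
      from dfn_binrelG[of UNIV "\<lambda>t s. t \<in> B s", OF this that(2,1)] show ?thesis .
    qed
    have "dfnG UNIV (\<lambda>e. F (val (e 0)))"
    proof -
      have "dfnG UNIV (\<lambda>e. lub {b. b \<in> B (val (e 0))})" by (intro dfnG_lub dB dfnG_val_var)
      then show ?thesis by (simp add: F_def)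
    qed
    from linear_bound[OF lin this] obtain n T where nT: "\<And>\<gamma>. T < \<gamma> \<Longrightarrow> F \<gamma> < mul n \<gamma>" by blast
    \<comment> \<open>Beyond \<open>T\<close> the function \<open>F\<close> is below
      \<open>mul n\<close>, while \<open>mul n t0 < s\<close> lets \<open>slope_sign\<close> apply
      to every \<open>k\<close> that enters \<open>F s\<close>.\<close>
    obtain s where s: "max 0 (max T (mul n t0)) < s" using gt_ex by blast
    then have "0 < s" "T < s" "mul n t0 < s" by simp_all
    have ge: "mul n s \<le> slope k s" if kK: "k \<in> \<K>" and sk: "s \<le> slope k t0" for k
    proof -
      obtain N where N: "\<exists>T. \<forall>\<gamma>>T. k \<gamma> < mul N \<gamma>" using bound[OF kK] by blast
      have "mul n t0 < slope k t0" using \<open>mul n t0 < s\<close> sk by (rule less_le_trans)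
      then show ?thesis
        by (rule slope_sign[OF k(1)[OF kK] k(2)[OF kK] N t0]) (rule \<open>0 < s\<close>)
    qed
    then have mem: "mul n s \<in> B s" by (simp add: B_def)
    obtain k1 where k1: "k1 \<in> \<K>" "s \<le> slope k1 t0" using True by blast
    have "is_lub (B s) (F s)"
      unfolding F_def
    proof (rule gset_lub[OF _ mem])
      show "gset (B s)" unfolding gset_def by (intro dB dfnG_const dfnG_val_var)
      show "b \<le> slope k1 s" if "b \<in> B s" for b using that k1 by (simp add: B_def)
    qed
    then have "mul n s \<le> F s" unfolding is_lub_def using mem by blast
    then show ?thesis using nT[OF \<open>T < s\<close>] by (meson leD)
  next
    case bounded: False
    then obtain b where "\<And>k. k \<in> \<K> \<Longrightarrow> \<not> b \<le> slope k t0" by blast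
    then have b: "\<And>s. s \<in> {s. \<exists>k\<in>\<K>. s = slope k t0} \<Longrightarrow> s \<le> b" by (force simp: not_le)
    have "slope k0 t0 \<in> {s. \<exists>k\<in>\<K>. s = slope k t0}" using k0 by blast
    from gset_lub[OF S this b] obtain \<sigma> where "is_lub {s. \<exists>k\<in>\<K>. s = slope k t0} \<sigma>" by blast
    then have \<sigma>: "(\<forall>k\<in>\<K>. slope k t0 \<le> \<beta>) \<longleftrightarrow> \<sigma> \<le> \<beta>" for \<beta> unfolding is_lub_def by blast
    \<comment> \<open>A bound in the group is not yet a multiple of \<open>t0\<close>. A slope
      within \<open>t0\<close> of the supremum yields one, as each single slope is at most a
      multiple of \<open>t0\<close>.\<close>
    have "\<not> \<sigma> \<le> \<sigma> - t0" using t0 by (simp add: not_le)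
    then obtain k1 where k1: "k1 \<in> \<K>" "\<sigma> - t0 < slope k1 t0" using \<sigma> by (meson not_less)
    obtain N where N: "\<exists>T. \<forall>\<gamma>>T. k1 \<gamma> < mul N \<gamma>" using bound[OF k1(1)] by blast
    have "slope k1 t0 \<le> mul (Suc N) t0" by (rule slope_le[OF k(1)[OF k1(1)] k(2)[OF k1(1)] N t0])
    then have "\<sigma> - t0 \<le> mul (Suc N) t0" using k1(2) by (meson less_imp_le order_trans)
    then have "\<sigma> \<le> mul (Suc (Suc N)) t0" by (simp add: diff_le_eq)
    then show ?thesis using \<sigma> by blast
  qed
qed simp

text \<open>The parameters form a tuple of arbitrary length, so a block of entries is quantified at
  once; the values of \<open>f\<close> from \<open>n\<close> on are ignored.\<close>

lemma dfn_exs: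
  assumes "dfn A P"
  shows "dfn A (\<lambda>e. \<exists>f. P (\<lambda>i. if i < n then f i else e (i - n)))"
proof (induction n)
  case 0
  then show ?case using assms by simp
next
  case (Suc n)
  define Q where "Q e \<longleftrightarrow> (\<exists>f. P (\<lambda>i. if i < n then f i else e (i - n)))" for e
  have shift: "(\<lambda>i. if i < n then f i else case_nat x e (i - n)) =
    (\<lambda>i. if i < Suc n then (f(n := x)) i else e (i - Suc n))" for f x and e :: "nat \<Rightarrow> 'k"
  proof
    fix i
    consider "i < n" | "i = n" | j where "i = Suc (n + j)"
      by (metis less_iff_Suc_add linorder_neqE_nat)
    then show "(if i < n then f i else case_nat x e (i - n)) =
      (if i < Suc n then (f(n := x)) i else e (i - Suc n))"
      by cases (auto simp: Suc_diff_le)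
  qed
  have "(\<exists>f. P (\<lambda>i. if i < Suc n then f i else e (i - Suc n))) \<longleftrightarrow> (\<exists>x. Q (case_nat x e))" for e
  proof
    assume "\<exists>f. P (\<lambda>i. if i < Suc n then f i else e (i - Suc n))"
    then obtain f where f: "P (\<lambda>i. if i < Suc n then f i else e (i - Suc n))" ..
    have "P (\<lambda>i. if i < n then f i else case_nat (f n) e (i - n))"
      unfolding shift fun_upd_triv by (rule f)
    then show "\<exists>x. Q (case_nat x e)" unfolding Q_def by (intro exI)
  next
    assume "\<exists>x. Q (case_nat x e)"
    then show "\<exists>f. P (\<lambda>i. if i < Suc n then f i else e (i - Suc n))"
      unfolding Q_def shift by (elim exE) (rule exI)
  qed
  moreover have "dfn A (\<lambda>e. \<exists>x. Q (case_nat x e))"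
  proof (rule dfn_ex)
    have "case_nat (e 0) (\<lambda>i. e (Suc i)) = e" for e :: "nat \<Rightarrow> 'k"
      by (rule ext) (simp split: nat.split)
    then have "(\<lambda>e. Q (case_nat (e 0) (\<lambda>i. e (Suc i)))) = (\<lambda>e. Q e)" by (simp only:)
    moreover have "dfn A (\<lambda>e. Q e)" unfolding Q_def by (rule Suc.IH)
    ultimately show "dfn A (\<lambda>e. Q (case_nat (e 0) (\<lambda>i. e (Suc i))))" by (simp only:)
  qed
  ultimately show ?case by simp
qed

text \<open>The first \<open>n\<close> entries range over all of \<open>K\<close>, not only over
  parameters of the family, which is possible as \<open>h\<close> is total and nonnegative; the
  others are the fixed constants of the definition.\<close>

lemma uniform_bound:
  assumes lin: "Q_linearly_bounded (L_ind L M v) (Gamma_ind :: ('g, unit, 'g list set) struct)"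
    and h: "gfam {} h" and nonneg: "\<And>e \<gamma>. 0 \<le> h e \<gamma>"
  shows "\<exists>N. \<forall>e. (\<forall>i\<ge>n. e i = e0 i) \<longrightarrow> (\<exists>T. \<forall>\<gamma>>T. h e \<gamma> < mul N \<gamma>)"
proof -
  obtain t0 :: 'g where t0: "0 < t0" using ex_pos by blast
  define put where "put f = (\<lambda>i. if i < n then f i else e0 i)" for f :: "nat \<Rightarrow> 'k"
  define \<K> where "\<K> = {h (put f) |f. True}"
  have slope: "gfam {} (\<lambda>e. slope (h e))"
    unfolding gfam_def slope_def by (intro dfnG_lub dfn_intros gfam_app[OF h])
  have put: "dfnG UNIV (\<lambda>e. slope (h (put e)) (t e))" if "dfnG UNIV t" for t
  proof -
    have "var_or_const UNIV (\<lambda>e. if i < n then e i else e0 i)" for i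
      by (cases "i < n") (simp_all add: var_or_const_var var_or_const_const)
    from gfam_subst[where \<tau> = "\<lambda>i e. if i < n then e i else e0 i", OF slope this _ that]
    show ?thesis by (simp add: put_def)
  qed
  have put_if: "put (\<lambda>i. if i < n then f i else e (i - n)) = put f" for f e
    by (auto simp: put_def)
  have k: "dfnG UNIV (\<lambda>e. k (val (e 0)))" "0 \<le> k \<gamma>" if "k \<in> \<K>" for k \<gamma>
    using that nonneg gfam_const[OF h dfnG_val_var] by (auto simp: \<K>_def)
  have "dfn UNIV (\<lambda>e. val (e n) = slope (h (put e)) t0)"
    by (intro dfnU_intros put)
  from dfn_exs[OF this, of n] have "dfn UNIV (\<lambda>e. \<exists>f. val (e 0) = slope (h (put f)) t0)"
    unfolding put_if by simp
  moreover have "(\<exists>k\<in>\<K>. s = slope k t0) \<longleftrightarrow> (\<exists>f. s = slope (h (put f)) t0)" for s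
    by (auto simp: \<K>_def)
  ultimately have S: "gset {s. \<exists>k\<in>\<K>. s = slope k t0}" by (simp add: gset_def)
  have "dfn UNIV (\<lambda>e. \<not> (val (e (Suc n)) \<le> slope (h (put e)) t0 \<longrightarrow>
      val (e n) \<le> slope (h (put e)) (val (e (Suc n)))))"
    by (intro dfnU_intros put)
  from dfn_neg[OF dfn_exs[OF this, of n]]
  have "dfn UNIV (\<lambda>e. \<forall>f. val (e 1) \<le> slope (h (put f)) t0 \<longrightarrow> val (e 0) \<le> slope (h (put f)) (val (e 1)))"
    unfolding put_if by simp
  moreover have "(\<forall>k\<in>\<K>. s \<le> slope k t0 \<longrightarrow> b \<le> slope k s) \<longleftrightarrow>
    (\<forall>f. s \<le> slope (h (put f)) t0 \<longrightarrow> b \<le> slope (h (put f)) s)" for s b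
    by (auto simp: \<K>_def)
  ultimately have R: "dfn UNIV (\<lambda>e. \<forall>k\<in>\<K>. val (e 1) \<le> slope k t0 \<longrightarrow> val (e 0) \<le> slope k (val (e 1)))"
    by simp
  have "\<exists>N. \<forall>k\<in>\<K>. slope k t0 \<le> mul N t0"
    by (rule uniform_slope) (fact lin t0 k S R)+
  then obtain N where N: "\<And>k. k \<in> \<K> \<Longrightarrow> slope k t0 \<le> mul N t0" by blast
  have "\<exists>T. \<forall>\<gamma>>T. h e \<gamma> < mul (Suc (Suc N)) \<gamma>" if e: "\<forall>i\<ge>n. e i = e0 i" for e
  proof -
    have "put e = e" using e by (auto simp: put_def)
    then have hk: "h e \<in> \<K>" unfolding \<K>_def by (metis (mono_tags) mem_Collect_eq)
    obtain N' where N': "\<exists>T. \<forall>\<gamma>>T. h e \<gamma> < mul N' \<gamma>" using linear_bound[OF lin k(1)[OF hk]] by blast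
    show ?thesis by (rule bound_of_slope[OF k(1)[OF hk] k(2)[OF hk] N' t0 N[OF hk]])
  qed
  then show ?thesis by blast
qed

section \<open>Polynomial boundedness\<close>

context
  fixes p :: "('f vf_fun, 'r vf_rel) fm" and m :: nat
  assumes wf: "wf_fm L p"
begin

text \<open>The formula \<open>p\<close> describes the graph of the family: variables \<open>m\<close> and \<open>m + 1\<close> stand for the
  argument and the value, the others for the parameters.\<close>

definition graph :: "(nat \<Rightarrow> 'k) \<Rightarrow> 'k \<Rightarrow> 'k \<Rightarrow> bool" where
  "graph e x y \<longleftrightarrow>
     sat M (\<lambda>i. if i < m then e i else if i = m then x else if i = Suc m then y else e (i - 2)) p"

text \<open>The element 0 makes the result nonnegative and provides a value where the function is
  undefined or zero.\<close>

definition neg_val :: "(nat \<Rightarrow> 'k) \<Rightarrow> 'k \<Rightarrow> 'g" where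
  "neg_val e x = lub {\<beta>. \<beta> = 0 \<or> (\<exists>y. graph e x y \<and> y \<noteq> 0 \<and> \<beta> = - val y)}"

text \<open>The default 0 is taken where no supremum exists; for fixed \<open>e\<close> and large
  \<gamma> this does not happen, by \<open>bounded_on_annuli\<close>.\<close>

definition growth :: "(nat \<Rightarrow> 'k) \<Rightarrow> 'g \<Rightarrow> 'g" where
  "growth e \<gamma> = lub {\<beta>. \<beta> = 0 \<or> (\<exists>x. x \<noteq> 0 \<and> val x = - \<gamma> \<and> \<beta> = neg_val e x)}"

lemma dfn_graph: "dfn A (\<lambda>e. graph (\<lambda>l. e (\<rho> l)) (e i) (e j))"
proof -
  have "(\<lambda>n. if n < m then e (\<rho> n) else if n = m then e i else if n = Suc m then e j else e (\<rho> (n - 2)))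
    = (\<lambda>n. e (if n < m then \<rho> n else if n = m then i else if n = Suc m then j else \<rho> (n - 2)))"
    for e :: "nat \<Rightarrow> 'k" by auto
  then show ?thesis unfolding graph_def by (simp only:) (rule dfn_sat_var[OF wf])
qed

lemma dfn_graph_const: "dfn UNIV (\<lambda>e'. graph e (e' i) (e' j))"
proof -
  have "dfn UNIV (\<lambda>e'. sat M (\<lambda>n. (if n < m then (\<lambda>_. e n) else if n = m then (\<lambda>e'. e' i)
    else if n = Suc m then (\<lambda>e'. e' j) else (\<lambda>_. e (n - 2))) e') p)"
    by (rule dfn_sat[OF wf]) (simp add: var_or_const_var var_or_const_const)
  moreover have "(\<lambda>n. (if n < m then (\<lambda>_. e n) else if n = m then (\<lambda>e'. e' i)
    else if n = Suc m then (\<lambda>e'. e' j) else (\<lambda>_. e (n - 2))) e') =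
    (\<lambda>n. if n < m then e n else if n = m then e' i else if n = Suc m then e' j else e (n - 2))"
    for e' :: "nat \<Rightarrow> 'k" by auto
  ultimately show ?thesis unfolding graph_def by simp
qed

lemma dfnG_neg_val: "dfnG A (\<lambda>e. neg_val (\<lambda>l. e (\<rho> l)) (e i))"
  unfolding neg_val_def by (intro dfnG_lub dfn_intros dfn_graph)

lemma gfam_growth: "gfam {} growth"
  unfolding gfam_def growth_def by (intro dfnG_lub dfn_intros dfnG_neg_val)

lemma neg_val_nonneg: "0 \<le> neg_val e x"
  unfolding neg_val_def by (rule lub_nonneg) simp

lemma growth_nonneg: "0 \<le> growth e \<gamma>"
  unfolding growth_def by (rule lub_nonneg) simp

lemma growth_bound:
  assumes functional: "\<And>x y y'. graph e x y \<Longrightarrow> graph e x y' \<Longrightarrow> y = y'"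
  shows "\<exists>T. \<forall>\<gamma>>T. \<forall>x y. x \<noteq> 0 \<and> val x = - \<gamma> \<and> graph e x y \<and> y \<noteq> 0 \<longrightarrow> - val y \<le> growth e \<gamma>"
proof -
  have d: "dfnG UNIV (\<lambda>e'. neg_val e (e' i))" for i
    unfolding neg_val_def by (intro dfnG_lub dfnU_intros dfn_graph_const)
  obtain \<gamma>0 where \<gamma>0: "\<And>\<gamma>. \<gamma> < \<gamma>0 \<Longrightarrow> \<exists>b. \<forall>x. x \<noteq> 0 \<and> val x = \<gamma> \<longrightarrow> neg_val e x \<le> b"
    using bounded_on_annuli[OF d neg_val_nonneg] by blast
  have "- val y \<le> growth e \<gamma>"
    if \<gamma>: "- \<gamma>0 < \<gamma>" and x: "x \<noteq> 0" "val x = - \<gamma>" and y: "graph e x y" "y \<noteq> 0" for \<gamma> x y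
  proof -
    have "{\<beta>. \<beta> = 0 \<or> (\<exists>y. graph e x y \<and> y \<noteq> 0 \<and> \<beta> = - val y)} \<subseteq> {0, - val y}"
      using functional[OF y(1)] by auto
    then have "finite {\<beta>. \<beta> = 0 \<or> (\<exists>y. graph e x y \<and> y \<noteq> 0 \<and> \<beta> = - val y)}"
      using finite_subset by blast
    then have 1: "- val y \<le> neg_val e x"
      unfolding neg_val_def by (rule lub_le_finite) (use y in blast)
    have "- \<gamma> < \<gamma>0" using \<gamma> by (simp add: minus_less_iff)
    then obtain b where b: "\<And>x. x \<noteq> 0 \<Longrightarrow> val x = - \<gamma> \<Longrightarrow> neg_val e x \<le> b" using \<gamma>0 by blast
    define S where "S = {\<beta>. \<beta> = 0 \<or> (\<exists>x. x \<noteq> 0 \<and> val x = - \<gamma> \<and> \<beta> = neg_val e x)}"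
    have "is_lub S (lub S)"
    proof (rule gset_lub)
      show "gset S" unfolding S_def by (intro gset_Collect dfnU_intros d)
      show "0 \<in> S" by (simp add: S_def)
      show "s \<le> max 0 b" if "s \<in> S" for s using that b by (auto simp: S_def le_max_iff_disj)
    qed
    moreover have "neg_val e x \<in> S" using x by (auto simp: S_def)
    ultimately have "neg_val e x \<le> growth e \<gamma>" unfolding growth_def S_def[symmetric] is_lub_def by blast
    with 1 show ?thesis by (rule order_trans)
  qed
  then show ?thesis by blast
qed

definition threshold :: "nat \<Rightarrow> (nat \<Rightarrow> 'k) \<Rightarrow> 'g" where
  "threshold N e =
     lub {\<alpha>. \<forall>x y. graph e x y \<and> x \<noteq> 0 \<and> val x < \<alpha> \<and> y \<noteq> 0 \<longrightarrow> mul N (val x) < val y}"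

lemma dfnG_threshold: "dfnG A (\<lambda>e. threshold N (\<lambda>l. e (\<rho> l)))"
  unfolding threshold_def by (intro dfnG_lub dfn_intros dfn_graph dfnG_mul)

lemma threshold_bound:
  assumes functional: "\<And>x y y'. graph e x y \<Longrightarrow> graph e x y' \<Longrightarrow> y = y'"
    and growth: "\<exists>T. \<forall>\<gamma>>T. growth e \<gamma> < mul N \<gamma>"
    and xy: "graph e x y" "x \<noteq> 0" "val x < threshold N e" "y \<noteq> 0"
  shows "mul N (val x) < val y"
proof -
  define S where "S = {\<alpha>. \<forall>x y. graph e x y \<and> x \<noteq> 0 \<and> val x < \<alpha> \<and> y \<noteq> 0 \<longrightarrow> mul N (val x) < val y}"
  have S: "gset S" unfolding S_def by (intro gset_Collect dfnU_intros dfn_graph_const dfnG_mul)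
  obtain T1 where T1: "\<And>\<gamma>. T1 < \<gamma> \<Longrightarrow> growth e \<gamma> < mul N \<gamma>" using growth by blast
  have "\<exists>T. \<forall>\<gamma>>T. \<forall>x y. x \<noteq> 0 \<and> val x = - \<gamma> \<and> graph e x y \<and> y \<noteq> 0 \<longrightarrow> - val y \<le> growth e \<gamma>"
    by (rule growth_bound) (rule functional)
  then obtain T2 where T2: "\<And>\<gamma> x y. T2 < \<gamma> \<Longrightarrow> x \<noteq> 0 \<Longrightarrow> val x = - \<gamma> \<Longrightarrow> graph e x y \<Longrightarrow> y \<noteq> 0 \<Longrightarrow>
    - val y \<le> growth e \<gamma>"
    by blast
  define T where "T = max T1 T2"
  have ne: "- T \<in> S"
    unfolding S_def
  proof (intro CollectI allI impI)
    fix x y assume *: "graph e x y \<and> x \<noteq> 0 \<and> val x < - T \<and> y \<noteq> 0"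
    then have "T < - val x" by (simp add: less_minus_iff)
    then have "T1 < - val x" "T2 < - val x" by (simp_all add: T_def)
    then have "- val y < mul N (- val x)"
      using T1[of "- val x"] T2[of "- val x" x y] * by (auto intro: le_less_trans)
    then show "mul N (val x) < val y" by (simp add: mul_minus)
  qed
  \<comment> \<open>If \<open>S\<close> is bounded, \<open>threshold\<close> is its true supremum.
    If not, \<open>threshold\<close> has the default value, which does no harm since
    \<open>S\<close> then exceeds every value.\<close>
  have "\<exists>\<alpha>\<in>S. val x < \<alpha>"
  proof (rule ccontr)
    assume no: "\<not> ?thesis"
    then have "\<And>s. s \<in> S \<Longrightarrow> s \<le> val x" by (simp add: not_less)
    from gset_lub[OF S ne this] have "lub S \<le> val x"
      using no unfolding is_lub_def by (meson not_less)
    then show False using xy(3) unfolding threshold_def S_def[symmetric] by (meson leD)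
  qed
  then show ?thesis using xy by (auto simp: S_def)
qed

end

theorem polynomially_bounded:
  assumes lin: "Q_linearly_bounded (L_ind L M v) (Gamma_ind :: ('g, unit, 'g list set) struct)"
  shows "uniformly_polynomially_bounded L M v"
  unfolding uniformly_polynomially_bounded_def
proof (intro allI impI)
  fix m k :: nat and W :: "('k list \<times> 'g list) set" and X f
  assume fam: "definable_function_family L M v m k W X f"
  then have W: "fst ` X = W" and lenW: "\<And>xs gs. (xs, gs) \<in> W \<Longrightarrow> length xs = m \<and> length gs = k"
    by (auto simp: definable_function_family_def definable_family_def interpretable_def)
  define G where "G = {(xs @ [x, f (xs, gs) x], gs) |xs gs x. ((xs, gs), x) \<in> X}"
  have "definable L M (m + 2 + k) (pullback v G)"
    using fam by (simp add: definable_function_family_def interpretable_def G_def)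
  then obtain p par where wf: "wf_fm L p" and p: "pullback v G = solutions M (m + 2 + k) par p"
    by (auto simp: definable_def)
  define n where "n = m + k"
  \<comment> \<open>The places of argument and function value are dropped from the environment,
    which shifts the constants by two.\<close>
  define e0 where "e0 i = par (i + 2)" for i
  define gra where "gra = graph p m"
  have len: "length ys = length gs" if "map v ys = map Fin gs" for ys gs
    using that by (metis length_map)
  have Fin_inj: "gs = gs'" if "map Fin gs = map Fin gs'" for gs gs' :: "'g list"
    using that by (simp add: inj_def map_injective)
  have graph_iff: "gra (assign (xs @ ys) e0) x y \<longleftrightarrow>
      (\<exists>gs. map v ys = map Fin gs \<and> ((xs, gs), x) \<in> X \<and> y = f (xs, gs) x)"
    if l: "length xs = m" "length ys = k" for xs ys x y
  proof -
    have "(\<lambda>i. if i < m then assign (xs @ ys) e0 i else if i = m then x else if i = Suc m then y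
        else assign (xs @ ys) e0 (i - 2)) = assign (xs @ [x, y] @ ys) par"
    proof
      fix i
      consider "i < m" | "i = m" | "i = Suc m" | j where "i = m + 2 + j"
        by (metis add_2_eq_Suc' less_iff_Suc_add linorder_neqE_nat add_Suc_right add_Suc less_SucE not_less_eq)
      then show "(if i < m then assign (xs @ ys) e0 i else if i = m then x else if i = Suc m then y
        else assign (xs @ ys) e0 (i - 2)) = assign (xs @ [x, y] @ ys) par i"
        by cases (auto simp: assign_def nth_append l e0_def)
    qed
    then have "gra (assign (xs @ ys) e0) x y \<longleftrightarrow> xs @ [x, y] @ ys \<in> pullback v G"
      unfolding gra_def graph_def[OF wf] p solutions_def by (simp add: l)
    also have "\<dots> \<longleftrightarrow> (\<exists>gs. map v ys = map Fin gs \<and> ((xs, gs), x) \<in> X \<and> y = f (xs, gs) x)"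
    proof
      assume "xs @ [x, y] @ ys \<in> pullback v G"
      then obtain xs' x' gs ys' where eq: "xs @ [x, y] @ ys = (xs' @ [x', f (xs', gs) x']) @ ys'"
        and X': "((xs', gs), x') \<in> X" "map v ys' = map Fin gs"
        unfolding pullback_def G_def by blast
      have "(xs', gs) \<in> W" using X'(1) W by force
      then have "length xs' = length xs" using lenW l by auto
      then have "xs = xs'" "x = x'" "y = f (xs', gs) x'" "ys = ys'" using eq by auto
      then show "\<exists>gs. map v ys = map Fin gs \<and> ((xs, gs), x) \<in> X \<and> y = f (xs, gs) x" using X' by blast
    next
      assume "\<exists>gs. map v ys = map Fin gs \<and> ((xs, gs), x) \<in> X \<and> y = f (xs, gs) x"
      then obtain gs where gs: "map v ys = map Fin gs" "((xs, gs), x) \<in> X" "y = f (xs, gs) x" by blast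
      then have "(xs @ [x, y], gs) \<in> G" unfolding G_def by blast
      moreover have "xs @ [x, y] @ ys = (xs @ [x, y]) @ ys" by simp
      ultimately show "xs @ [x, y] @ ys \<in> pullback v G" unfolding pullback_def using gs(1) by blast
    qed
    finally show ?thesis .
  qed
  have graph_gs: "gra (assign (xs @ ys) e0) x y \<longleftrightarrow> ((xs, gs), x) \<in> X \<and> y = f (xs, gs) x"
    if "length xs = m" "length ys = k" "map v ys = map Fin gs" for xs ys gs x y
    unfolding graph_iff[OF that(1,2)] using that(3) Fin_inj by metis
  obtain N where N: "\<And>e. \<forall>i\<ge>n. e i = e0 i \<Longrightarrow> \<exists>T. \<forall>\<gamma>>T. growth p m e \<gamma> < mul N \<gamma>"
    using uniform_bound[OF lin gfam_growth[OF wf] growth_nonneg[OF wf], of n e0] by blast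
  \<comment> \<open>This form of the threshold shows that it depends on \<open>w\<close> alone and
    not on the representatives of its values.\<close>
  define a where "a w = lub {\<alpha>. \<forall>x y. ((w, x) \<in> X \<and> y = f w x) \<and> x \<noteq> 0 \<and> val x < \<alpha> \<and> y \<noteq> 0 \<longrightarrow>
    mul N (val x) < val y}" for w
  have a: "threshold p m N (assign (xs @ ys) e0) = a (xs, gs)"
    if "length xs = m" "length ys = k" "map v ys = map Fin gs" for xs ys gs
    unfolding threshold_def[OF wf] a_def gra_def[symmetric] graph_gs[OF that] ..
  have lift: "\<exists>ys. map v ys = map Fin gs" for gs
  proof -
    have "\<exists>z. \<forall>\<gamma>. z \<gamma> \<noteq> 0 \<and> val (z \<gamma>) = \<gamma>" by (intro choice allI ex_val)
    then obtain z where "\<And>\<gamma>. z \<gamma> \<noteq> 0 \<and> val (z \<gamma>) = \<gamma>" by blast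
    then have "map v (map z gs) = map Fin gs" by (simp add: v_eq)
    then show ?thesis by blast
  qed
  have bound: "Fin (int_mult (int N) \<gamma>) < v (f w x)"
    if w: "w \<in> W" "(w, x) \<in> X" "v x = Fin \<gamma>" "\<gamma> < a w" for w x \<gamma>
  proof -
    obtain xs gs where wxs: "w = (xs, gs)" by (cases w)
    have l: "length xs = m" "length gs = k" using lenW w(1) wxs by auto
    obtain ys where ys: "map v ys = map Fin gs" using lift by blast
    have ly: "length ys = k" using len[OF ys] l by simp
    define e where "e = assign (xs @ ys) e0"
    note g = graph_gs[OF l(1) ly ys, folded e_def, unfolded gra_def]
    have e: "\<forall>i\<ge>n. e i = e0 i" using l ly by (simp add: e_def assign_def n_def)
    have x: "x \<noteq> 0" "val x = \<gamma>" using w(3) by (auto simp: v_eq split: if_splits)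
    show ?thesis
    proof (cases "f w x = 0")
      case True
      then show ?thesis by (simp add: v_eq)
    next
      case False
      have "mul N (val x) < val (f w x)"
      proof (rule threshold_bound[OF wf _ N[OF e]])
        show "graph p m e x (f w x)" unfolding g using w(2) wxs by simp
        show "y = y'" if "graph p m e x y" "graph p m e x y'" for x y y'
          using that unfolding g by simp
        show "val x < threshold p m N e"
          using a[OF l(1) ly ys] w(4) x(2) by (simp add: e_def wxs)
      qed (use x False in auto)
      then show ?thesis using False x by (simp add: v_eq int_mult_mul)
    qed
  qed
  have "definable_value_function L M v m k W a"
    unfolding definable_value_function_def interpretable_def
  proof (intro conjI)
    show "\<forall>(xs, gs)\<in>{(xs, gs @ [a (xs, gs)]) |xs gs. (xs, gs) \<in> W}. length xs = m \<and> length gs = k + 1"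
      using lenW by auto
    define \<rho> where "\<rho> i = (if i < n then i else Suc i)" for i
    \<comment> \<open>As \<open>W\<close> is the projection of \<open>X\<close>, membership in it is
      expressed by the existence of a point on the graph. Entry \<open>n\<close> represents the
      value of \<open>a\<close>.\<close>
    have "dfn {} (\<lambda>e. (\<exists>x y. gra (\<lambda>i. e (\<rho> i)) x y) \<and> e n \<noteq> 0 \<and>
      val (e n) = threshold p m N (\<lambda>i. e (\<rho> i)))"
      unfolding gra_def by (intro dfn_intros dfn_graph[OF wf] dfnG_threshold[OF wf])
    then obtain r where r: "wf_fm L r" "\<And>e. (\<exists>x y. gra (\<lambda>i. e (\<rho> i)) x y) \<and> e n \<noteq> 0 \<and>
      val (e n) = threshold p m N (\<lambda>i. e (\<rho> i)) \<longleftrightarrow> sat M e r"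
      by (rule dfn_empty_formula) blast
    \<comment> \<open>The new place for the value of \<open>a\<close> comes before the
      constants.\<close>
    define e1 where "e1 i = e0 (i - 1)" for i
    have \<rho>: "(\<lambda>i. assign (xs @ ys @ [z]) e1 (\<rho> i)) = assign (xs @ ys) e0"
      "assign (xs @ ys @ [z]) e1 n = z" if "length xs = m" "length ys = k" for xs ys z
      using that by (auto simp: \<rho>_def assign_def n_def e1_def nth_append fun_eq_iff)
    have sat_r: "sat M (assign (xs @ ys @ [z]) e1) r \<longleftrightarrow>
      (\<exists>x y. gra (assign (xs @ ys) e0) x y) \<and> z \<noteq> 0 \<and> val z = threshold p m N (assign (xs @ ys) e0)"
      if "length xs = m" "length ys = k" for xs ys z
      unfolding r(2)[symmetric] \<rho>[OF that] ..
    have "pullback v {(xs, gs @ [a (xs, gs)]) |xs gs. (xs, gs) \<in> W} = solutions M (m + (k + 1)) e1 r"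
    proof (intro set_eqI iffI)
      fix zs assume "zs \<in> pullback v {(xs, gs @ [a (xs, gs)]) |xs gs. (xs, gs) \<in> W}"
      then obtain xs gs ys' where zs: "zs = xs @ ys'" and w: "(xs, gs) \<in> W"
        and ys': "map v ys' = map Fin (gs @ [a (xs, gs)])" unfolding pullback_def by blast
      obtain ys z where ysz: "ys' = ys @ [z]" using ys' by (cases ys' rule: rev_cases) auto
      then have ys: "map v ys = map Fin gs" "v z = Fin (a (xs, gs))" using ys' by auto
      have l: "length xs = m" "length ys = k" using lenW[OF w] len[OF ys(1)] by auto
      obtain x where "((xs, gs), x) \<in> X" using w W by force
      then have "gra (assign (xs @ ys) e0) x (f (xs, gs) x)" unfolding graph_gs[OF l ys(1)] by simp
      moreover have "z \<noteq> 0" "val z = a (xs, gs)" using ys(2) by (auto simp: v_eq split: if_splits)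
      ultimately have "sat M (assign (xs @ ys @ [z]) e1) r"
        unfolding sat_r[OF l] a[OF l ys(1)] by blast
      then show "zs \<in> solutions M (m + (k + 1)) e1 r" using l by (simp add: solutions_def zs ysz)
    next
      fix zs assume "zs \<in> solutions M (m + (k + 1)) e1 r"
      then have lz: "length zs = m + k + 1" and sat: "sat M (assign zs e1) r"
        by (simp_all add: solutions_def)
      define xs ys z where "xs = take m zs" and "ys = take k (drop m zs)" and "z = last zs"
      have zs: "zs = xs @ ys @ [z]"
      proof -
        have "drop m zs = take k (drop m zs) @ drop k (drop m zs)" by (rule append_take_drop_id[symmetric])
        moreover have "drop k (drop m zs) = [z]"
          using lz by (cases zs rule: rev_cases) (auto simp: z_def add.commute)
        ultimately have "drop m zs = ys @ [z]" unfolding ys_def by metis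
        then show ?thesis unfolding xs_def by (metis append_take_drop_id)
      qed
      have l: "length xs = m" "length ys = k" using lz by (simp_all add: xs_def ys_def)
      from sat[unfolded zs sat_r[OF l]] obtain x y where xy: "gra (assign (xs @ ys) e0) x y"
        and z: "z \<noteq> 0" "val z = threshold p m N (assign (xs @ ys) e0)" by blast
      from xy[unfolded graph_iff[OF l]] obtain gs where gs: "map v ys = map Fin gs" "((xs, gs), x) \<in> X"
        by blast
      have "map v (ys @ [z]) = map Fin (gs @ [a (xs, gs)])"
        using gs(1) z a[OF l gs(1)] by (simp add: v_eq)
      moreover have "(xs, gs) \<in> W" using gs(2) W by force
      ultimately show "zs \<in> pullback v {(xs, gs @ [a (xs, gs)]) |xs gs. (xs, gs) \<in> W}"
        unfolding pullback_def zs by blast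
    qed
    then show "definable L M (m + (k + 1)) (pullback v {(xs, gs @ [a (xs, gs)]) |xs gs. (xs, gs) \<in> W})"
      unfolding definable_def using r(1) by (intro exI[of _ r] exI[of _ e1]) simp
  qed
  with bound show "\<exists>(n::int) a. definable_value_function L M v m k W a \<and>
      (\<forall>w\<in>W. \<forall>x. (w, x) \<in> X \<longrightarrow>
        (\<forall>\<gamma>. v x = Fin \<gamma> \<and> \<gamma> < a w \<longrightarrow> v (f w x) > Fin (int_mult n \<gamma>)))"
    by blast
qed

end

theorem theorem4p7:
  fixes L :: "('f vf_fun, 'r vf_rel) lang"
    and M :: "('k::alg_closed_field, 'f vf_fun, 'r vf_rel) struct"
    and v :: "'k \<Rightarrow> 'g::{linordered_ab_group_add, ordered_ab_group_add_abs} extended"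
  assumes "expands_valued_field L M v"
    and "C_minimal L M"
    and "Q_linearly_bounded (L_ind L M v) Gamma_ind"
  shows "uniformly_polynomially_bounded L M v"
proof -
  interpret C_minimal_valued_field L M v
    by unfold_locales (fact assms)+
  show ?thesis by (rule polynomially_bounded) (fact assms(3))
qed

end
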